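(* 1. There exists a unique solution $(x_\infty,\sigma)\in(0,+\infty)^2$ of the system $$W(x_\infty,\sigma)=1,\qquad H(x_\infty,\sigma)=1,$$ where $$W(x_\infty,\sigma)=x_\infty\int_0^1\exp\left(\frac{-\sigma}{1-u^2}\right)du,\qquad H(x_\infty,\sigma)=x_\infty\int_0^{+\infty}\left(1-\exp\left(\frac{-\sigma}{1+u^2}\right)\right)du.$$ 2. With this pair $(x_\infty,\sigma)$, as $K\to+\infty$, $$z_1\longrightarrow x_\infty,\qquad \operatorname{Im}(z_1)\sim\frac{\pi\sigma x_\infty}{2\log K},$$ and, for $z\in\mathbb{C}\setminus\{-x_\infty,x_\infty\}$, $$\eta(z)\longrightarrow\frac{\sigma x_\infty}{2}\left(\frac{-1}{(z-x_\infty)^2}+\frac{1}{(z+x_\infty)^2}\right).$$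
   Context: Let $\mathrm{Sq}=\{x+iy : x\in[-1,1],\ y\in[-1,1]\}\subset\mathbb{C}$. For a real $K>1$, let $\mu$ be the function on $\mathbb{C}$ equal to $\frac{K-1}{K+1}$ on $\mathrm{Sq}$ and to $0$ outside $\mathrm{Sq}$ (the Beltrami form $\mu\, d\bar z/dz$, whose ellipses are vertical with axis ratio $K$ in $\mathrm{Sq}$ and circles outside). Let $\phi:\mathbb{C}\to\mathbb{C}$ be its straightening, i.e. the unique quasiconformal homeomorphism with $\partial_{\bar z}\phi=\mu\,\partial_z\phi$ almost everywhere, normalized by $\phi(z)=z+o(1)$ as $z\to\infty$. Denote the images of the corners by $$z_1=\phi(1+i),\quad z_2=\phi(-1+i),\quad z_3=\phi(-1-i),\quad z_4=\phi(1-i);$$ by symmetry $z_1=x+iy$, $z_2=-x+iy$, $z_3=-x-iy$, $z_4=x-iy$ for some $x,y>0$. These numbers depend on $K$. Define the rational function (also depending on $K$) $$\eta(z)=-\frac{\log K}{2i\pi}\left(\frac1{z-z_1}-\frac1{z-z_2}+\frac1{z-z_3}-\frac1{z-z_4}\right).$$ (It is the distortion derivative $f''/f'$ of the affine charts, in particular of $f=\phi^{-1}$ on $\phi(\mathbb{C}\setminus\mathrm{Sq})$.) *)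

theory Defs
  imports "HOL-Analysis.Analysis" "HOL-Library.Landau_Symbols"
begin

text \<open>
  Weak first order partial derivatives are tested against compactly supported \<open>C\<^sup>1\<close> functions
  \<open>h\<close>, whose partial derivatives \<open>hx\<close>, \<open>hy\<close> are carried along explicitly. Testing against
  compactly supported smooth functions gives the same notion, by mollification.
\<close>

definition test_function ::
  "(complex \<Rightarrow> complex) \<Rightarrow> (complex \<Rightarrow> complex) \<Rightarrow> (complex \<Rightarrow> complex) \<Rightarrow> bool" where
  "test_function h hx hy \<longleftrightarrow>
     (\<forall>z. (h has_derivative (\<lambda>v. Re v *\<^sub>R hx z + Im v *\<^sub>R hy z)) (at z)) \<and>
     continuous_on UNIV hx \<and> continuous_on UNIV hy \<and>
     compact (closure {z. h z \<noteq> 0})"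

definition locally_L2 :: "(complex \<Rightarrow> complex) \<Rightarrow> bool" where
  "locally_L2 f \<longleftrightarrow>
     f \<in> borel_measurable lborel \<and>
     (\<forall>S. compact S \<longrightarrow> set_integrable lborel S (\<lambda>z. (cmod (f z))\<^sup>2))"

text \<open>
  \<open>f\<close> lies in the local Sobolev space \<open>W\<^sup>1\<^sup>,\<^sup>2\<close> of the plane, with weak partial derivatives
  \<open>fx\<close> and \<open>fy\<close> with respect to the real and the imaginary part. These are unique up to null
  sets.
\<close>

definition has_weak_partials ::
  "(complex \<Rightarrow> complex) \<Rightarrow> (complex \<Rightarrow> complex) \<Rightarrow> (complex \<Rightarrow> complex) \<Rightarrow> bool" where
  "has_weak_partials f fx fy \<longleftrightarrow>
     locally_L2 f \<and> locally_L2 fx \<and> locally_L2 fy \<and>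
     (\<forall>h hx hy. test_function h hx hy \<longrightarrow>
        (LINT z|lborel. f z * hx z) = - (LINT z|lborel. fx z * h z) \<and>
        (LINT z|lborel. f z * hy z) = - (LINT z|lborel. fy z * h z))"

definition d_z :: "(complex \<Rightarrow> complex) \<Rightarrow> (complex \<Rightarrow> complex) \<Rightarrow> complex \<Rightarrow> complex" where
  "d_z fx fy z = (fx z - \<i> * fy z) / 2"

definition d_zbar :: "(complex \<Rightarrow> complex) \<Rightarrow> (complex \<Rightarrow> complex) \<Rightarrow> complex \<Rightarrow> complex" where
  "d_zbar fx fy z = (fx z + \<i> * fy z) / 2"

text \<open>
  The analytic definition of quasiconformality. That \<open>f\<close> preserves orientation is contained in
  the inequality, which makes the Jacobian \<open>\<bar>d_z\<bar>\<^sup>2 - \<bar>d_zbar\<bar>\<^sup>2\<close> nonnegative.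
\<close>

definition quasiconformal_homeo :: "(complex \<Rightarrow> complex) \<Rightarrow> bool" where
  "quasiconformal_homeo f \<longleftrightarrow>
     (\<exists>g. homeomorphism UNIV UNIV f g) \<and>
     (\<exists>fx fy. has_weak_partials f fx fy \<and>
        (\<exists>k<1. AE z in lborel. cmod (d_zbar fx fy z) \<le> k * cmod (d_z fx fy z)))"

definition straightening :: "(complex \<Rightarrow> complex) \<Rightarrow> (complex \<Rightarrow> complex) \<Rightarrow> bool" where
  "straightening \<mu> \<phi> \<longleftrightarrow>
     quasiconformal_homeo \<phi> \<and>
     (\<exists>\<phi>x \<phi>y. has_weak_partials \<phi> \<phi>x \<phi>y \<and>
        (AE z in lborel. d_zbar \<phi>x \<phi>y z = \<mu> z * d_z \<phi>x \<phi>y z)) \<and>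
     ((\<lambda>z. \<phi> z - z) \<longlongrightarrow> 0) at_infinity"

definition Sq :: "complex set" where
  "Sq = {z. Re z \<in> {-1..1} \<and> Im z \<in> {-1..1}}"

definition beltrami_Sq :: "real \<Rightarrow> complex \<Rightarrow> complex" where
  "beltrami_Sq K z = (if z \<in> Sq then complex_of_real ((K - 1) / (K + 1)) else 0)"

definition eta :: "real \<Rightarrow> (complex \<Rightarrow> complex) \<Rightarrow> complex \<Rightarrow> complex" where
  "eta K \<phi> z =
     - (complex_of_real (ln K) / (2 * \<i> * complex_of_real pi)) *
       (1 / (z - \<phi> (1 + \<i>)) - 1 / (z - \<phi> (- 1 + \<i>))
        + 1 / (z - \<phi> (- 1 - \<i>)) - 1 / (z - \<phi> (1 - \<i>)))"

text \<open>
  At \<open>u = 1\<close> the integrand of \<open>W\<close> takes the value \<open>1\<close> by the convention on division by zero,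
  which does not affect the integral.
\<close>

definition W :: "real \<Rightarrow> real \<Rightarrow> real" where
  "W x \<sigma> = x * integral {0..1} (\<lambda>u. exp (- \<sigma> / (1 - u\<^sup>2)))"

definition H :: "real \<Rightarrow> real \<Rightarrow> real" where
  "H x \<sigma> = x * integral {0..} (\<lambda>u. 1 - exp (- \<sigma> / (1 + u\<^sup>2)))"

end

theory Submission
  imports Defs "HOL-Complex_Analysis.Complex_Analysis" "HOL-Real_Asymp.Real_Asymp"
begin

text \<open>
  A straightening \<open>\<phi>\<close> is conformal for a flat structure with singularities at the corners of
  \<open>Sq\<close>. Outside \<open>Sq\<close> this is the structure of the plane; inside it is that of the rectangle obtained by
  stretching \<open>Sq\<close> horizontally by the factor \<open>K\<close>. Across the vertical edges the two sides fit
  together by a translation, across the horizontal edges by a similarity of ratio \<open>K\<close>. So every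
  point other than a corner lies in the image of a chart \<open>E\<close> with \<open>\<phi> \<circ> E\<close> holomorphic, first off a
  straight line, by Weyl's lemma (\<open>weak_beltrami_imp_holomorphic\<close>), and then across it. For two
  solutions, \<open>\<phi>\<^sub>2 \<circ> \<phi>\<^sub>1\<^sup>-\<^sup>1\<close> is then entire and its difference to the identity tends to zero at infinity,
  so it is the identity (\<open>square_solution_unique\<close>). This gives the symmetries of \<open>\<phi>\<close>.

  Changes of charts are affine, so \<open>f'' / f'\<close> with \<open>f = (\<phi> \<circ> E)\<^sup>-\<^sup>1\<close> does not depend on the chart and is
  one holomorphic function on the complement of the four points \<open>z\<^sub>j\<close>. It vanishes at
  infinity. At a corner, the logarithm of the affine coordinate lives on a half plane modulo the
  translation by \<open>2 \<pi> i - ln K\<close>; the exponential that uniformizes this quotient shows that \<open>f'' / f'\<close>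
  has a simple pole with residue \<open>\<plusminus> i ln K / (2 \<pi>)\<close> (\<open>chart_eta_residue\<close>). By Liouville's theorem it
  equals \<open>\<eta>\<close> (\<open>chart_eta_eq_eta\<close>).

  On each axis, \<open>\<phi>\<close> in a chart is a real function \<open>\<theta>\<close> with \<open>\<theta>'' = P'(\<theta>) \<theta>'\<^sup>2\<close>, where \<open>P\<close> is
  a primitive of \<open>- \<eta>\<close> along the axis, so that \<open>\<theta>' = exp (P \<theta>)\<close>. Here \<open>P\<close> is \<open>\<plusminus> ln K / \<pi>\<close> times
  the angle under which a side of the rectangle \<open>z\<^sub>1 z\<^sub>2 z\<^sub>3 z\<^sub>4\<close> parallel to the axis is seen. Comparing
  heights and widths of \<open>Sq\<close> in the chart with their images yields exact equations for
  \<open>x = Re z\<^sub>1\<close>, \<open>y = Im z\<^sub>1\<close> and \<open>\<phi> 1\<close> (\<open>height_equation\<close>, \<open>width_equations\<close>).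

  Put \<open>\<lambda> = ln K / \<pi>\<close> and \<open>r = y / x\<close>. The equations keep \<open>2 \<lambda> r\<close> and \<open>1 / x\<close> bounded, so that
  \<open>r \<longrightarrow> 0\<close> (\<open>uniform_bounds\<close>), and keep \<open>\<phi> 1 / x\<close> from staying below 1 (\<open>om_ge\<close>). If \<open>2 \<lambda> r \<longrightarrow> s\<close> along a sequence, then the exponents
  converge and dominated convergence turns the equations into \<open>W (lim x) s = 1\<close> and
  \<open>H (lim x) s = 1\<close>. The integral in \<open>W\<close> decreases with \<open>s\<close> and that in \<open>H\<close> increases, so there is only
  one such \<open>s\<close>, and by compactness \<open>2 \<lambda> r\<close> converges to it. The remaining claims follow from
  \<open>y ln K = \<pi> x (2 \<lambda> r) / 2\<close>.
\<close>

section \<open>Regularity of weak solutions of a Beltrami equation with constant coefficient\<close>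

text \<open>
  A kernel of class \<open>C\<^sup>1\<close> supported in the disc of radius \<open>e\<close>, given by a polynomial on the disc. The
  functions \<open>bump_x\<close> and \<open>bump_y\<close> are its partial derivatives.
\<close>

definition bump :: "real \<Rightarrow> complex \<Rightarrow> real" where
  "bump e w = (max 0 (e\<^sup>2 - (Re w)\<^sup>2 - (Im w)\<^sup>2))\<^sup>2"
definition bump_x :: "real \<Rightarrow> complex \<Rightarrow> real" where
  "bump_x e w = - 4 * Re w * max 0 (e\<^sup>2 - (Re w)\<^sup>2 - (Im w)\<^sup>2)"
definition bump_y :: "real \<Rightarrow> complex \<Rightarrow> real" where
  "bump_y e w = - 4 * Im w * max 0 (e\<^sup>2 - (Re w)\<^sup>2 - (Im w)\<^sup>2)"

lemma DERIV_positive_part_square: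
  "((\<lambda>t::real. (max 0 t)\<^sup>2) has_real_derivative 2 * max 0 t) (at t)"
proof (cases "t = 0")
  case True
  have "((\<lambda>h::real. (max 0 h)\<^sup>2 / h) \<longlongrightarrow> 0) (at 0)"
  proof (rule Lim_null_comparison)
    show "\<forall>\<^sub>F h in at 0. norm ((max 0 h)\<^sup>2 / h :: real) \<le> \<bar>h\<bar>"
      by (rule always_eventually) (auto simp: max_def power2_eq_square)
  qed (auto intro!: tendsto_eq_intros)
  then show ?thesis using True by (simp add: DERIV_def)
next
  case False
  then consider "t > 0" | "t < 0" by linarith
  then show ?thesis
  proof cases
    case 1
    have "((\<lambda>t::real. t\<^sup>2) has_real_derivative 2 * max 0 t) (at t)"
      using 1 by (auto intro!: derivative_eq_intros)
    then show ?thesis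
      by (rule has_field_derivative_transform_within_open[of _ _ _ "{0<..}"]) (use 1 in auto)
  next
    case 2
    have "((\<lambda>t::real. 0) has_real_derivative 2 * max 0 t) (at t)"
      using 2 by (auto intro!: derivative_eq_intros)
    then show ?thesis
      by (rule has_field_derivative_transform_within_open[of _ _ _ "{..<0}"]) (use 2 in auto)
  qed
qed

lemma has_derivative_bump:
  "(bump e has_derivative (\<lambda>v. Re v * bump_x e w + Im v * bump_y e w)) (at w)"
proof -
  have d: "((\<lambda>w::complex. e\<^sup>2 - (Re w)\<^sup>2 - (Im w)\<^sup>2) has_derivative
        (\<lambda>v. - 2 * Re w * Re v - 2 * Im w * Im v)) (at w)"
    by (auto intro!: derivative_eq_intros)
  have "((\<lambda>w. (max 0 (e\<^sup>2 - (Re w)\<^sup>2 - (Im w)\<^sup>2))\<^sup>2) has_derivative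
        (\<lambda>v. (2 * max 0 (e\<^sup>2 - (Re w)\<^sup>2 - (Im w)\<^sup>2)) * (- 2 * Re w * Re v - 2 * Im w * Im v))) (at w)"
    using has_derivative_compose[OF d DERIV_positive_part_square[unfolded has_field_derivative_def]]
    by (simp add: o_def)
  then have "(bump e has_derivative
        (\<lambda>v. (2 * max 0 (e\<^sup>2 - (Re w)\<^sup>2 - (Im w)\<^sup>2)) * (- 2 * Re w * Re v - 2 * Im w * Im v))) (at w)"
    by (simp only: bump_def[abs_def])
  then show ?thesis
    by (rule has_derivative_eq_rhs) (simp add: bump_x_def bump_y_def fun_eq_iff algebra_simps)
qed

lemma continuous_on_bump [continuous_intros]:
  assumes "continuous_on S f"
  shows "continuous_on S (\<lambda>x. bump e (f x))" "continuous_on S (\<lambda>x. bump_x e (f x))"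
    "continuous_on S (\<lambda>x. bump_y e (f x))"
  unfolding bump_def bump_x_def bump_y_def by (intro continuous_intros assms)+

lemma bump_nonneg: "bump e w \<ge> 0" by (simp add: bump_def)

lemma bump_eq_0:
  assumes "cmod w \<ge> e" "e > 0"
  shows "bump e w = 0" "bump_x e w = 0" "bump_y e w = 0"
proof -
  have "e\<^sup>2 \<le> (cmod w)\<^sup>2" using assms by (intro power_mono) auto
  then have "e\<^sup>2 - (Re w)\<^sup>2 - (Im w)\<^sup>2 \<le> 0" by (simp add: cmod_power2)
  then show "bump e w = 0" "bump_x e w = 0" "bump_y e w = 0"
    unfolding bump_def bump_x_def bump_y_def by auto
qed

lemma test_function_bump:
  assumes "e > 0"
  shows "test_function (\<lambda>w. of_real (bump e (w - z))) (\<lambda>w. of_real (bump_x e (w - z)))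
     (\<lambda>w. of_real (bump_y e (w - z)))"
  unfolding test_function_def
proof (intro conjI allI)
  fix w
  have "((\<lambda>w. w - z) has_derivative (\<lambda>v. v)) (at w)" by (auto intro!: derivative_eq_intros)
  from has_derivative_compose[OF this has_derivative_bump]
  have "((\<lambda>w. bump e (w - z)) has_derivative (\<lambda>v. Re v * bump_x e (w - z) + Im v * bump_y e (w - z))) (at w)"
    .
  from has_derivative_of_real[OF this, where 'a=complex]
  show "((\<lambda>w. complex_of_real (bump e (w - z))) has_derivative
       (\<lambda>v. Re v *\<^sub>R complex_of_real (bump_x e (w - z)) + Im v *\<^sub>R complex_of_real (bump_y e (w - z)))) (at w)"
    by (simp add: scaleR_conv_of_real)
next
  have "{w. complex_of_real (bump e (w - z)) \<noteq> 0} \<subseteq> cball z e"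
  proof
    fix w assume "w \<in> {w. complex_of_real (bump e (w - z)) \<noteq> 0}"
    then have "\<not> cmod (w - z) \<ge> e" using bump_eq_0(1)[OF _ assms] by auto
    then show "w \<in> cball z e" by (simp add: dist_norm norm_minus_commute)
  qed
  then have "bounded {w. complex_of_real (bump e (w - z)) \<noteq> 0}"
    using bounded_cball bounded_subset by blast
  then show "compact (closure {w. complex_of_real (bump e (w - z)) \<noteq> 0})"
    by (simp add: compact_closure)
qed (intro continuous_intros)+

lemma integrable_continuous_supported:
  fixes f :: "'a::euclidean_space \<Rightarrow> 'b::euclidean_space"
  assumes "continuous_on UNIV f" "compact C" "\<And>x. x \<notin> C \<Longrightarrow> f x = 0"
  shows "integrable lborel f" "integral C f = integral\<^sup>L lborel f"
proof -
  have "integrable lborel (\<lambda>x. indicator C x *\<^sub>R f x)"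
    by (rule borel_integrable_compact) (use assms continuous_on_subset[OF assms(1)] in auto)
  also have "(\<lambda>x. indicator C x *\<^sub>R f x) = f"
    using assms(3) by (auto simp: indicator_def)
  finally show i: "integrable lborel f" .
  have "(f has_integral integral\<^sup>L lborel f) UNIV"
    by (rule has_integral_integral_lborel[OF i])
  moreover have "integral UNIV (\<lambda>x. if x \<in> C then f x else 0) = integral C f"
    by (rule integral_restrict_UNIV)
  moreover have "(\<lambda>x. if x \<in> C then f x else 0) = f" using assms(3) by auto
  ultimately show "integral C f = integral\<^sup>L lborel f"
    by (simp add: integral_unique)
qed

text \<open>
  The equation is \<open>(1 - m) \<phi>\<^sub>x + i (1 + m) \<phi>\<^sub>y = 0\<close>; integration by parts moves the derivatives to the
  test function, on whose support \<open>\<mu>\<close> is constant.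
\<close>

lemma weak_beltrami_tested:
  fixes \<phi> h hx hy :: "complex \<Rightarrow> complex" and m :: real
  assumes w: "has_weak_partials \<phi> \<phi>x \<phi>y"
    and b: "AE z in lborel. d_zbar \<phi>x \<phi>y z = \<mu> z * d_z \<phi>x \<phi>y z"
    and c: "continuous_on UNIV \<phi>"
    and h: "test_function h hx hy"
    and C: "compact C" "\<And>z. z \<notin> C \<Longrightarrow> h z = 0" "\<And>z. z \<notin> C \<Longrightarrow> hx z = 0" "\<And>z. z \<notin> C \<Longrightarrow> hy z = 0"
    and m: "\<And>z. z \<in> C \<Longrightarrow> \<mu> z = of_real m"
  shows "(LINT z|lborel. \<phi> z * ((1 - m) * hx z + \<i> * (1 + m) * hy z)) = 0"
proof -
  have ch: "continuous_on UNIV h"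
    using h unfolding test_function_def
    by (intro continuous_at_imp_continuous_on) (blast intro: has_derivative_continuous)
  have chx: "continuous_on UNIV hx" and chy: "continuous_on UNIV hy"
    using h by (auto simp: test_function_def)
  have ix: "integrable lborel (\<lambda>z. \<phi> z * hx z)"
    by (rule integrable_continuous_supported(1)[OF _ C(1)]) (simp_all add: C c chx continuous_on_mult)
  have iy: "integrable lborel (\<lambda>z. \<phi> z * hy z)"
    by (rule integrable_continuous_supported(1)[OF _ C(1)]) (simp_all add: C c chy continuous_on_mult)
  have "compact (h ` C)" using compact_continuous_image[OF _ C(1)] ch continuous_on_subset by blast
  then obtain M where M: "\<And>z. z \<in> C \<Longrightarrow> cmod (h z) \<le> M"
    using compact_imp_bounded bounded_iff by (metis imageI)
  have int: "integrable lborel (\<lambda>z. f z * h z)" if "locally_L2 f" for f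
  proof (rule Bochner_Integration.integrable_bound)
    have "set_integrable lborel C (\<lambda>z. (cmod (f z))\<^sup>2)"
      using that C(1) by (auto simp: locally_L2_def)
    moreover have "set_integrable lborel C (\<lambda>z. 1::real)"
      unfolding set_integrable_def by (rule borel_integrable_compact) (use C in auto)
    ultimately have "set_integrable lborel C (\<lambda>z. \<bar>M\<bar> * (1 + (cmod (f z))\<^sup>2))"
      by (intro set_integrable_mult_right set_integral_add)
    then show "integrable lborel (\<lambda>z. indicator C z *\<^sub>R (\<bar>M\<bar> * (1 + (cmod (f z))\<^sup>2)))"
      by (simp add: set_integrable_def)
    have "h \<in> borel_measurable lborel"
      using borel_measurable_continuous_onI[OF ch] by simp
    then show "(\<lambda>z. f z * h z) \<in> borel_measurable lborel"
      using that by (auto simp: locally_L2_def)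
    show "AE z in lborel. norm (f z * h z) \<le> norm (indicator C z *\<^sub>R (\<bar>M\<bar> * (1 + (cmod (f z))\<^sup>2)))"
    proof (rule AE_I2)
      fix z
      have "cmod (f z) \<le> 1 + (cmod (f z))\<^sup>2"
        using sum_power2_ge_zero[of "cmod (f z) - 1" 0] by (simp add: power2_eq_square algebra_simps) (smt (verit) norm_ge_zero)
      moreover have "cmod (h z) \<le> \<bar>M\<bar>" if "z \<in> C" using M[OF that] by simp
      ultimately have "z \<in> C \<Longrightarrow> cmod (f z) * cmod (h z) \<le> (1 + (cmod (f z))\<^sup>2) * \<bar>M\<bar>"
        by (intro mult_mono) auto
      then show "norm (f z * h z) \<le> norm (indicator C z *\<^sub>R (\<bar>M\<bar> * (1 + (cmod (f z))\<^sup>2)))"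
        using C(2)[of z] by (cases "z \<in> C") (auto simp: norm_mult mult.commute abs_mult)
    qed
  qed
  have L: "locally_L2 \<phi>x" "locally_L2 \<phi>y" using w by (auto simp: has_weak_partials_def)
  have wx: "(LINT z|lborel. \<phi> z * hx z) = - (LINT z|lborel. \<phi>x z * h z)"
    and wy: "(LINT z|lborel. \<phi> z * hy z) = - (LINT z|lborel. \<phi>y z * h z)"
    using w h by (auto simp: has_weak_partials_def)
  have "(LINT z|lborel. \<phi> z * ((1 - m) * hx z + \<i> * (1 + m) * hy z)) =
     (LINT z|lborel. (1 - m) * (\<phi> z * hx z) + \<i> * (1 + m) * (\<phi> z * hy z))"
    by (simp add: algebra_simps)
  also have "\<dots> = (1 - m) * (LINT z|lborel. \<phi> z * hx z) + \<i> * (1 + m) * (LINT z|lborel. \<phi> z * hy z)"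
    using ix iy by (subst Bochner_Integration.integral_add) auto
  also have "\<dots> = - ((1 - m) * (LINT z|lborel. \<phi>x z * h z) + \<i> * (1 + m) * (LINT z|lborel. \<phi>y z * h z))"
    by (simp add: wx wy)
  also have "\<dots> = - (LINT z|lborel. (1 - m) * (\<phi>x z * h z) + \<i> * (1 + m) * (\<phi>y z * h z))"
    using int[OF L(1)] int[OF L(2)] by (subst Bochner_Integration.integral_add) auto
  also have "(LINT z|lborel. (1 - m) * (\<phi>x z * h z) + \<i> * (1 + m) * (\<phi>y z * h z)) = (LINT z::complex|lborel. 0)"
  proof (rule Bochner_Integration.integral_cong_AE)
    show "AE z in lborel. (1 - m) * (\<phi>x z * h z) + \<i> * (1 + m) * (\<phi>y z * h z) = 0"
      using b
    proof eventually_elim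
      case (elim z)
      show ?case
      proof (cases "z \<in> C")
        case True
        have "(1 - m) * \<phi>x z + \<i> * (1 + m) * \<phi>y z = 0"
        proof -
          have "\<phi>x z + \<i> * \<phi>y z = m * (\<phi>x z - \<i> * \<phi>y z)"
          proof -
            have "(\<phi>x z + \<i> * \<phi>y z) / 2 = (m * (\<phi>x z - \<i> * \<phi>y z)) / 2"
              using elim unfolding m[OF True] d_zbar_def d_z_def by (simp only: times_divide_eq_right)
            then show ?thesis by (simp only: divide_cancel_right) simp
          qed
          then show ?thesis by (simp add: algebra_simps)
        qed
        then have "((1 - m) * \<phi>x z + \<i> * (1 + m) * \<phi>y z) * h z = 0" by simp
        then show ?thesis by (simp add: algebra_simps)
      qed (simp add: C)
    qed
    show "(\<lambda>z. (1 - m) * (\<phi>x z * h z) + \<i> * (1 + m) * (\<phi>y z * h z)) \<in> borel_measurable lborel"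
      using borel_measurable_integrable[OF int[OF L(1)]] borel_measurable_integrable[OF int[OF L(2)]]
      by measurable
  qed simp
  finally show ?thesis by simp
qed

lemma bump_integral_pos:
  assumes "e > 0"
  shows "(LINT w|lborel. bump e w) > 0"
proof (rule ccontr)
  assume *: "\<not> (LINT w|lborel. bump e w) > 0"
  have "bounded (cball (0::complex) e)" by simp
  then obtain a where a: "cball (0::complex) e \<subseteq> cbox (-a) a"
    using bounded_subset_cbox_symmetric by blast
  have z: "bump e w = 0" if "w \<notin> cbox (-a) a" for w
    using bump_eq_0(1)[of e w] that a assms by (force simp: dist_norm)
  have c: "continuous_on UNIV (bump e)" using continuous_on_bump(1)[OF continuous_on_id] by simp
  have I: "integral (cbox (-a) a) (bump e) = (LINT w|lborel. bump e w)"
    by (rule integrable_continuous_supported(2)[OF c compact_cbox z])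
  have "(LINT w|lborel. bump e w) \<ge> 0" by (simp add: bump_nonneg)
  then have "integral (cbox (-a) a) (bump e) = 0" using * I by simp
  moreover have "bump e integrable_on cbox (-a) a"
    by (rule integrable_continuous) (use c continuous_on_subset in blast)
  ultimately have "(bump e has_integral 0) (cbox (-a) a)"
    by (metis integrable_integral)
  moreover have "ball (0::complex) e \<subseteq> cbox (-a) a" using a ball_subset_cball by blast
  then have "box (-a) a \<noteq> {}"
    using assms interior_maximal[of "ball 0 e" "cbox (-a) a"] by (auto simp: interior_cbox)
  ultimately have "bump e 0 = 0"
    by (intro has_integral_0_cbox_imp_0[of "-a" a "bump e" 0])
      (use continuous_on_subset[OF c subset_UNIV] bump_nonneg a assms in \<open>simp_all add: subset_iff\<close>)
  then show False using assms by (simp add: bump_def)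
qed

lemma bump_integral_translate:
  "(LINT w|lborel. bump e (w - z)) = (LINT w|lborel. bump e w)"
proof -
  have m: "bump e \<in> borel_measurable borel"
    by (intro borel_measurable_continuous_onI continuous_on_bump(1)[OF continuous_on_id])
  have "(LINT w|lborel. bump e w) = (LINT w|distr lborel borel ((+) (- z)). bump e w)"
    by (simp add: lborel_distr_plus)
  also have "\<dots> = (LINT w|lborel. bump e (- z + w))"
    using m by (intro integral_distr) auto
  finally show ?thesis by simp
qed

lemma mollified_has_derivative:
  fixes \<phi> :: "complex \<Rightarrow> complex"
  assumes c: "continuous_on UNIV \<phi>" and B: "open B" "convex B" "z \<in> B"
  shows "((\<lambda>z. integral (cbox a b) (\<lambda>w. \<phi> w * of_real (bump e (w - z)))) has_derivative
     (\<lambda>v. - of_real (Re v) * integral (cbox a b) (\<lambda>w. \<phi> w * of_real (bump_x e (w - z)))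
          - of_real (Im v) * integral (cbox a b) (\<lambda>w. \<phi> w * of_real (bump_y e (w - z))))) (at z)"
proof -
  define D where "D z w v = \<phi> w * (- (of_real (Re v * bump_x e (w - z) + Im v * bump_y e (w - z))))" for z w v
  define fx where "fx z w = Blinfun (D z w)" for z w
  have D: "bounded_linear (D z w)" for z w
  proof (rule linear_conv_bounded_linear[THEN iffD1], rule linearI)
    show "D z w (b1 + b2) = D z w b1 + D z w b2" "D z w (r *\<^sub>R b) = r *\<^sub>R D z w b" for b1 b2 r b
      by (simp_all add: D_def scaleR_conv_of_real algebra_simps)
  qed
  have fx: "blinfun_apply (fx z w) = D z w" for z w
    by (simp add: fx_def bounded_linear_Blinfun_apply[OF D])
  have cc: "continuous_on S (\<lambda>x. \<phi> (f x))" if "continuous_on S f" for S and f :: "complex \<times> complex \<Rightarrow> complex"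
    using continuous_on_compose2[OF c that] by simp
  have cs: "continuous_on S \<phi>" for S using c continuous_on_subset by blast
  have cont: "continuous_on (B \<times> cbox a b) (\<lambda>(x, t). fx x t)"
  proof (rule continuous_on_blinfun_componentwise)
    fix i :: complex assume "i \<in> Basis"
    show "continuous_on (B \<times> cbox a b) (\<lambda>x. blinfun_apply (case x of (x, t) \<Rightarrow> fx x t) i)"
      unfolding case_prod_beta fx D_def by (intro continuous_intros cc)
  qed
  have "((\<lambda>z. integral (cbox a b) (\<lambda>w. \<phi> w * of_real (bump e (w - z)))) has_derivative
      blinfun_apply (integral (cbox a b) (fx z))) (at z within B)"
  proof (rule leibniz_rule[OF _ _ cont B(3,2)])
    fix x t assume "x \<in> B" "t \<in> cbox a b"
    have d: "((\<lambda>x. t - x) has_derivative (\<lambda>v. - v)) (at x)"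
      by (auto intro!: derivative_eq_intros)
    have "((\<lambda>x. \<phi> t * of_real (bump e (t - x))) has_derivative (\<lambda>v. \<phi> t * of_real (Re (- v) * bump_x e (t - x) + Im (- v) * bump_y e (t - x)))) (at x)"
      by (intro has_derivative_mult_right has_derivative_of_real has_derivative_compose[OF d has_derivative_bump])
    then show "((\<lambda>x. \<phi> t * of_real (bump e (t - x))) has_derivative blinfun_apply (fx x t)) (at x within B)"
    proof (rule has_derivative_eq_rhs[OF has_derivative_at_withinI])
      show "(\<lambda>v. \<phi> t * of_real (Re (- v) * bump_x e (t - x) + Im (- v) * bump_y e (t - x))) = blinfun_apply (fx x t)"
        unfolding fx D_def by (rule ext) simp
    qed
  next
    fix x
    show "(\<lambda>t. \<phi> t * of_real (bump e (t - x))) integrable_on cbox a b"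
      by (intro integrable_continuous continuous_intros cs)
  qed
  then have *: "((\<lambda>z. integral (cbox a b) (\<lambda>w. \<phi> w * of_real (bump e (w - z)))) has_derivative
      blinfun_apply (integral (cbox a b) (fx z))) (at z)"
    unfolding at_within_open[OF B(3,1)] .
  have i: "fx z integrable_on cbox a b"
  proof (rule integrable_continuous)
    have "continuous_on (cbox a b) (\<lambda>w. case (z, w) of (x, t) \<Rightarrow> fx x t)"
      by (rule continuous_on_compose2[OF cont]) (use B in \<open>auto intro!: continuous_intros\<close>)
    then show "continuous_on (cbox a b) (fx z)" by simp
  qed
  have ix: "(\<lambda>w. \<phi> w * of_real (bump_x e (w - z))) integrable_on cbox a b"
    and iy: "(\<lambda>w. \<phi> w * of_real (bump_y e (w - z))) integrable_on cbox a b"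
    by (intro integrable_continuous continuous_intros cs)+
  have "blinfun_apply (integral (cbox a b) (fx z)) v =
      - of_real (Re v) * integral (cbox a b) (\<lambda>w. \<phi> w * of_real (bump_x e (w - z)))
          - of_real (Im v) * integral (cbox a b) (\<lambda>w. \<phi> w * of_real (bump_y e (w - z)))" for v
  proof -
    have "blinfun_apply (integral (cbox a b) (fx z)) v = integral (cbox a b) (\<lambda>w. D z w v)"
      by (simp add: blinfun_apply_integral[OF i] fx)
    also have "\<dots> = integral (cbox a b) (\<lambda>w. - of_real (Re v) * (\<phi> w * of_real (bump_x e (w - z)))
        - of_real (Im v) * (\<phi> w * of_real (bump_y e (w - z))))"
      by (rule integral_cong) (simp add: D_def algebra_simps)
    also have "\<dots> = integral (cbox a b) (\<lambda>w. - of_real (Re v) * (\<phi> w * of_real (bump_x e (w - z))))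
        - integral (cbox a b) (\<lambda>w. of_real (Im v) * (\<phi> w * of_real (bump_y e (w - z))))"
      by (intro Henstock_Kurzweil_Integration.integral_diff integrable_on_mult_right ix iy)
    finally show ?thesis by simp
  qed
  from has_derivative_eq_rhs[OF * ext, OF this] show ?thesis .
qed

text \<open>
  Weyl's lemma. The mollification of \<open>\<phi>\<close> is \<open>C\<^sup>1\<close> and satisfies the same equation with constant
  coefficient, because the derivatives fall on the kernel. After the linear change of variables
  that makes the equation the Cauchy-Riemann equation it is holomorphic, and holomorphy survives
  the locally uniform limit.
\<close>

lemma weak_beltrami_imp_holomorphic:
  fixes \<phi> :: "complex \<Rightarrow> complex" and m :: real
  assumes c: "continuous_on UNIV \<phi>" and U: "open U" and m: "\<bar>m\<bar> < 1"
    and test: "\<And>e z. e > 0 \<Longrightarrow> cball z e \<subseteq> U \<Longrightarrow>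
      (LINT w|lborel. \<phi> w * ((1 - m) * bump_x e (w - z) + \<i> * (1 + m) * bump_y e (w - z))) = 0"
  shows "(\<lambda>w. \<phi> (Complex ((1 - m) / (1 + m) * Re w) (Im w))) holomorphic_on
     {w. Complex ((1 - m) / (1 + m) * Re w) (Im w) \<in> U}"
proof -
  define r where "r = (1 - m) / (1 + m)"
  have r: "r > 0" using m by (simp add: r_def)
  define A where "A w = Complex (r * Re w) (Im w)" for w
  have A': "(A has_derivative A) (at w)" for w
  proof -
    have "bounded_linear A"
      by (rule linear_conv_bounded_linear[THEN iffD1], rule linearI)
        (auto simp: A_def complex_eq_iff algebra_simps)
    then show ?thesis by (rule bounded_linear_imp_has_derivative)
  qed
  have cA: "continuous_on S A" for S
    using has_derivative_continuous[OF A'] by (intro continuous_at_imp_continuous_on) blast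
  have loc: "\<exists>N. open N \<and> w0 \<in> N \<and> (\<phi> \<circ> A) holomorphic_on N" if "A w0 \<in> U" for w0
  proof -
    define z0 where "z0 = A w0"
    from that have "z0 \<in> U" by (simp only: z0_def)
    then obtain d' where "d' > 0" "cball z0 d' \<subseteq> U" using U by (meson open_contains_cball_eq)
    define d where "d = d' / 2"
    have d: "d > 0" "cball z0 (2 * d) \<subseteq> U"
      using \<open>d' > 0\<close> \<open>cball z0 d' \<subseteq> U\<close> by (auto simp: d_def)
    obtain a where a: "cball z0 (2 * d) \<subseteq> cbox (-a) a"
      using bounded_subset_cbox_symmetric[OF bounded_cball] by blast
    define N where "N = A -` ball z0 d"
    have N: "open N" "w0 \<in> N"
      using d open_vimage[OF open_ball cA[of UNIV]] by (auto simp: N_def z0_def)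
    \<comment> \<open>Mollification radii at most \<open>d\<close>, so that the discs around points of \<open>ball z0 d\<close> stay in \<open>U\<close>.\<close>
    define e where "e n = d / (real n + 1)" for n
    have e: "e n > 0" "e n \<le> d" for n
      using d by (auto simp: e_def field_simps)
    define c0 where "c0 n = (LINT w|lborel. bump (e n) w)" for n
    have c0: "c0 n > 0" for n unfolding c0_def by (rule bump_integral_pos[OF e(1)])
    define F where "F n z = integral (cbox (-a) a) (\<lambda>w. \<phi> w * of_real (bump (e n) (w - z)))" for n z
    have sup: "bump (e n) (w - z) = 0 \<and> bump_x (e n) (w - z) = 0 \<and> bump_y (e n) (w - z) = 0"
      if "z \<in> ball z0 d" "w \<notin> cbox (-a) a" for n w z
    proof -
      have "w \<notin> cball z0 (2 * d)" using that a by blast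
      then have "dist z0 w > 2 * d" "dist z0 z < d" using that by auto
      then have "dist z w > d" using dist_triangle[of z0 w z] by linarith
      then have "cmod (w - z) \<ge> e n" using e[of n] by (simp add: dist_norm norm_minus_commute)
      then show ?thesis using bump_eq_0[OF _ e(1)] by blast
    qed
    define f where "f n w = F n (A w) / c0 n" for n w
    have hol: "f n holomorphic_on N" for n
    proof -
      have "\<exists>D. (f n has_field_derivative D) (at w)" if "w \<in> N" for w
      proof -
        define z where "z = A w"
        have z: "z \<in> ball z0 d" using that by (simp add: N_def z_def)
        define P where "P = integral (cbox (-a) a) (\<lambda>w. \<phi> w * of_real (bump_x (e n) (w - z)))"
        define Q where "Q = integral (cbox (-a) a) (\<lambda>w. \<phi> w * of_real (bump_y (e n) (w - z)))"
        have PL: "P = (LINT w|lborel. \<phi> w * of_real (bump_x (e n) (w - z)))"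
          "integrable lborel (\<lambda>w. \<phi> w * of_real (bump_x (e n) (w - z)))"
          unfolding P_def using sup[OF z]
          by (auto intro!: integrable_continuous_supported[OF _ compact_cbox[of "-a" a]] continuous_intros c)
        have QL: "Q = (LINT w|lborel. \<phi> w * of_real (bump_y (e n) (w - z)))"
          "integrable lborel (\<lambda>w. \<phi> w * of_real (bump_y (e n) (w - z)))"
          unfolding Q_def using sup[OF z]
          by (auto intro!: integrable_continuous_supported[OF _ compact_cbox[of "-a" a]] continuous_intros c)
        have "cball z (e n) \<subseteq> U"
        proof -
          have "cball z (e n) \<subseteq> cball z0 (2 * d)"
          proof
            fix v assume "v \<in> cball z (e n)"
            then show "v \<in> cball z0 (2 * d)"
              using z e(2)[of n] dist_triangle[of z0 v z] by simp
          qed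
          then show ?thesis using d by blast
        qed
        then have "0 = (LINT w|lborel. \<phi> w * ((1 - m) * bump_x (e n) (w - z) + \<i> * (1 + m) * bump_y (e n) (w - z)))"
          using test e by simp
        also have "\<dots> = (LINT w|lborel. (1 - m) * (\<phi> w * bump_x (e n) (w - z)) + \<i> * (1 + m) * (\<phi> w * bump_y (e n) (w - z)))"
          by (simp add: algebra_simps)
        also have "\<dots> = (1 - m) * P + \<i> * (1 + m) * Q"
          unfolding PL QL using PL(2) QL(2) by (subst Bochner_Integration.integral_add) auto
        finally have PQ: "(1 - m) * P + \<i> * (1 + m) * Q = 0" by simp
        have "of_real (1 + m) \<noteq> (0::complex)" using m by (simp only: of_real_eq_0_iff)
        then have Q: "Q = \<i> * r * P"
        proof -
          have "\<i> * ((1 - m) * P + \<i> * (1 + m) * Q) = 0" using PQ by simp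
          then have "(1 + m) * Q = \<i> * (1 - m) * P" by (simp add: algebra_simps)
          then show ?thesis using \<open>of_real (1 + m) \<noteq> (0::complex)\<close> unfolding r_def of_real_divide
            by (simp add: field_simps)
        qed
        have "(F n has_derivative (\<lambda>v. - of_real (Re v) * P - of_real (Im v) * Q)) (at z)"
          unfolding F_def P_def Q_def
          by (rule mollified_has_derivative[OF c open_ball convex_ball z])
        then have "((\<lambda>w. F n (A w)) has_derivative (\<lambda>v. - of_real (Re (A v)) * P - of_real (Im (A v)) * Q)) (at w)"
          unfolding z_def by (rule has_derivative_compose[OF A'])
        moreover have "(\<lambda>v. - of_real (Re (A v)) * P - of_real (Im (A v)) * Q) = (*) (- (r * P))"
          unfolding Q by (rule ext) (simp add: A_def complex_eq_iff algebra_simps)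
        ultimately have "((\<lambda>w. F n (A w)) has_field_derivative (- (r * P))) (at w)"
          by (simp add: has_field_derivative_def)
        from DERIV_cdivide[OF this] show ?thesis unfolding f_def by blast
      qed
      then show ?thesis using N(1) by (simp add: holomorphic_on_open)
    qed
    have unif: "uniform_limit N f (\<phi> \<circ> A) sequentially"
      unfolding uniform_limit_iff
    proof (intro allI impI)
      fix \<epsilon> :: real assume \<epsilon>: "\<epsilon> > 0"
      have "uniformly_continuous_on (cball z0 (2 * d)) \<phi>"
        by (intro compact_uniformly_continuous compact_cball continuous_on_subset[OF c]) auto
      then obtain t where t: "t > 0" "\<And>x x'. x \<in> cball z0 (2 * d) \<Longrightarrow> x' \<in> cball z0 (2 * d) \<Longrightarrow> dist x' x < t \<Longrightarrow> dist (\<phi> x') (\<phi> x) < \<epsilon> / 2"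
        using \<epsilon> unfolding uniformly_continuous_on_def by (metis half_gt_zero)
      have "e \<longlonglongrightarrow> 0"
        unfolding e_def by real_asymp
      then have "\<forall>\<^sub>F n in sequentially. e n < t"
        using t(1) by (rule order_tendstoD(2))
      then show "\<forall>\<^sub>F n in sequentially. \<forall>x\<in>N. dist (f n x) ((\<phi> \<circ> A) x) < \<epsilon>"
      proof eventually_elim
        case (elim n)
        show ?case
        proof
          fix w assume w: "w \<in> N"
          define z where "z = A w"
          have z: "z \<in> ball z0 d" using w by (simp add: N_def z_def)
          have i1: "integrable lborel (\<lambda>w. \<phi> w * of_real (bump (e n) (w - z)))"
            and F: "F n z = (LINT w|lborel. \<phi> w * of_real (bump (e n) (w - z)))"
            unfolding F_def using sup[OF z]
            by (auto intro!: integrable_continuous_supported[OF _ compact_cbox[of "-a" a]] continuous_intros c)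
          have i2: "integrable lborel (\<lambda>w. bump (e n) (w - z))"
            using sup[OF z]
            by (auto intro!: integrable_continuous_supported(1)[OF _ compact_cbox[of "-a" a]] continuous_intros)
          have c1: "(LINT w|lborel. bump (e n) (w - z)) = c0 n"
            by (simp add: bump_integral_translate c0_def)
          have "F n z - \<phi> z * c0 n = (LINT w|lborel. \<phi> w * of_real (bump (e n) (w - z)) - \<phi> z * of_real (bump (e n) (w - z)))"
            using i1 i2 by (subst Bochner_Integration.integral_diff) (auto simp: F c1[symmetric])
          also have "cmod \<dots> \<le> (LINT w|lborel. \<epsilon> / 2 * bump (e n) (w - z))"
          proof (rule Bochner_Integration.integral_norm_bound_integral)
            show "integrable lborel (\<lambda>w. \<phi> w * of_real (bump (e n) (w - z)) - \<phi> z * of_real (bump (e n) (w - z)))"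
              using i1 i2 by auto
            show "integrable lborel (\<lambda>w. \<epsilon> / 2 * bump (e n) (w - z))" using i2 by auto
            fix v
            show "cmod (\<phi> v * of_real (bump (e n) (v - z)) - \<phi> z * of_real (bump (e n) (v - z))) \<le> \<epsilon> / 2 * bump (e n) (v - z)"
            proof (cases "cmod (v - z) \<ge> e n")
              case True
              then show ?thesis using bump_eq_0[OF _ e(1)] by simp
            next
              case False
              have "dist z0 v \<le> dist z0 z + dist z v" by (rule dist_triangle)
              then have "v \<in> cball z0 (2 * d)" "z \<in> cball z0 (2 * d)" "dist v z < t"
                using False z e(2)[of n] d elim by (auto simp: dist_norm norm_minus_commute)
              then have "cmod (\<phi> v - \<phi> z) \<le> \<epsilon> / 2" using t(2)[of z v] by (simp add: dist_norm)
              then have "cmod (\<phi> v - \<phi> z) * bump (e n) (v - z) \<le> \<epsilon> / 2 * bump (e n) (v - z)"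
                by (intro mult_right_mono bump_nonneg)
              then show ?thesis
                by (simp add: left_diff_distrib[symmetric] norm_mult bump_nonneg)
            qed
          qed
          also have "\<dots> = \<epsilon> / 2 * c0 n" by (simp add: c1)
          finally have "cmod (F n z - \<phi> z * c0 n) \<le> \<epsilon> / 2 * c0 n" .
          then have "cmod ((F n z - \<phi> z * c0 n) / c0 n) \<le> \<epsilon> / 2"
            using c0[of n] by (simp add: norm_divide field_simps)
          also have "(F n z - \<phi> z * c0 n) / c0 n = f n w - (\<phi> \<circ> A) w"
            using c0[of n] by (simp add: f_def z_def field_simps)
          finally show "dist (f n w) ((\<phi> \<circ> A) w) < \<epsilon>" using \<epsilon> by (simp add: dist_norm)
        qed
      qed
    qed
    have "(\<phi> \<circ> A) holomorphic_on N"
    proof (rule holomorphic_uniform_sequence[OF N(1) hol])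
      fix x assume "x \<in> N"
      then obtain d where "d > 0" "cball x d \<subseteq> N" using N(1) open_contains_cball by blast
      then show "\<exists>d>0. cball x d \<subseteq> N \<and> uniform_limit (cball x d) f (\<phi> \<circ> A) sequentially"
        using uniform_limit_on_subset[OF unif] by blast
    qed
    then show ?thesis using N by blast
  qed
  have "(\<phi> \<circ> A) holomorphic_on {w. A w \<in> U}"
    unfolding holomorphic_on_def
  proof
    fix w assume "w \<in> {w. A w \<in> U}"
    then obtain N where "open N" "w \<in> N" "(\<phi> \<circ> A) holomorphic_on N" using loc by blast
    then show "(\<phi> \<circ> A) field_differentiable at w within {w. A w \<in> U}"
      using field_differentiable_at_within holomorphic_on_imp_differentiable_at by blast
  qed
  then show ?thesis by (simp add: A_def[abs_def] r_def o_def)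
qed

section \<open>The flat structure of the square and uniqueness\<close>

text \<open>
  What Weyl's lemma extracts from a straightening: conformality in the flat structure, off the
  edges of \<open>Sq\<close>. The inner chart has domain the stretched rectangle.
\<close>

locale square_solution =
  fixes K :: real and \<phi> :: "complex \<Rightarrow> complex"
  assumes K: "K > 1"
    and homeo: "\<exists>g. homeomorphism UNIV UNIV \<phi> g"
    and hol_out: "\<phi> holomorphic_on - Sq"
    and hol_in: "(\<lambda>w. \<phi> (Complex (Re w / K) (Im w))) holomorphic_on {w. \<bar>Re w\<bar> < K \<and> \<bar>Im w\<bar> < 1}"
    and norm: "((\<lambda>z. \<phi> z - z) \<longlongrightarrow> 0) at_infinity"

lemma closed_Sq: "closed Sq"
proof -
  have "Sq = {z. -1 \<le> Re z} \<inter> {z. Re z \<le> 1} \<inter> {z. -1 \<le> Im z} \<inter> {z. Im z \<le> 1}"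
    by (auto simp: Sq_def)
  then show ?thesis
    by (metis closed_Int closed_halfspace_Im_ge closed_halfspace_Im_le closed_halfspace_Re_ge closed_halfspace_Re_le)
qed

lemma straightening_imp_square_solution:
  assumes K: "K > 1" and s: "straightening (beltrami_Sq K) \<phi>"
  shows "square_solution K \<phi>"
proof
  obtain g where g: "homeomorphism UNIV UNIV \<phi> g"
    using s by (auto simp: straightening_def quasiconformal_homeo_def)
  then have c: "continuous_on UNIV \<phi>" by (simp add: homeomorphism_def)
  obtain \<phi>x \<phi>y where w: "has_weak_partials \<phi> \<phi>x \<phi>y"
    and b: "AE z in lborel. d_zbar \<phi>x \<phi>y z = beltrami_Sq K z * d_z \<phi>x \<phi>y z"
    using s by (auto simp: straightening_def)
  have test: "(LINT w|lborel. \<phi> w * ((1 - m) * bump_x e (w - z) + \<i> * (1 + m) * bump_y e (w - z))) = 0"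
    if "e > 0" "cball z e \<subseteq> U" "\<And>v. v \<in> U \<Longrightarrow> beltrami_Sq K v = of_real m" for e z U and m :: real
  proof -
    have z: "complex_of_real (bump e (v - z)) = 0" "complex_of_real (bump_x e (v - z)) = 0"
      "complex_of_real (bump_y e (v - z)) = 0" if "v \<notin> cball z e" for v
    proof -
      have "cmod (v - z) \<ge> e" using that by (simp add: dist_norm norm_minus_commute)
      then show "complex_of_real (bump e (v - z)) = 0" "complex_of_real (bump_x e (v - z)) = 0"
        "complex_of_real (bump_y e (v - z)) = 0"
        using bump_eq_0[OF _ \<open>e > 0\<close>] by simp_all
    qed
    have m: "beltrami_Sq K v = of_real m" if "v \<in> cball z e" for v
      using \<open>cball z e \<subseteq> U\<close> \<open>\<And>v. v \<in> U \<Longrightarrow> beltrami_Sq K v = of_real m\<close> that by blast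
    show ?thesis
      using weak_beltrami_tested[OF w b c test_function_bump[OF \<open>e > 0\<close>] compact_cball[of z e] z m]
      by simp
  qed
  show "K > 1" by fact
  show "\<exists>g. homeomorphism UNIV UNIV \<phi> g" using g by blast
  show "((\<lambda>z. \<phi> z - z) \<longlongrightarrow> 0) at_infinity" using s by (simp add: straightening_def)
  have "(\<lambda>w. \<phi> (Complex ((1 - 0) / (1 + 0) * Re w) (Im w))) holomorphic_on
     {w. Complex ((1 - 0) / (1 + 0) * Re w) (Im w) \<in> - Sq}"
    by (rule weak_beltrami_imp_holomorphic[OF c open_Compl[OF closed_Sq] _ test])
      (auto simp: beltrami_Sq_def)
  then show "\<phi> holomorphic_on - Sq" by (simp add: Compl_eq)
  define m where "m = (K - 1) / (K + 1)"
  have "1 - m = 2 / (K + 1)" "1 + m = 2 * K / (K + 1)" using K by (simp_all add: m_def field_simps)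
  then have "(1 - m) / (1 + m) = (2 / (K + 1)) / (2 * K / (K + 1))" by (simp only:)
  also have "\<dots> = 1 / K" using K by (subst frac_eq_eq) auto
  finally have mK: "(1 - m) / (1 + m) = 1 / K" .
  define U where "U = {z. \<bar>Re z\<bar> < 1 \<and> \<bar>Im z\<bar> < 1}"
  have "U = {z. -1 < Re z} \<inter> {z. Re z < 1} \<inter> {z. -1 < Im z} \<inter> {z. Im z < 1}"
    by (auto simp: U_def)
  then have U: "open U"
    by (metis open_Int open_halfspace_Im_gt open_halfspace_Im_lt open_halfspace_Re_gt open_halfspace_Re_lt)
  have "(\<lambda>w. \<phi> (Complex ((1 - m) / (1 + m) * Re w) (Im w))) holomorphic_on
     {w. Complex ((1 - m) / (1 + m) * Re w) (Im w) \<in> U}"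
  proof (rule weak_beltrami_imp_holomorphic[OF c U])
    show "\<bar>m\<bar> < 1" using K by (simp add: m_def)
    show "(LINT w|lborel. \<phi> w * ((1 - m) * bump_x e (w - z) + \<i> * (1 + m) * bump_y e (w - z))) = 0"
      if "e > 0" "cball z e \<subseteq> U" for e z
      by (rule test[OF that]) (auto simp: beltrami_Sq_def U_def Sq_def m_def)
  qed
  then show "(\<lambda>w. \<phi> (Complex (Re w / K) (Im w))) holomorphic_on {w. \<bar>Re w\<bar> < K \<and> \<bar>Im w\<bar> < 1}"
    unfolding mK using K by (simp add: U_def)
qed

text \<open>
  The outer chart, continued across the top edge into \<open>Sq\<close>: the horizontal coordinate is the common
  one, so the inside has to be compressed vertically by \<open>K\<close> in the chart. Through the right edge it is
  the inner chart that is continued; \<open>chart_right\<close> is \<open>w \<mapsto> (Re w / K, Im w)\<close> for \<open>Re w \<le> K\<close> and a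
  translation beyond. The formulas with \<open>min\<close> and \<open>max\<close> make continuity evident.
\<close>

definition chart_top :: "real \<Rightarrow> complex \<Rightarrow> complex" where
  "chart_top K w = Complex (Re w) (max 1 (Im w) + K * min 0 (Im w - 1))"
definition dom_top :: "real \<Rightarrow> complex set" where
  "dom_top K = {w. \<bar>Re w\<bar> < 1 \<and> 1 - 2 / K < Im w}"
definition chart_right :: "real \<Rightarrow> complex \<Rightarrow> complex" where
  "chart_right K w = Complex (min K (Re w) / K + max 0 (Re w - K)) (Im w)"
definition dom_right :: "real \<Rightarrow> complex set" where
  "dom_right K = {w. \<bar>Im w\<bar> < 1 \<and> - K < Re w}"

definition corners :: "complex set" where
  "corners = {1 + \<i>, - 1 + \<i>, - 1 - \<i>, 1 - \<i>}"

lemma corners_iff: "p \<in> corners \<longleftrightarrow> \<bar>Re p\<bar> = 1 \<and> \<bar>Im p\<bar> = 1"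
  by (auto simp: corners_def complex_eq_iff)

text \<open>
  The condition does not mention a particular solution, so that two solutions can be compared in
  the same chart.
\<close>

definition affine_chart :: "real \<Rightarrow> (complex \<Rightarrow> complex) \<Rightarrow> complex set \<Rightarrow> bool" where
  "affine_chart K E V \<longleftrightarrow> open V \<and> inj_on E V \<and>
     (\<forall>\<phi>. square_solution K \<phi> \<longrightarrow> (\<lambda>w. \<phi> (E w)) holomorphic_on V)"

lemma open_dom_top: "open (dom_top K)"
proof -
  have "dom_top K = {z. -1 < Re z} \<inter> {z. Re z < 1} \<inter> {z. 1 - 2 / K < Im z}"
    by (auto simp: dom_top_def)
  then show ?thesis
    by (metis open_Int open_halfspace_Im_gt open_halfspace_Re_gt open_halfspace_Re_lt)
qed

lemma open_dom_right: "open (dom_right K)"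
proof -
  have "dom_right K = {z. -1 < Im z} \<inter> {z. Im z < 1} \<inter> {z. - K < Re z}"
    by (auto simp: dom_right_def)
  then show ?thesis
    by (metis open_Int open_halfspace_Im_gt open_halfspace_Re_gt open_halfspace_Im_lt)
qed

lemma chart_top_above: "Im w \<ge> 1 \<Longrightarrow> chart_top K w = w"
  by (simp add: chart_top_def complex_eq_iff max_def min_def)
lemma chart_top_below:
  "K > 0 \<Longrightarrow> Im w \<le> 1 \<Longrightarrow> chart_top K w = (let v = K * w + \<i> * (1 - K) in Complex (Re v / K) (Im v))"
  by (auto simp: chart_top_def complex_eq_iff max_def min_def Let_def algebra_simps)
lemma chart_right_left: "Re w \<le> K \<Longrightarrow> chart_right K w = Complex (Re w / K) (Im w)"
  by (simp add: chart_right_def max_def min_def)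
lemma chart_right_right: "K > 0 \<Longrightarrow> Re w \<ge> K \<Longrightarrow> chart_right K w = w - of_real (K - 1)"
  by (simp add: chart_right_def complex_eq_iff max_def min_def)

lemma (in square_solution) inj: "inj \<phi>" and surj: "surj \<phi>" and cont: "continuous_on S \<phi>"
    and cont_inv: "continuous_on S (inv \<phi>)"
proof -
  obtain g where g: "homeomorphism UNIV UNIV \<phi> g" using homeo by blast
  then show "inj \<phi>" by (intro inj_on_inverseI[of _ g]) (auto simp: homeomorphism_def)
  show s: "surj \<phi>" using g by (auto simp: homeomorphism_def)
  show "continuous_on S \<phi>" using g continuous_on_subset by (auto simp: homeomorphism_def)
  have "inv \<phi> = g"
    by (rule inv_equality) (use g in \<open>auto simp: homeomorphism_def\<close>)
  then show "continuous_on S (inv \<phi>)" using g continuous_on_subset by (auto simp: homeomorphism_def)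
qed

lemma (in square_solution) inv_at_infinity: "filterlim (inv \<phi>) at_infinity at_infinity"
  unfolding filterlim_at_infinity[of 0, OF order_refl]
proof (intro allI impI)
  fix r :: real assume "r > 0"
  have "compact (\<phi> ` cball 0 r)" by (intro compact_continuous_image[OF cont] compact_cball)
  then have "bounded (\<phi> ` cball 0 r)" by (rule compact_imp_bounded)
  then obtain M where M: "\<forall>z\<in>\<phi> ` cball 0 r. cmod z \<le> M" unfolding bounded_iff by blast
  have "r \<le> cmod (inv \<phi> z)" if "M + 1 \<le> cmod z" for z
  proof (rule ccontr)
    assume "\<not> r \<le> cmod (inv \<phi> z)"
    then have "inv \<phi> z \<in> cball 0 r" by simp
    then have "\<phi> (inv \<phi> z) \<in> \<phi> ` cball 0 r" by (rule imageI)
    then have "z \<in> \<phi> ` cball 0 r" by (simp only: surj_f_inv_f[OF surj])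
    then have "cmod z \<le> M" using M by blast
    then show False using that by linarith
  qed
  then show "\<forall>\<^sub>F z in at_infinity. r \<le> cmod (inv \<phi> z)"
    unfolding eventually_at_infinity by blast
qed

text \<open>
  In the chart the edge is part of the line \<open>Im w = 1\<close>. A continuous function that is holomorphic
  on both sides of a straight line is holomorphic across it.
\<close>

lemma (in square_solution) hol_top: "(\<lambda>w. \<phi> (chart_top K w)) holomorphic_on dom_top K"
proof (rule holomorphic_on_paste_across_line[OF open_dom_top, where d = \<i> and k = 1])
  have "continuous_on UNIV (chart_top K)"
    unfolding chart_top_def[abs_def] Complex_eq by (intro continuous_intros)
  then show "continuous_on (dom_top K) (\<lambda>w. \<phi> (chart_top K w))"
    using continuous_on_compose2[OF cont[of UNIV]] continuous_on_subset by blast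
  have "(\<lambda>w. \<phi> (Complex (Re (K * w + \<i> * (1 - K)) / K) (Im (K * w + \<i> * (1 - K))))) holomorphic_on (dom_top K \<inter> {z. \<i> \<bullet> z < 1})"
  proof (rule holomorphic_on_compose_gen[OF _ hol_in, unfolded o_def])
    show "(\<lambda>w. K * w + \<i> * (1 - K)) holomorphic_on dom_top K \<inter> {z. \<i> \<bullet> z < 1}"
      by (intro holomorphic_intros)
    show "(\<lambda>w. K * w + \<i> * (1 - K)) ` (dom_top K \<inter> {z. \<i> \<bullet> z < 1}) \<subseteq> {w. \<bar>Re w\<bar> < K \<and> \<bar>Im w\<bar> < 1}"
    proof (clarsimp simp: dom_top_def inner_complex_def abs_mult, intro conjI)
      fix v :: complex assume v: "\<bar>Re v\<bar> < 1" "1 - 2 / K < Im v" "Im v < 1"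
      show "\<bar>K\<bar> * \<bar>Re v\<bar> < K" using v K by simp
      have "K * (1 - 2 / K) < K * Im v" "K * Im v < K * 1" using K v by (intro mult_strict_left_mono; simp)+
      moreover have "K * (1 - 2 / K) = K - 2" using K by (simp add: right_diff_distrib)
      ultimately show "\<bar>K * Im v + (1 - K)\<bar> < 1" by linarith
    qed
  qed
  then show "(\<lambda>w. \<phi> (chart_top K w)) holomorphic_on dom_top K \<inter> {z. \<i> \<bullet> z < 1}"
    by (rule holomorphic_transform) (use K in \<open>auto simp: chart_top_below Let_def inner_complex_def\<close>)
  have "\<phi> holomorphic_on (dom_top K \<inter> {z. 1 < \<i> \<bullet> z})"
    by (rule holomorphic_on_subset[OF hol_out]) (auto simp: Sq_def inner_complex_def)
  then show "(\<lambda>w. \<phi> (chart_top K w)) holomorphic_on dom_top K \<inter> {z. 1 < \<i> \<bullet> z}"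
    by (rule holomorphic_transform) (auto simp: chart_top_above inner_complex_def)
qed simp

lemma (in square_solution) hol_right: "(\<lambda>w. \<phi> (chart_right K w)) holomorphic_on dom_right K"
proof (rule holomorphic_on_paste_across_line[OF open_dom_right, where d = 1 and k = K])
  have "continuous_on UNIV (chart_right K)"
    unfolding chart_right_def[abs_def] Complex_eq by (intro continuous_intros) (use K in auto)
  then show "continuous_on (dom_right K) (\<lambda>w. \<phi> (chart_right K w))"
    using continuous_on_compose2[OF cont[of UNIV]] continuous_on_subset by blast
  have "(\<lambda>w. \<phi> (Complex (Re w / K) (Im w))) holomorphic_on (dom_right K \<inter> {z. 1 \<bullet> z < K})"
    by (rule holomorphic_on_subset[OF hol_in]) (auto simp: dom_right_def)
  then show "(\<lambda>w. \<phi> (chart_right K w)) holomorphic_on dom_right K \<inter> {z. 1 \<bullet> z < K}"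
    by (rule holomorphic_transform) (auto simp: chart_right_left)
  have "(\<lambda>w. \<phi> (w - of_real (K - 1))) holomorphic_on (dom_right K \<inter> {z. K < 1 \<bullet> z})"
    by (rule holomorphic_on_compose_gen[OF _ hol_out, unfolded o_def])
      (auto simp: Sq_def intro!: holomorphic_intros)
  then show "(\<lambda>w. \<phi> (chart_right K w)) holomorphic_on dom_right K \<inter> {z. K < 1 \<bullet> z}"
    by (rule holomorphic_transform) (use K in \<open>auto simp: chart_right_right\<close>)
qed simp

lemma (in square_solution) reflect: "square_solution K (\<lambda>z. - \<phi> (- z))"
proof
  show "K > 1" by (rule K)
  obtain g where g: "homeomorphism UNIV UNIV \<phi> g" using homeo by blast
  have hm: "homeomorphism UNIV UNIV (uminus :: complex \<Rightarrow> complex) uminus"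
    by (auto simp: homeomorphism_def intro!: continuous_intros)
  have "homeomorphism UNIV UNIV (uminus \<circ> (\<phi> \<circ> uminus)) ((uminus \<circ> g) \<circ> uminus)"
    by (intro homeomorphism_compose[OF homeomorphism_compose[OF hm g] hm])
  then show "\<exists>g. homeomorphism UNIV UNIV (\<lambda>z. - \<phi> (- z)) g" by (auto simp: o_def)
  show "(\<lambda>z. - \<phi> (- z)) holomorphic_on - Sq"
    by (intro holomorphic_intros holomorphic_on_compose_gen[OF _ hol_out, unfolded o_def]) (auto simp: Sq_def)
  have "(\<lambda>w. - \<phi> (Complex (Re (-w) / K) (Im (-w)))) holomorphic_on {w. \<bar>Re w\<bar> < K \<and> \<bar>Im w\<bar> < 1}"
    by (intro holomorphic_on_minus holomorphic_on_compose_gen[OF _ hol_in, unfolded o_def]) (auto intro!: holomorphic_intros)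
  then show "(\<lambda>w. - \<phi> (- Complex (Re w / K) (Im w))) holomorphic_on {w. \<bar>Re w\<bar> < K \<and> \<bar>Im w\<bar> < 1}"
    by (simp add: complex_minus)
  have "((\<lambda>z. \<phi> (- z) - (- z)) \<longlongrightarrow> 0) at_infinity"
    by (rule filterlim_compose[OF norm]) (auto simp: filterlim_at_infinity[of 0, OF order_refl] eventually_at_infinity)
  from tendsto_minus[OF this] show "((\<lambda>z. - \<phi> (- z) - z) \<longlongrightarrow> 0) at_infinity" by simp
qed

lemma (in square_solution) conjugate: "square_solution K (\<lambda>z. cnj (\<phi> (cnj z)))"
proof
  show "K > 1" by (rule K)
  obtain g where g: "homeomorphism UNIV UNIV \<phi> g" using homeo by blast
  have hm: "homeomorphism UNIV UNIV cnj cnj"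
    by (auto simp: homeomorphism_def intro!: continuous_intros image_eqI[of _ cnj "cnj _"])
  have "homeomorphism UNIV UNIV (cnj \<circ> (\<phi> \<circ> cnj)) ((cnj \<circ> g) \<circ> cnj)"
    by (intro homeomorphism_compose[OF homeomorphism_compose[OF hm g] hm])
  then show "\<exists>g. homeomorphism UNIV UNIV (\<lambda>z. cnj (\<phi> (cnj z))) g" by (auto simp: o_def)
  have "\<phi> holomorphic_on cnj ` (- Sq)"
    by (rule holomorphic_on_subset[OF hol_out]) (auto simp: Sq_def)
  from holomorphic_on_compose_cnj_cnj[OF this]
  show "(\<lambda>z. cnj (\<phi> (cnj z))) holomorphic_on - Sq" using open_Compl[OF closed_Sq] by (simp add: o_def)
  define V where "V = {w. \<bar>Re w\<bar> < K \<and> \<bar>Im w\<bar> < 1}"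
  have "V = {z. -K < Re z} \<inter> {z. Re z < K} \<inter> {z. -1 < Im z} \<inter> {z. Im z < 1}"
    by (auto simp: V_def)
  then have V: "open V"
    by (metis open_Int open_halfspace_Im_gt open_halfspace_Im_lt open_halfspace_Re_gt open_halfspace_Re_lt)
  have "(\<lambda>w. \<phi> (Complex (Re w / K) (Im w))) holomorphic_on cnj ` V"
    by (rule holomorphic_on_subset[OF hol_in]) (auto simp: V_def)
  from holomorphic_on_compose_cnj_cnj[OF this V]
  show "(\<lambda>w. cnj (\<phi> (cnj (Complex (Re w / K) (Im w))))) holomorphic_on {w. \<bar>Re w\<bar> < K \<and> \<bar>Im w\<bar> < 1}"
    by (simp add: o_def V_def complex_cnj)
  have "filterlim cnj at_infinity at_infinity"
    unfolding filterlim_at_infinity[of 0, OF order_refl] eventually_at_infinity by auto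
  then have "((\<lambda>z. \<phi> (cnj z) - cnj z) \<longlongrightarrow> 0) at_infinity"
    by (rule filterlim_compose[OF norm])
  from tendsto_cnj[OF this] show "((\<lambda>z. cnj (\<phi> (cnj z)) - z) \<longlongrightarrow> 0) at_infinity" by simp
qed

lemma affine_chart_neg:
  assumes "affine_chart K E V"
  shows "affine_chart K (\<lambda>w. - E (- w)) (uminus ` V)"
  unfolding affine_chart_def
proof (intro conjI allI impI)
  show "open (uminus ` V)" using assms open_negations by (auto simp: affine_chart_def)
  show "inj_on (\<lambda>w. - E (- w)) (uminus ` V)" using assms by (auto simp: affine_chart_def inj_on_def)
  fix \<phi> assume "square_solution K \<phi>"
  then have "square_solution K (\<lambda>z. - \<phi> (- z))" by (rule square_solution.reflect)
  then have "(\<lambda>w. - \<phi> (- E w)) holomorphic_on V" using assms by (auto simp: affine_chart_def)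
  then have "(\<lambda>w. - \<phi> (- E (- w))) holomorphic_on uminus ` V"
    by (intro holomorphic_on_compose_gen[of uminus _ "\<lambda>w. - \<phi> (- E w)" V, unfolded o_def])
      (auto intro!: holomorphic_intros)
  from holomorphic_on_minus[OF this]
  show "(\<lambda>w. \<phi> (- E (- w))) holomorphic_on uminus ` V" by simp
qed

lemma affine_chart_top: "K > 1 \<Longrightarrow> affine_chart K (chart_top K) (dom_top K)"
  unfolding affine_chart_def
proof (intro conjI allI impI open_dom_top square_solution.hol_top)
  assume K: "K > 1"
  have m: "strict_mono (\<lambda>t::real. max 1 t + K * min 0 (t - 1))"
  proof (rule strict_monoI)
    fix s t :: real assume "s < t"
    then have "K * min 0 (s - 1) \<le> K * min 0 (t - 1)" using K by (intro mult_left_mono) auto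
    moreover have "K * min 0 (s - 1) < K * min 0 (t - 1)" if "s < 1" 
      using K that \<open>s < t\<close> by (intro mult_strict_left_mono) auto
    ultimately show "max 1 s + K * min 0 (s - 1) < max 1 t + K * min 0 (t - 1)"
      using \<open>s < t\<close> by (cases "s < 1") (auto simp: max_def)
  qed
  show "inj_on (chart_top K) (dom_top K)"
    using strict_mono_eq[OF m] by (auto simp: inj_on_def chart_top_def complex_eq_iff)
qed

lemma affine_chart_right: "K > 1 \<Longrightarrow> affine_chart K (chart_right K) (dom_right K)"
  unfolding affine_chart_def
proof (intro conjI allI impI open_dom_right square_solution.hol_right)
  assume K: "K > 1"
  have m: "strict_mono (\<lambda>t::real. min K t / K + max 0 (t - K))"
  proof (rule strict_monoI)
    fix s t :: real assume "s < t"
    then have "min K s / K \<le> min K t / K" using K by (intro divide_right_mono) auto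
    moreover have "min K s / K < min K t / K" if "s < K" 
      using K that \<open>s < t\<close> by (intro divide_strict_right_mono) auto
    ultimately show "min K s / K + max 0 (s - K) < min K t / K + max 0 (t - K)"
      using \<open>s < t\<close> by (cases "s < K") (auto simp: max_def)
  qed
  show "inj_on (chart_right K) (dom_right K)"
    using strict_mono_eq[OF m] by (auto simp: inj_on_def chart_right_def complex_eq_iff)
qed

lemma affine_chart_outside: "affine_chart K (\<lambda>w. w) (- Sq)"
  using closed_Sq square_solution.hol_out by (auto simp: affine_chart_def)

lemma mem_chart_top:
  assumes "K > 1" "\<bar>Re p\<bar> < 1" "Im p > - 1"
  shows "\<exists>w\<in>dom_top K. chart_top K w = p"
proof (cases "Im p \<ge> 1")
  case True
  moreover have "2 / K > 0" using assms by simp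
  ultimately have "1 - 2 / K < Im p" by linarith
  then show ?thesis using True assms by (intro bexI[of _ p]) (simp_all add: chart_top_above dom_top_def)
next
  case False
  moreover have "K * (1 + Im p) > 0" using assms by simp
  ultimately show ?thesis using assms
    by (intro bexI[of _ "Complex (Re p) (1 + (Im p - 1) / K)"])
      (auto simp: chart_top_def dom_top_def complex_eq_iff max_def min_def field_simps)
qed

lemma mem_chart_right:
  assumes "K > 1" "\<bar>Im p\<bar> < 1" "Re p > - 1"
  shows "\<exists>w\<in>dom_right K. chart_right K w = p"
proof (cases "Re p \<ge> 1")
  case True
  then show ?thesis using assms by (intro bexI[of _ "p + of_real (K - 1)"]) (auto simp: chart_right_right dom_right_def)
next
  case False
  moreover have "K * -1 < K * Re p" using assms by (intro mult_strict_left_mono) auto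
  ultimately show ?thesis using assms
    by (intro bexI[of _ "Complex (K * Re p) (Im p)"])
      (auto simp: chart_right_left dom_right_def complex_eq_iff)
qed

text \<open>
  The map \<open>E\<close> commutes with translations in the direction \<open>e\<close>, and \<open>e\<close> is tangent to any edge that
  the image of \<open>E\<close> meets. Derivatives of \<open>\<phi> \<circ> E\<close> can then be read off as derivatives of \<open>\<phi>\<close> in the
  direction \<open>e\<close>.
\<close>

definition straight_chart :: "real \<Rightarrow> complex \<Rightarrow> (complex \<Rightarrow> complex) \<Rightarrow> complex set \<Rightarrow> bool" where
  "straight_chart K e E V \<longleftrightarrow> affine_chart K E V \<and>
     (\<forall>w s. w \<in> V \<longrightarrow> w + of_real s * e \<in> V \<longrightarrow> E (w + of_real s * e) = E w + of_real s * e) \<and>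
     (e = 1 \<and> (\<forall>w\<in>V. \<not> (\<bar>Re (E w)\<bar> = 1 \<and> \<bar>Im (E w)\<bar> < 1)) \<or>
      e = \<i> \<and> (\<forall>w\<in>V. E w \<notin> Sq \<or> \<bar>Im (E w)\<bar> < 1))"

lemma straight_chart_top: "K > 1 \<Longrightarrow> straight_chart K 1 (chart_top K) (dom_top K)"
  using affine_chart_top by (auto simp: straight_chart_def chart_top_def dom_top_def complex_eq_iff)

lemma straight_chart_right: "K > 1 \<Longrightarrow> straight_chart K \<i> (chart_right K) (dom_right K)"
  using affine_chart_right by (auto simp: straight_chart_def chart_right_def dom_right_def complex_eq_iff)

lemma straight_chart_outside: "straight_chart K 1 (\<lambda>w. w) (- Sq)"
  using affine_chart_outside by (auto simp: straight_chart_def Sq_def)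

lemma straight_chart_neg:
  assumes "straight_chart K e E V"
  shows "straight_chart K e (\<lambda>w. - E (- w)) (uminus ` V)"
proof -
  have "- E (- (w + of_real s * e)) = - E (- w) + of_real s * e"
    if "w \<in> uminus ` V" "w + of_real s * e \<in> uminus ` V" for w s
  proof -
    have "- w \<in> V" "- w + of_real (- s) * e \<in> V" using that by (auto simp: algebra_simps)
    then have "E (- w + of_real (- s) * e) = E (- w) + of_real (- s) * e"
      using assms unfolding straight_chart_def by blast
    then show ?thesis by (simp add: algebra_simps)
  qed
  moreover have "- p \<in> Sq \<longleftrightarrow> p \<in> Sq" for p by (auto simp: Sq_def)
  ultimately show ?thesis
    using assms affine_chart_neg unfolding straight_chart_def by auto
qed

lemma straight_chart_cover:
  assumes K: "K > 1" and p: "p \<notin> corners"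
  shows "\<exists>e E V. straight_chart K e E V \<and> p \<in> E ` V"
proof -
  consider "p \<notin> Sq" | "\<bar>Re p\<bar> < 1" "Im p > - 1" | "\<bar>Re (-p)\<bar> < 1" "Im (-p) > - 1"
    | "\<bar>Im p\<bar> < 1" "Re p > - 1" | "\<bar>Im (-p)\<bar> < 1" "Re (-p) > - 1"
    using p unfolding corners_iff Sq_def by fastforce
  then show ?thesis
  proof cases
    case 1
    then show ?thesis using straight_chart_outside by (metis ComplI image_ident)
  next
    case 2
    then show ?thesis using mem_chart_top[OF K 2] straight_chart_top[OF K] by blast
  next
    case 3
    then obtain w where "w \<in> dom_top K" "chart_top K w = - p" using mem_chart_top[OF K] by blast
    then have "p \<in> (\<lambda>w. - chart_top K (- w)) ` (uminus ` dom_top K)"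
      by (intro image_eqI[of _ _ "-w"] imageI) simp_all
    then show ?thesis using straight_chart_neg[OF straight_chart_top[OF K]] by blast
  next
    case 4
    then show ?thesis using mem_chart_right[OF K 4] straight_chart_right[OF K] by blast
  next
    case 5
    then obtain w where "w \<in> dom_right K" "chart_right K w = - p" using mem_chart_right[OF K] by blast
    then have "p \<in> (\<lambda>w. - chart_right K (- w)) ` (uminus ` dom_right K)"
      by (intro image_eqI[of _ _ "-w"] imageI) simp_all
    then show ?thesis using straight_chart_neg[OF straight_chart_right[OF K]] by blast
  qed
qed

text \<open>
  In a common chart, \<open>\<phi>\<^sub>2 \<circ> \<phi>\<^sub>1\<^sup>-\<^sup>1\<close> is holomorphic away from four points, where it is still continuous.
  So it is entire, and it differs from the identity by \<open>o(1)\<close> at infinity.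
\<close>

theorem square_solution_unique:
  assumes s1: "square_solution K \<phi>1" and s2: "square_solution K \<phi>2"
  shows "\<phi>1 = \<phi>2"
proof -
  interpret S1: square_solution K \<phi>1 by (rule s1)
  interpret S2: square_solution K \<phi>2 by (rule s2)
  define g where "g z = \<phi>2 (inv \<phi>1 z)" for z
  have loc: "g field_differentiable at z" if "z \<notin> \<phi>1 ` corners" for z
  proof -
    define p where "p = inv \<phi>1 z"
    have z: "z = \<phi>1 p" by (simp add: p_def surj_f_inv_f[OF S1.surj])
    then have "p \<notin> corners" using that by auto
    then obtain e E V where "straight_chart K e E V" and EV: "p \<in> E ` V"
      using straight_chart_cover[OF S1.K] by blast
    then have "affine_chart K E V" by (simp add: straight_chart_def)
    then have V: "open V" "inj_on E V" and h1: "(\<lambda>w. \<phi>1 (E w)) holomorphic_on V"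
      and h2: "(\<lambda>w. \<phi>2 (E w)) holomorphic_on V"
      using s1 s2 by (auto simp: affine_chart_def)
    have "inj_on (\<lambda>w. \<phi>1 (E w)) V"
      using V(2) S1.inj by (auto simp: inj_on_def)
    then obtain k where k: "k holomorphic_on (\<lambda>w. \<phi>1 (E w)) ` V" "\<And>w. w \<in> V \<Longrightarrow> k (\<phi>1 (E w)) = w"
      using holomorphic_has_inverse[OF h1 V(1)] by metis
    have op: "open ((\<lambda>w. \<phi>1 (E w)) ` V)"
      by (rule open_mapping_thm3[OF h1 V(1)]) fact
    have "(\<lambda>y. \<phi>2 (E (k y))) holomorphic_on (\<lambda>w. \<phi>1 (E w)) ` V"
      by (rule holomorphic_on_compose_gen[OF k(1) h2, unfolded o_def]) (use k in auto)
    then have "g holomorphic_on (\<lambda>w. \<phi>1 (E w)) ` V"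
      by (rule holomorphic_transform) (use k in \<open>auto simp: g_def inv_f_f[OF S1.inj]\<close>)
    moreover have "z \<in> (\<lambda>w. \<phi>1 (E w)) ` V" using EV z by auto
    ultimately show ?thesis using op holomorphic_on_imp_differentiable_at by blast
  qed
  have "g holomorphic_on UNIV"
  proof (rule no_isolated_singularity)
    show "continuous_on UNIV g"
      unfolding g_def by (rule continuous_on_compose2[OF S2.cont[of UNIV] S1.cont_inv]) auto
    show "g holomorphic_on UNIV - \<phi>1 ` corners"
      using loc by (auto simp: holomorphic_on_def intro: field_differentiable_at_within)
  qed (auto simp: corners_def)
  then have h: "(\<lambda>z. g z - z) holomorphic_on UNIV" by (intro holomorphic_intros)
  have "((\<lambda>z. (\<phi>2 (inv \<phi>1 z) - inv \<phi>1 z) - (\<phi>1 (inv \<phi>1 z) - inv \<phi>1 z)) \<longlongrightarrow> 0 - 0) at_infinity"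
    by (intro tendsto_diff filterlim_compose[OF S1.norm S1.inv_at_infinity] filterlim_compose[OF S2.norm S1.inv_at_infinity])
  then have "((\<lambda>z. g z - z) \<longlongrightarrow> 0) at_infinity"
    by (simp add: g_def surj_f_inv_f[OF S1.surj])
  then have "g z = z" for z using Liouville_weak_0[OF h] by simp
  then have "\<phi>2 p = \<phi>1 p" for p using g_def[of "\<phi>1 p"] by (simp add: inv_f_f[OF S1.inj])
  then show ?thesis by auto
qed

context square_solution
begin

text \<open>
  Both symmetries are instances of uniqueness. They make \<open>\<phi>\<close> preserve each axis, and with the
  normalization at infinity each open half plane that an axis bounds.
\<close>

lemma odd: "\<phi> (- z) = - \<phi> z"
  using fun_cong[OF square_solution_unique[OF square_solution_axioms reflect], of "-z"] by simp

lemma cnj: "\<phi> (cnj z) = cnj (\<phi> z)"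
  using fun_cong[OF square_solution_unique[OF square_solution_axioms conjugate], of "cnj z"] by simp

lemma zero: "\<phi> 0 = 0" using odd[of 0] by simp

lemma Im_eq_0_iff: "Im (\<phi> z) = 0 \<longleftrightarrow> Im z = 0"
proof -
  have "Im (\<phi> z) = 0 \<longleftrightarrow> cnj (\<phi> z) = \<phi> z" by (auto simp: complex_eq_iff)
  also have "\<dots> \<longleftrightarrow> \<phi> (cnj z) = \<phi> z" by (simp add: cnj)
  also have "\<dots> \<longleftrightarrow> cnj z = z" using inj by (simp add: inj_eq)
  also have "\<dots> \<longleftrightarrow> Im z = 0" by (auto simp: complex_eq_iff)
  finally show ?thesis .
qed

lemma Re_eq_0_iff: "Re (\<phi> z) = 0 \<longleftrightarrow> Re z = 0"
proof -
  have "Re (\<phi> z) = 0 \<longleftrightarrow> - cnj (\<phi> z) = \<phi> z" by (auto simp: complex_eq_iff)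
  also have "\<dots> \<longleftrightarrow> \<phi> (- cnj z) = \<phi> z" by (simp add: cnj odd)
  also have "\<dots> \<longleftrightarrow> - cnj z = z" using inj by (simp add: inj_eq)
  also have "\<dots> \<longleftrightarrow> Re z = 0" by (auto simp: complex_eq_iff)
  finally show ?thesis .
qed

lemma near_identity: "\<exists>B. \<forall>z. B \<le> cmod z \<longrightarrow> cmod (\<phi> z - z) < 1"
proof -
  have "\<forall>\<^sub>F z in at_infinity. dist (\<phi> z - z) 0 < 1" using norm by (rule tendstoD) simp
  then show ?thesis by (auto simp: eventually_at_infinity)
qed

lemma Im_pos:
  assumes "Im z > 0" shows "Im (\<phi> z) > 0"
proof (rule ccontr)
  assume "\<not> Im (\<phi> z) > 0"
  obtain B where B: "\<And>z. B \<le> cmod z \<Longrightarrow> cmod (\<phi> z - z) < 1" using near_identity by blast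
  define w where "w = \<i> * of_real (\<bar>B\<bar> + 1)"
  have "cmod w = \<bar>B\<bar> + 1" by (simp add: w_def norm_mult)
  then have "cmod (\<phi> w - w) < 1" using B by simp
  then have "\<bar>Im (\<phi> w - w)\<bar> < 1" using abs_Im_le_cmod le_less_trans by blast
  then have w: "Im (\<phi> w) > 0" "Im w > 0" by (auto simp: w_def)
  have "connected ((\<lambda>z. Im (\<phi> z)) ` {z. Im z > 0})"
    by (intro connected_continuous_image continuous_intros cont convex_connected convex_halfspace_Im_gt)
  then have "0 \<in> (\<lambda>z. Im (\<phi> z)) ` {z. Im z > 0}"
    by (rule connectedD_interval[of _ "Im (\<phi> z)" "Im (\<phi> w)"])
      (use assms w \<open>\<not> Im (\<phi> z) > 0\<close> in auto)
  then show False using Im_eq_0_iff by auto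
qed

lemma Re_pos:
  assumes "Re z > 0" shows "Re (\<phi> z) > 0"
proof (rule ccontr)
  assume "\<not> Re (\<phi> z) > 0"
  obtain B where B: "\<And>z. B \<le> cmod z \<Longrightarrow> cmod (\<phi> z - z) < 1" using near_identity by blast
  define w where "w = complex_of_real (\<bar>B\<bar> + 1)"
  have "cmod w = \<bar>B\<bar> + 1" unfolding w_def norm_of_real by simp
  then have "cmod (\<phi> w - w) < 1" using B by simp
  then have "\<bar>Re (\<phi> w - w)\<bar> < 1" using abs_Re_le_cmod le_less_trans by blast
  then have w: "Re (\<phi> w) > 0" "Re w > 0" by (auto simp: w_def)
  have "connected ((\<lambda>z. Re (\<phi> z)) ` {z. Re z > 0})"
    by (intro connected_continuous_image continuous_intros cont convex_connected convex_halfspace_Re_gt)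
  then have "0 \<in> (\<lambda>z. Re (\<phi> z)) ` {z. Re z > 0}"
    by (rule connectedD_interval[of _ "Re (\<phi> z)" "Re (\<phi> w)"])
      (use assms w \<open>\<not> Re (\<phi> z) > 0\<close> in auto)
  then show False using Re_eq_0_iff by auto
qed

end

section \<open>The quantity f''/f' of the affine charts\<close>

text \<open>
  If \<open>\<phi> \<circ> E\<close> is holomorphic with inverse branch \<open>g\<close>, then \<open>inverse_nonlin (\<phi> \<circ> E) w\<close> is \<open>g'' / g'\<close>
  at the image of \<open>w\<close>. When \<open>E\<close> commutes with translations in the direction \<open>e\<close>, so is
  \<open>dir_nonlin e \<phi> (E w)\<close>, which does not refer to the chart.
\<close>

definition dir_deriv :: "complex \<Rightarrow> (complex \<Rightarrow> complex) \<Rightarrow> complex \<Rightarrow> complex" where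
  "dir_deriv e f p = vector_derivative (\<lambda>s::real. f (p + of_real s * e)) (at 0)"
definition dir_nonlin :: "complex \<Rightarrow> (complex \<Rightarrow> complex) \<Rightarrow> complex \<Rightarrow> complex" where
  "dir_nonlin e f p = - dir_deriv e (dir_deriv e f) p / (dir_deriv e f p)\<^sup>2"
definition inverse_nonlin :: "(complex \<Rightarrow> complex) \<Rightarrow> complex \<Rightarrow> complex" where
  "inverse_nonlin f w = - deriv (deriv f) w / (deriv f w)\<^sup>2"

lemma dir_deriv_chart:
  assumes V: "open V" and h: "\<Psi> holomorphic_on V"
    and f: "\<And>w. w \<in> V \<Longrightarrow> f (E w) = \<Psi> w"
    and E: "\<And>w s. w \<in> V \<Longrightarrow> w + of_real s * e \<in> V \<Longrightarrow> E (w + of_real s * e) = E w + of_real s * e"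
    and w: "w \<in> V"
  shows "dir_deriv e f (E w) = e * deriv \<Psi> w"
proof -
  have d: "(\<Psi> has_field_derivative deriv \<Psi> w) (at (w + of_real 0 * e))"
    using holomorphic_derivI[OF h V w] by simp
  have l: "((\<lambda>s::real. w + of_real s * e) has_vector_derivative e) (at 0)"
    by (auto intro!: derivative_eq_intros simp: has_vector_derivative_def scaleR_conv_of_real)
  have "((\<lambda>s. \<Psi> (w + of_real s * e)) has_vector_derivative e * deriv \<Psi> w) (at 0)"
    using field_vector_diff_chain_at[OF l d] by (simp add: o_def)
  moreover have "open ((\<lambda>s::real. w + of_real s * e) -` V)"
    by (intro open_vimage V continuous_intros)
  ultimately have "((\<lambda>s. f (E w + of_real s * e)) has_vector_derivative e * deriv \<Psi> w) (at 0)"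
  proof (rule has_vector_derivative_transform_within_open)
    show "0 \<in> (\<lambda>s::real. w + of_real s * e) -` V" using w by simp
    fix s assume "s \<in> (\<lambda>s::real. w + of_real s * e) -` V"
    then show "\<Psi> (w + of_real s * e) = f (E w + of_real s * e)"
      using E[OF w, of s] f[of "w + of_real s * e"] by simp
  qed
  then show ?thesis unfolding dir_deriv_def by (rule vector_derivative_at)
qed

lemma dir_nonlin_chart:
  assumes V: "open V" and h: "(\<lambda>w. f (E w)) holomorphic_on V"
    and E: "\<And>w s. w \<in> V \<Longrightarrow> w + of_real s * e \<in> V \<Longrightarrow> E (w + of_real s * e) = E w + of_real s * e"
    and w: "w \<in> V" and e: "e \<noteq> 0"
  shows "dir_nonlin e f (E w) = inverse_nonlin (\<lambda>w. f (E w)) w"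
proof -
  define \<Psi> where "\<Psi> = (\<lambda>w. f (E w))"
  have h': "\<Psi> holomorphic_on V" using h by (simp add: \<Psi>_def)
  have d1: "dir_deriv e f (E w) = e * deriv \<Psi> w" if "w \<in> V" for w
    by (rule dir_deriv_chart[OF V h' _ E that]) (simp add: \<Psi>_def)
  have dh: "deriv \<Psi> holomorphic_on V" by (rule holomorphic_deriv[OF h' V])
  have "dir_deriv e (dir_deriv e f) (E w) = e * deriv (\<lambda>w. e * deriv \<Psi> w) w"
    by (rule dir_deriv_chart[where \<Psi> = "\<lambda>w. e * deriv \<Psi> w" and E = E, OF V _ d1 E w])
      (intro holomorphic_intros dh)
  also have "deriv (\<lambda>w. e * deriv \<Psi> w) w = e * deriv (deriv \<Psi>) w"
    by (intro deriv_cmult) (use dh V w holomorphic_on_imp_differentiable_at in blast)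
  finally show ?thesis
    using e by (simp add: dir_nonlin_def inverse_nonlin_def d1[OF w] \<Psi>_def[symmetric] power2_eq_square)
qed

text \<open>
  Invariance of \<open>g'' / g'\<close> under a complex affine change of the chart; a factor \<open>c\<close> on the side of
  the values divides it by \<open>c\<close>. The cases \<open>c = 1\<close> and \<open>c = - 1\<close> give independence of the chart and
  oddness.
\<close>

lemma inverse_nonlin_affine:
  assumes V: "open V" "open V2" and h: "\<Psi>2 holomorphic_on V2"
    and aff: "\<And>w. w \<in> V \<Longrightarrow> a * w + b \<in> V2" "\<And>w. w \<in> V \<Longrightarrow> \<Psi>1 w = c * \<Psi>2 (a * w + b)"
    and a: "a \<noteq> 0" "c \<noteq> 0" and w: "w \<in> V"
  shows "inverse_nonlin \<Psi>1 w = inverse_nonlin \<Psi>2 (a * w + b) / c"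
proof -
  have step: "deriv \<Psi>1 w = c * a * deriv \<Psi>2 (a * w + b)"
    if "\<And>w. w \<in> V \<Longrightarrow> \<Psi>1 w = c * \<Psi>2 (a * w + b)" "\<Psi>2 holomorphic_on V2" "w \<in> V"
    for \<Psi>1 \<Psi>2 c w
  proof -
    have "(\<Psi>2 has_field_derivative deriv \<Psi>2 (a * w + b)) (at (a * w + b))"
      by (rule holomorphic_derivI[OF that(2) V(2) aff(1)[OF that(3)]])
    moreover have "((\<lambda>w. a * w + b) has_field_derivative a) (at w)"
      by (auto intro!: derivative_eq_intros)
    ultimately have "((\<lambda>w. \<Psi>2 (a * w + b)) has_field_derivative deriv \<Psi>2 (a * w + b) * a) (at w)"
      by (rule DERIV_chain2)
    from DERIV_cmult[OF this, of c]
    have "(\<Psi>1 has_field_derivative c * (deriv \<Psi>2 (a * w + b) * a)) (at w)"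
      by (rule has_field_derivative_transform_within_open[OF _ V(1) that(3)]) (simp add: that(1))
    then show ?thesis by (simp add: DERIV_imp_deriv)
  qed
  have d1: "deriv \<Psi>1 w = c * a * deriv \<Psi>2 (a * w + b)" if "w \<in> V" for w
    by (rule step[OF aff(2) h that])
  have "deriv (deriv \<Psi>1) w = c * a * a * deriv (deriv \<Psi>2) (a * w + b)"
    by (rule step[OF d1 holomorphic_deriv[OF h V(2)] w])
  then show ?thesis
    using a by (simp add: inverse_nonlin_def d1[OF w] power2_eq_square)
qed

text \<open>
  The quantity \<open>f'' / f'\<close> at \<open>\<phi> p\<close>, with the direction of differentiation tangent to the edge if \<open>p\<close>
  lies on one. Off the edges both directions give the same value, so one formula covers all
  charts at once.
\<close>

definition pulled_eta :: "(complex \<Rightarrow> complex) \<Rightarrow> complex \<Rightarrow> complex" where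
  "pulled_eta \<phi> p = (if \<bar>Re p\<bar> = 1 \<and> \<bar>Im p\<bar> < 1 then dir_nonlin \<i> \<phi> p else dir_nonlin 1 \<phi> p)"

lemma finite_corners: "finite corners" by (simp add: corners_def)

context square_solution
begin

lemma deriv_chart_nonzero:
  assumes "affine_chart K E V" "w \<in> V"
  shows "deriv (\<lambda>w. \<phi> (E w)) w \<noteq> 0"
proof (rule holomorphic_injective_imp_regular[OF _ _ _ assms(2)])
  show "(\<lambda>w. \<phi> (E w)) holomorphic_on V" "open V"
    using assms square_solution_axioms by (auto simp: affine_chart_def)
  show "inj_on (\<lambda>w. \<phi> (E w)) V"
    using assms inj by (auto simp: affine_chart_def inj_on_def)
qed

text \<open>
  The inner chart is straight in the vertical direction, the continuation of the outer chart in
  the horizontal one. They differ by a complex affine map.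
\<close>

lemma dir_nonlin_inside:
  assumes p: "\<bar>Re p\<bar> < 1" "\<bar>Im p\<bar> < 1"
  shows "dir_nonlin 1 \<phi> p = dir_nonlin \<i> \<phi> p"
proof -
  define A where "A w = Complex (Re w / K) (Im w)" for w
  define V2 where "V2 = {w. \<bar>Re w\<bar> < K \<and> \<bar>Im w\<bar> < 1}"
  have "V2 = {z. -K < Re z} \<inter> {z. Re z < K} \<inter> {z. -1 < Im z} \<inter> {z. Im z < 1}"
    by (auto simp: V2_def)
  then have V2: "open V2"
    by (metis open_Int open_halfspace_Im_gt open_halfspace_Im_lt open_halfspace_Re_gt open_halfspace_Re_lt)
  have hA: "(\<lambda>w. \<phi> (A w)) holomorphic_on V2" using hol_in by (simp add: A_def V2_def)
  define V where "V = dom_top K \<inter> {w. Im w < 1}"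
  have V: "open V" unfolding V_def by (intro open_Int open_dom_top open_halfspace_Im_lt)
  have top: "chart_top K w = A (of_real K * w + \<i> * (1 - K))" if "w \<in> V" for w
    using chart_top_below[of K w] that K by (simp add: V_def A_def Let_def)
  have mem: "of_real K * w + \<i> * (1 - K) \<in> V2" if "w \<in> V" for w
  proof -
    have v: "\<bar>Re w\<bar> < 1" "1 - 2 / K < Im w" "Im w < 1" using that by (auto simp: V_def dom_top_def)
    have "\<bar>K\<bar> * \<bar>Re w\<bar> < K" using v K by simp
    moreover have "K * (1 - 2 / K) < K * Im w" "K * Im w < K * 1" using K v by (intro mult_strict_left_mono; simp)+
    moreover have "K * (1 - 2 / K) = K - 2" using K by (simp add: right_diff_distrib)
    ultimately have "\<bar>K * Re w\<bar> < K" "\<bar>K * Im w + (1 - K)\<bar> < 1" by (simp_all only: abs_mult abs_less_iff, linarith)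
    then show ?thesis by (simp add: V2_def)
  qed
  have "Im p > - 1" using p by simp
  with mem_chart_top[OF K p(1)] obtain w where w: "w \<in> dom_top K" "chart_top K w = p" by blast
  have "w \<in> V"
  proof (rule ccontr)
    assume "w \<notin> V"
    then have "Im w \<ge> 1" using w by (simp add: V_def)
    then have "p = w" using w chart_top_above by simp
    then show False using \<open>Im w \<ge> 1\<close> p by simp
  qed
  have hV: "(\<lambda>w. \<phi> (chart_top K w)) holomorphic_on V"
    by (rule holomorphic_on_subset[OF hol_top]) (auto simp: V_def)
  have "dir_nonlin 1 \<phi> (chart_top K w) = inverse_nonlin (\<lambda>w. \<phi> (chart_top K w)) w"
    by (rule dir_nonlin_chart[where E = "chart_top K", OF V hV _ \<open>w \<in> V\<close>]) (auto simp: chart_top_def complex_eq_iff)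
  also have "\<dots> = inverse_nonlin (\<lambda>w. \<phi> (A w)) (K * w + \<i> * (1 - K)) / 1"
    by (rule inverse_nonlin_affine[OF V V2 hA mem _ _ _ \<open>w \<in> V\<close>]) (use top K in auto)
  also have "inverse_nonlin (\<lambda>w. \<phi> (A w)) (K * w + \<i> * (1 - K)) = dir_nonlin \<i> \<phi> (A (K * w + \<i> * (1 - K)))"
    by (rule dir_nonlin_chart[where E = A, OF V2 hA _ mem[OF \<open>w \<in> V\<close>], symmetric]) (auto simp: A_def complex_eq_iff)
  finally show ?thesis using top[OF \<open>w \<in> V\<close>] w by simp
qed

lemma pulled_eta_chart:
  assumes c: "straight_chart K e E V" and w: "w \<in> V"
  shows "pulled_eta \<phi> (E w) = inverse_nonlin (\<lambda>w. \<phi> (E w)) w"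
proof -
  have V: "open V" and h: "(\<lambda>w. \<phi> (E w)) holomorphic_on V"
    and E: "\<And>w s. w \<in> V \<Longrightarrow> w + of_real s * e \<in> V \<Longrightarrow> E (w + of_real s * e) = E w + of_real s * e"
    and e: "e \<noteq> 0"
    using c square_solution_axioms by (auto simp: straight_chart_def affine_chart_def)
  have "pulled_eta \<phi> (E w) = dir_nonlin e \<phi> (E w)"
  proof -
    consider "e = 1" "\<not> (\<bar>Re (E w)\<bar> = 1 \<and> \<bar>Im (E w)\<bar> < 1)" | "e = \<i>" "E w \<notin> Sq" |
       "e = \<i>" "E w \<in> Sq" "\<bar>Im (E w)\<bar> < 1"
      using c w by (auto simp: straight_chart_def)
    then show ?thesis
    proof cases
      case 1
      then show ?thesis by (auto simp: pulled_eta_def)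
    next
      case 2
      have tr: "dir_nonlin d \<phi> (E w) = inverse_nonlin \<phi> (E w)" if "d \<noteq> 0" for d
        by (rule dir_nonlin_chart[of "- Sq" \<phi> "\<lambda>w. w"]) (use 2 that closed_Sq hol_out in auto)
      have "pulled_eta \<phi> (E w) = dir_nonlin 1 \<phi> (E w)" using 2 by (auto simp: pulled_eta_def Sq_def)
      then show ?thesis using tr[of 1] tr[of \<i>] 2 by simp
    next
      case 3
      then show ?thesis
        using dir_nonlin_inside[of "E w"] by (cases "\<bar>Re (E w)\<bar> = 1") (auto simp: pulled_eta_def Sq_def)
    qed
  qed
  then show ?thesis using dir_nonlin_chart[where E = E and f = \<phi>, OF V h E w e] by simp
qed

text \<open>
  The function \<open>f'' / f'\<close> on the side of the values of \<open>\<phi>\<close>.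
\<close>

definition chart_eta :: "complex \<Rightarrow> complex" where
  "chart_eta z = pulled_eta \<phi> (inv \<phi> z)"

lemma chart_eta_\<phi>: "chart_eta (\<phi> p) = pulled_eta \<phi> p"
  by (simp add: chart_eta_def inv_f_f[OF inj])

lemma chart_eta_holomorphic: "chart_eta holomorphic_on - \<phi> ` corners"
  unfolding holomorphic_on_def
proof
  fix z assume z: "z \<in> - \<phi> ` corners"
  define p where "p = inv \<phi> z"
  have zp: "z = \<phi> p" by (simp add: p_def surj_f_inv_f[OF surj])
  then have "p \<notin> corners" using z by auto
  then obtain e E V where EV: "straight_chart K e E V" "p \<in> E ` V"
    using straight_chart_cover[OF K] by blast
  then have ac: "affine_chart K E V" by (simp add: straight_chart_def)
  then have V: "open V" "inj_on E V" and h: "(\<lambda>w. \<phi> (E w)) holomorphic_on V"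
    using square_solution_axioms by (auto simp: affine_chart_def)
  have ij: "inj_on (\<lambda>w. \<phi> (E w)) V" using V(2) inj by (auto simp: inj_on_def)
  then obtain k where k: "k holomorphic_on (\<lambda>w. \<phi> (E w)) ` V" "\<And>w. w \<in> V \<Longrightarrow> k (\<phi> (E w)) = w"
    using holomorphic_has_inverse[OF h V(1)] by metis
  have op: "open ((\<lambda>w. \<phi> (E w)) ` V)" by (rule open_mapping_thm3[OF h V(1) ij])
  have hn: "inverse_nonlin (\<lambda>w. \<phi> (E w)) holomorphic_on V"
    unfolding inverse_nonlin_def[abs_def]
    by (intro holomorphic_intros holomorphic_deriv h V(1)) (simp add: deriv_chart_nonzero[OF ac])
  have "(\<lambda>y. inverse_nonlin (\<lambda>w. \<phi> (E w)) (k y)) holomorphic_on (\<lambda>w. \<phi> (E w)) ` V"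
    by (rule holomorphic_on_compose_gen[OF k(1) hn, unfolded o_def]) (use k in auto)
  then have "chart_eta holomorphic_on (\<lambda>w. \<phi> (E w)) ` V"
    by (rule holomorphic_transform) (use k in \<open>auto simp: chart_eta_\<phi> pulled_eta_chart[OF EV(1)]\<close>)
  moreover have "z \<in> (\<lambda>w. \<phi> (E w)) ` V" using EV(2) zp by auto
  ultimately show "chart_eta field_differentiable at z within - \<phi> ` corners"
    using op holomorphic_on_imp_differentiable_at field_differentiable_at_within by blast
qed

lemma chart_eta_odd:
  assumes "z \<notin> \<phi> ` corners" shows "chart_eta (- z) = - chart_eta z"
proof -
  define p where "p = inv \<phi> z"
  have zp: "z = \<phi> p" by (simp add: p_def surj_f_inv_f[OF surj])
  then have "p \<notin> corners" using assms by auto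
  then obtain e E V w where EV: "straight_chart K e E V" "p = E w" "w \<in> V"
    using straight_chart_cover[OF K] by blast
  have V: "open V" "(\<lambda>w. \<phi> (E w)) holomorphic_on V"
    using EV(1) square_solution_axioms by (auto simp: straight_chart_def affine_chart_def)
  have "chart_eta (- z) = pulled_eta \<phi> (- E (- (- w)))"
    by (simp add: zp EV(2) odd[symmetric] chart_eta_\<phi>)
  also have "\<dots> = inverse_nonlin (\<lambda>w. \<phi> (- E (- w))) (- w)"
    by (rule pulled_eta_chart[OF straight_chart_neg[OF EV(1)]]) (use EV in auto)
  also have "\<dots> = inverse_nonlin (\<lambda>w. \<phi> (E w)) (- 1 * (- w) + 0) / (- 1)"
    by (rule inverse_nonlin_affine[OF open_negations[OF V(1)] V]) (use EV in \<open>auto simp: odd\<close>)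
  also have "\<dots> = - chart_eta z" by (simp add: zp EV(2) chart_eta_\<phi> pulled_eta_chart[OF EV(1,3)])
  finally show ?thesis .
qed

lemma chart_eta_outside: "p \<notin> Sq \<Longrightarrow> chart_eta (\<phi> p) = inverse_nonlin \<phi> p"
  using pulled_eta_chart[OF straight_chart_outside, of p] by (simp add: chart_eta_\<phi>)

text \<open>
  Cauchy's estimates on unit discs for \<open>\<phi> z - z\<close>, which tends to zero.
\<close>

lemma deriv_outside_at_infinity:
  "(deriv \<phi> \<longlongrightarrow> 1) at_infinity" "(deriv (deriv \<phi>) \<longlongrightarrow> 0) at_infinity"
proof -
  define d where "d z = \<phi> z - z" for z
  have out: "z \<notin> Sq" if "cmod z \<ge> 3" for z
  proof
    assume "z \<in> Sq"
    then have "cmod z \<le> 2" using cmod_le[of z] by (auto simp: Sq_def)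
    then show False using that by simp
  qed
  have hd: "d holomorphic_on - Sq" unfolding d_def by (intro holomorphic_intros hol_out)
  have key: "((deriv ^^ n) d \<longlongrightarrow> 0) at_infinity" for n
  proof (rule tendstoI)
    fix \<epsilon> :: real assume "\<epsilon> > 0"
    then have "\<epsilon> / (2 * fact n) > 0" by simp
    then have "\<forall>\<^sub>F z in at_infinity. dist (d z) 0 < \<epsilon> / (2 * fact n)"
      using norm unfolding d_def by (rule tendstoD[rotated])
    then obtain B where B: "\<And>z. B \<le> cmod z \<Longrightarrow> cmod (d z) < \<epsilon> / (2 * fact n)"
      by (auto simp: eventually_at_infinity)
    have "dist ((deriv ^^ n) d z) 0 < \<epsilon>" if "\<bar>B\<bar> + 4 \<le> cmod z" for z
    proof -
      have far: "cmod x \<ge> \<bar>B\<bar> + 3" if "x \<in> cball z 1" for x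
        using that \<open>\<bar>B\<bar> + 4 \<le> cmod z\<close> norm_triangle_ineq2[of z x] by (simp add: dist_norm)
      have sub: "cball z 1 \<subseteq> - Sq" using far out by (meson ComplI abs_ge_zero le_add_same_cancel2 order_trans subsetI)
      have "cmod ((deriv ^^ n) d z) \<le> fact n * (\<epsilon> / (2 * fact n)) / 1 ^ n"
      proof (rule Cauchy_inequality)
        show "d holomorphic_on ball z 1" using hd sub ball_subset_cball holomorphic_on_subset by (metis subset_trans)
        show "continuous_on (cball z 1) d"
          using hd sub holomorphic_on_imp_continuous_on holomorphic_on_subset by blast
        fix x assume "cmod (z - x) = 1"
        then have "x \<in> cball z 1" by (simp add: dist_norm)
        then have "B \<le> cmod x" using far by fastforce
        then show "cmod (d x) \<le> \<epsilon> / (2 * fact n)" using B[of x] by simp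
      qed simp
      then show ?thesis using \<open>\<epsilon> > 0\<close> by simp
    qed
    then show "\<forall>\<^sub>F z in at_infinity. dist ((deriv ^^ n) d z) 0 < \<epsilon>"
      unfolding eventually_at_infinity by blast
  qed
  have fd: "\<phi> field_differentiable at z" if "z \<notin> Sq" for z
    using hol_out closed_Sq that holomorphic_on_imp_differentiable_at by blast
  have d1: "deriv d z = deriv \<phi> z - 1" if "z \<notin> Sq" for z
    unfolding d_def using fd[OF that] by (subst deriv_diff) auto
  have d2: "deriv (deriv d) z = deriv (deriv \<phi>) z" if "z \<notin> Sq" for z
  proof -
    have "(deriv \<phi> has_field_derivative deriv (deriv \<phi>) z) (at z)"
      by (rule holomorphic_derivI[OF holomorphic_deriv[OF hol_out]]) (use that closed_Sq in auto)
    then have "((\<lambda>z. deriv \<phi> z - 1) has_field_derivative deriv (deriv \<phi>) z) (at z)"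
      by (auto intro!: derivative_eq_intros)
    then have "(deriv d has_field_derivative deriv (deriv \<phi>) z) (at z)"
      by (rule has_field_derivative_transform_within_open[of _ _ _ "- Sq"]) (use that closed_Sq d1 in auto)
    then show ?thesis by (rule DERIV_imp_deriv)
  qed
  have ev: "\<forall>\<^sub>F z in at_infinity. z \<notin> Sq" unfolding eventually_at_infinity using out by blast
  have "((\<lambda>z. deriv d z + 1) \<longlongrightarrow> 0 + 1) at_infinity"
    using key[of 1] by (intro tendsto_intros) simp
  then show "(deriv \<phi> \<longlongrightarrow> 1) at_infinity"
    using Lim_transform_eventually[of "\<lambda>z. deriv d z + 1" _ at_infinity "\<lambda>z. deriv \<phi> z"] eventually_mono[OF ev, of "\<lambda>z. deriv d z + 1 = deriv \<phi> z"]
    by (simp add: d1)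
  have "deriv (deriv d) = (deriv ^^ 2) d" by (simp add: numeral_2_eq_2)
  then have "(deriv (deriv d) \<longlongrightarrow> 0) at_infinity" using key[of 2] by simp
  then show "(deriv (deriv \<phi>) \<longlongrightarrow> 0) at_infinity"
    using Lim_transform_eventually[of "\<lambda>z. deriv (deriv d) z" _ at_infinity "\<lambda>z. deriv (deriv \<phi>) z"] eventually_mono[OF ev, of "\<lambda>z. deriv (deriv d) z = deriv (deriv \<phi>) z"]
    by (simp add: d2)
qed

lemma chart_eta_at_infinity: "(chart_eta \<longlongrightarrow> 0) at_infinity"
proof -
  have "((\<lambda>z. - deriv (deriv \<phi>) z / (deriv \<phi> z)\<^sup>2) \<longlongrightarrow> - 0 / 1\<^sup>2) at_infinity"
    by (intro tendsto_intros deriv_outside_at_infinity) simp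
  then have "((\<lambda>z. inverse_nonlin \<phi> (inv \<phi> z)) \<longlongrightarrow> 0) at_infinity"
    unfolding inverse_nonlin_def by (intro filterlim_compose[OF _ inv_at_infinity]) simp
  moreover have "\<forall>\<^sub>F z in at_infinity. inv \<phi> z \<notin> Sq"
  proof (rule eventually_compose_filterlim[OF _ inv_at_infinity])
    have "z \<notin> Sq" if "3 \<le> cmod z" for z
    proof
      assume "z \<in> Sq"
      then have "cmod z \<le> 2" using cmod_le[of z] by (auto simp: Sq_def)
      then show False using that by simp
    qed
    then show "\<forall>\<^sub>F z in at_infinity. z \<notin> Sq" unfolding eventually_at_infinity by blast
  qed
  then have "\<forall>\<^sub>F z in at_infinity. inverse_nonlin \<phi> (inv \<phi> z) = chart_eta z"
    by eventually_elim (use chart_eta_outside in \<open>metis surj_f_inv_f surj\<close>)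
  ultimately show ?thesis by (rule Lim_transform_eventually)
qed

lemma finite_corner_images: "finite (\<phi> ` corners)" by (simp add: finite_corners)

lemma cnj_corners: "cnj ` (- \<phi> ` corners) = - \<phi> ` corners"
proof -
  have "cnj z \<in> \<phi> ` corners \<longleftrightarrow> z \<in> \<phi> ` corners" for z
  proof -
    have *: "cnj z \<in> \<phi> ` corners" if "z \<in> \<phi> ` corners" for z
    proof -
      from that obtain p where "p \<in> corners" "z = \<phi> p" by auto
      then show ?thesis by (intro image_eqI[of _ _ "cnj p"]) (auto simp: cnj corners_iff)
    qed
    show ?thesis using *[of z] *[of "cnj z"] by auto
  qed
  then show ?thesis by (auto simp: image_cnj_conv_vimage_cnj)
qed

text \<open>
  The identity is checked for the images of points outside \<open>Sq\<close>, where the chart is the identity, and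
  extends by analytic continuation.
\<close>

lemma chart_eta_cnj:
  assumes "z \<notin> \<phi> ` corners" shows "chart_eta (cnj z) = cnj (chart_eta z)"
proof -
  have op: "open (- \<phi> ` corners)" using finite_corner_images finite_imp_closed by blast
  have h2: "(\<lambda>z. cnj (chart_eta (cnj z))) holomorphic_on - \<phi> ` corners"
    using holomorphic_on_compose_cnj_cnj[of chart_eta "- \<phi> ` corners"] chart_eta_holomorphic cnj_corners op
    by (simp add: o_def)
  have oS: "open (- Sq)" using closed_Sq by blast
  have inv0: "cnj (inverse_nonlin \<phi> (cnj p)) = inverse_nonlin \<phi> p" if p: "p \<notin> Sq" for p
  proof -
    have step: "deriv f (cnj p) = cnj (deriv f p)"
      if "\<And>q. q \<notin> Sq \<Longrightarrow> f (cnj q) = cnj (f q)" "f holomorphic_on - Sq" "p \<notin> Sq" for f p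
    proof -
      have "(f has_field_derivative deriv f p) (at p)"
        using holomorphic_derivI[OF that(2) oS] that(3) by simp
      then have "(cnj \<circ> f \<circ> cnj has_field_derivative cnj (deriv f p)) (at (cnj p))"
        by (intro has_field_derivative_cnj_cnj) simp
      then have "(f has_field_derivative cnj (deriv f p)) (at (cnj p))"
      proof (rule has_field_derivative_transform_within_open[OF _ oS])
        show "cnj p \<in> - Sq" using that(3) by (auto simp: Sq_def)
        fix x assume "x \<in> - Sq"
        then have "f (cnj x) = cnj (f x)" using that(1) by simp
        then show "(cnj \<circ> f \<circ> cnj) x = f x" by simp
      qed
      then show ?thesis by (rule DERIV_imp_deriv)
    qed
    have d1: "deriv \<phi> (cnj q) = cnj (deriv \<phi> q)" if "q \<notin> Sq" for q
      by (rule step[OF _ hol_out that]) (simp add: cnj)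
    have d2: "deriv (deriv \<phi>) (cnj p) = cnj (deriv (deriv \<phi>) p)"
      by (rule step[OF d1 holomorphic_deriv[OF hol_out oS] p])
    show ?thesis by (simp add: inverse_nonlin_def d1[OF p] d2)
  qed
  have inj': "inj_on \<phi> (- Sq)" using inj inj_on_subset by blast
  have "cnj (chart_eta (cnj z)) = chart_eta z"
  proof (rule analytic_continuation_open[of "\<phi> ` (- Sq)" "- \<phi> ` corners" "\<lambda>z. cnj (chart_eta (cnj z))" chart_eta])
    show "open (\<phi> ` (- Sq))" by (rule open_mapping_thm3[OF hol_out oS inj'])
    show "open (- \<phi> ` corners)" by (rule op)
    have "3 \<in> - Sq" by (simp add: Sq_def)
    then show "\<phi> ` (- Sq) \<noteq> {}" by blast
    show "connected (- \<phi> ` corners)"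
      using connected_open_delete_finite[of UNIV "\<phi> ` corners"] finite_corner_images connected_UNIV
      by (simp add: Compl_eq_Diff_UNIV)
    show "\<phi> ` (- Sq) \<subseteq> - \<phi> ` corners"
      using inj by (auto simp: inj_eq corners_iff Sq_def) 
    show "(\<lambda>z. cnj (chart_eta (cnj z))) holomorphic_on - \<phi> ` corners" by (rule h2)
    show "chart_eta holomorphic_on - \<phi> ` corners" by (rule chart_eta_holomorphic)
    show "z \<in> - \<phi> ` corners" using assms by simp
    fix x assume "x \<in> \<phi> ` (- Sq)"
    then obtain p where p: "x = \<phi> p" "p \<notin> Sq" by auto
    have "cnj p \<notin> Sq" using p by (auto simp: Sq_def)
    then have "chart_eta (cnj x) = inverse_nonlin \<phi> (cnj p)" by (simp add: p cnj[symmetric] chart_eta_outside)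
    then show "cnj (chart_eta (cnj x)) = chart_eta x" using inv0[OF p(2)] chart_eta_outside[OF p(2)] p by simp
  qed
  then show ?thesis by (metis complex_cnj_cnj)
qed

section \<open>The flat structure around a corner\<close>

text \<open>
  With \<open>\<alpha> = 1 + i \<kappa>\<close> the translation \<open>2 \<pi> i - ln K\<close> (\<open>period\<close>) equals \<open>2 \<pi> i \<alpha>\<close>. Hence
  \<open>t = exp (L / \<alpha>)\<close> is a coordinate on the quotient, and the affine coordinate \<open>exp L\<close> is the power
  \<open>t\<^sup>\<alpha>\<close>.
\<close>

definition kappa :: real where "kappa = ln K / (2 * pi)"
definition alpha :: complex where "alpha = Complex 1 kappa"

text \<open>
  Here \<open>exp L\<close> is the outer affine coordinate at the corner \<open>1 + i\<close>, continued by turning around the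
  corner. The angles from \<open>- \<pi> / 2\<close> to \<open>\<pi>\<close> are outside \<open>Sq\<close>; then the top edge is crossed, where
  the inside is stretched in the vertical direction, and then the right edge, beyond which the
  coordinate has become \<open>1 / K\<close> of the original one. The first case enters \<open>Sq\<close> through the right
  edge instead. The four cases cover one and a half turns, so that every point of the quotient is
  interior.
\<close>

definition corner_chart :: "complex \<Rightarrow> complex" where
  "corner_chart L = 1 + \<i> +
     (if Im L \<le> - pi / 2 then Complex (Re (exp L) / K) (Im (exp L))
      else if Im L \<le> pi then exp L
      else if Im L \<le> 3 * pi / 2 then Complex (Re (exp L)) (K * Im (exp L))
      else of_real K * exp L)"

text \<open>
  The bound on the real part says \<open>K * cmod (exp L) < 1\<close>, which keeps all four cases of the chart
  within distance less than 1 of the corner in each coordinate.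
\<close>

definition corner_dom :: "complex set" where
  "corner_dom = {L. - pi < Im L \<and> Im L < 2 * pi \<and> Re L < - ln K}"

lemma kappa_pos: "kappa > 0" using K by (simp add: kappa_def)
lemma alpha_nz: "alpha \<noteq> 0" by (simp add: alpha_def complex_eq_iff)

lemma open_corner_dom: "open corner_dom"
proof -
  have "corner_dom = {z. - pi < Im z} \<inter> {z. Im z < 2 * pi} \<inter> {z. Re z < - ln K}"
    by (auto simp: corner_dom_def)
  then show ?thesis
    by (metis open_Int open_halfspace_Im_gt open_halfspace_Im_lt open_halfspace_Re_lt)
qed

lemma exp_small:
  assumes "L \<in> corner_dom"
  shows "K * \<bar>Re (exp L)\<bar> < 1" "K * \<bar>Im (exp L)\<bar> < 1" "\<bar>Re (exp L)\<bar> < 1" "\<bar>Im (exp L)\<bar> < 1"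
proof -
  have "cmod (exp L) < exp (- ln K)" using assms by (simp add: corner_dom_def)
  then have "cmod (exp L) < 1 / K" using K by (simp add: exp_minus inverse_eq_divide)
  then have 1: "K * cmod (exp L) < 1" using K by (simp add: field_simps)
  have "\<bar>Re (exp L)\<bar> \<le> cmod (exp L)" "\<bar>Im (exp L)\<bar> \<le> cmod (exp L)"
    by (rule abs_Re_le_cmod abs_Im_le_cmod)+
  then have "K * \<bar>Re (exp L)\<bar> \<le> K * cmod (exp L)" "K * \<bar>Im (exp L)\<bar> \<le> K * cmod (exp L)"
    using K by (intro mult_left_mono; simp)+
  then show a: "K * \<bar>Re (exp L)\<bar> < 1" "K * \<bar>Im (exp L)\<bar> < 1" using 1 by linarith+
  have "1 * \<bar>Re (exp L)\<bar> \<le> K * \<bar>Re (exp L)\<bar>" "1 * \<bar>Im (exp L)\<bar> \<le> K * \<bar>Im (exp L)\<bar>"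
    using K by (intro mult_right_mono; simp)+
  then show "\<bar>Re (exp L)\<bar> < 1" "\<bar>Im (exp L)\<bar> < 1" using a by linarith+
qed

lemma exp_third_quadrant:
  assumes "- pi < Im L \<and> Im L < - pi / 2 \<or> pi < Im L \<and> Im L < 3 * pi / 2"
  shows "Re (exp L) < 0" "Im (exp L) < 0"
proof -
  have "cos (Im L) < 0 \<and> sin (Im L) < 0"
    using assms
  proof
    assume a: "- pi < Im L \<and> Im L < - pi / 2"
    have "cos (Im L + pi) > 0" by (rule cos_gt_zero_pi) (use a in auto)
    moreover have "sin (Im L + pi) > 0" by (rule sin_gt_zero) (use a pi_gt_zero in auto)
    ultimately show ?thesis by simp
  next
    assume a: "pi < Im L \<and> Im L < 3 * pi / 2"
    have "cos (Im L - pi) > 0" by (rule cos_gt_zero_pi) (use a in auto)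
    moreover have "sin (Im L - pi) > 0" by (rule sin_gt_zero) (use a pi_gt_zero in auto)
    ultimately show ?thesis by (simp add: cos_diff sin_diff)
  qed
  then show "Re (exp L) < 0" "Im (exp L) < 0" by (auto simp: Re_exp Im_exp mult_pos_neg)
qed

lemma exp_other_quadrants:
  assumes "- pi / 2 \<le> Im L" "Im L \<le> pi"
  shows "0 \<le> Re (exp L) \<or> 0 \<le> Im (exp L)"
    "- pi / 2 < Im L \<Longrightarrow> Im L < pi \<Longrightarrow> 0 < Re (exp L) \<or> 0 < Im (exp L)"
proof -
  have c: "cos (Im L) \<ge> 0" if "Im L \<le> pi / 2" by (rule cos_ge_zero) (use assms that in auto)
  have s: "sin (Im L) \<ge> 0" if "Im L > pi / 2" by (rule sin_ge_zero) (use assms that pi_gt_zero in linarith)+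
  show "0 \<le> Re (exp L) \<or> 0 \<le> Im (exp L)"
    using c s by (cases "Im L \<le> pi / 2") (auto simp: Re_exp Im_exp)
  assume "- pi / 2 < Im L" "Im L < pi"
  then have "cos (Im L) > 0" if "Im L < pi / 2" by (intro cos_gt_zero_pi) (use that in auto)
  moreover have "sin (Im L) > 0" if "Im L \<ge> pi / 2"
    by (rule sin_gt_zero) (use that \<open>Im L < pi\<close> pi_gt_zero in linarith)+
  ultimately show "0 < Re (exp L) \<or> 0 < Im (exp L)"
    by (cases "Im L < pi / 2") (auto simp: Re_exp Im_exp)
qed

lemma Re_exp_last:
  assumes "3 * pi / 2 < Im L" "Im L < 2 * pi" shows "Re (exp L) > 0"
proof -
  have "cos (Im L - 2 * pi) > 0" by (rule cos_gt_zero_pi) (use assms in auto)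
  then show ?thesis by (simp add: Re_exp cos_diff)
qed

lemma corner_chart_continuous: "continuous_on corner_dom corner_chart"
proof -
  have 1: "Re (exp L) = 0" if "Im L = - pi / 2" for L :: complex
    using that by (simp add: Re_exp)
  have 2: "Im (exp L) = 0" if "Im L = pi" for L :: complex
    using that by (simp add: Im_exp)
  have 3: "Re (exp L) = 0" if "Im L = 3 * pi / 2" for L :: complex
  proof -
    have "Im L = 3 / 2 * pi" using that by simp
    then have "cos (Im L) = 0" by (simp only: cos_3over2_pi)
    then show ?thesis by (simp add: Re_exp)
  qed
  show ?thesis
    unfolding corner_chart_def[abs_def] Complex_eq
  proof (intro continuous_on_add continuous_on_const continuous_on_cases_le)
    show "\<And>t. t \<in> corner_dom \<Longrightarrow> Im t = - pi / 2 \<Longrightarrow>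
         complex_of_real (Re (exp t) / K) + \<i> * complex_of_real (Im (exp t)) =
         (if Im t \<le> pi then exp t
          else if Im t \<le> 3 * pi / 2 then complex_of_real (Re (exp t)) + \<i> * complex_of_real (K * Im (exp t))
               else complex_of_real K * exp t)"
      using 1 pi_ge_two by (auto simp: complex_eq_iff)
    show "\<And>t. t \<in> {t \<in> corner_dom. - pi / 2 \<le> Im t} \<Longrightarrow> Im t = pi \<Longrightarrow> exp t =
         (if Im t \<le> 3 * pi / 2 then complex_of_real (Re (exp t)) + \<i> * complex_of_real (K * Im (exp t))
               else complex_of_real K * exp t)"
      using 2 pi_ge_two by (auto simp: complex_eq_iff)
    show "\<And>t. t \<in> {t \<in> {t \<in> corner_dom. - pi / 2 \<le> Im t}. pi \<le> Im t} \<Longrightarrow> Im t = 3 * pi / 2 \<Longrightarrow>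
        complex_of_real (Re (exp t)) + \<i> * complex_of_real (K * Im (exp t)) = complex_of_real K * exp t"
      using 3 by (auto simp: complex_eq_iff)
  qed (use K in \<open>auto intro!: continuous_intros\<close>)
qed

lemma corner_chart_holomorphic: "(\<lambda>L. \<phi> (corner_chart L)) holomorphic_on corner_dom"
proof -
  define f where "f = (\<lambda>L. \<phi> (corner_chart L))"
  have f: "continuous_on S f" if "S \<subseteq> corner_dom" for S
    unfolding f_def
    by (rule continuous_on_compose2[OF cont[of UNIV] continuous_on_subset[OF corner_chart_continuous that]]) auto
  have inA: "(\<lambda>L. \<phi> (Complex (Re (m L) / K) (Im (m L)))) holomorphic_on S"
    if "m holomorphic_on S" "\<And>L. L \<in> S \<Longrightarrow> \<bar>Re (m L)\<bar> < K \<and> \<bar>Im (m L)\<bar> < 1" for m S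
    by (rule holomorphic_on_compose_gen[OF that(1) hol_in, unfolded o_def]) (use that(2) in auto)
  have out: "(\<lambda>L. \<phi> (m L)) holomorphic_on S"
    if "m holomorphic_on S" "\<And>L. L \<in> S \<Longrightarrow> m L \<notin> Sq" for m S
    by (rule holomorphic_on_compose_gen[OF that(1) hol_out, unfolded o_def]) (use that(2) in auto)
  have p1: "f holomorphic_on corner_dom \<inter> {L. Im L < - pi / 2}"
  proof -
    have "(\<lambda>L. \<phi> (Complex (Re (of_real K + \<i> + exp L) / K) (Im (of_real K + \<i> + exp L))))
        holomorphic_on corner_dom \<inter> {L. Im L < - pi / 2}"
    proof (rule inA)
      fix L assume L: "L \<in> corner_dom \<inter> {L. Im L < - pi / 2}"
      then have "Re (exp L) < 0" "Im (exp L) < 0"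
        using exp_third_quadrant[of L] by (auto simp: corner_dom_def)
      moreover have "\<bar>Re (exp L)\<bar> < 1" "\<bar>Im (exp L)\<bar> < 1" using exp_small[of L] L by auto
      ultimately show "\<bar>Re (of_real K + \<i> + exp L)\<bar> < K \<and> \<bar>Im (of_real K + \<i> + exp L)\<bar> < 1"
        using K unfolding plus_complex.sel by simp
    qed (intro holomorphic_intros)
    moreover have "corner_chart L = Complex (Re (of_real K + \<i> + exp L) / K) (Im (of_real K + \<i> + exp L))"
      if "Im L < - pi / 2" for L
      using that K by (simp add: corner_chart_def complex_eq_iff add_divide_distrib)
    ultimately show ?thesis by (elim holomorphic_transform) (simp add: f_def)
  qed
  have p2: "f holomorphic_on corner_dom \<inter> {L. - pi / 2 < Im L \<and> Im L < pi}"
  proof -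
    have "(\<lambda>L. \<phi> (1 + \<i> + exp L)) holomorphic_on corner_dom \<inter> {L. - pi / 2 < Im L \<and> Im L < pi}"
    proof (rule out)
      fix L assume L: "L \<in> corner_dom \<inter> {L. - pi / 2 < Im L \<and> Im L < pi}"
      then have "0 < Re (exp L) \<or> 0 < Im (exp L)" using exp_other_quadrants(2)[of L] by auto
      then show "1 + \<i> + exp L \<notin> Sq" by (auto simp: Sq_def)
    qed (intro holomorphic_intros)
    then show ?thesis
      by (rule holomorphic_transform) (auto simp: f_def corner_chart_def)
  qed
  have p3: "f holomorphic_on corner_dom \<inter> {L. pi < Im L \<and> Im L < 3 * pi / 2}"
  proof -
    have "(\<lambda>L. \<phi> (Complex (Re (of_real K + \<i> + of_real K * exp L) / K) (Im (of_real K + \<i> + of_real K * exp L))))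
        holomorphic_on corner_dom \<inter> {L. pi < Im L \<and> Im L < 3 * pi / 2}"
    proof (rule inA)
      fix L assume L: "L \<in> corner_dom \<inter> {L. pi < Im L \<and> Im L < 3 * pi / 2}"
      then have "Re (exp L) < 0" "Im (exp L) < 0"
        using exp_third_quadrant[of L] by (auto simp: corner_dom_def)
      then have "K * Re (exp L) < 0" "K * Im (exp L) < 0" using K by (auto simp: mult_pos_neg)
      moreover have "\<bar>K * Re (exp L)\<bar> < 1" "\<bar>K * Im (exp L)\<bar> < 1"
        using exp_small[of L] L K by (auto simp: abs_mult)
      ultimately show "\<bar>Re (of_real K + \<i> + of_real K * exp L)\<bar> < K \<and> \<bar>Im (of_real K + \<i> + of_real K * exp L)\<bar> < 1"
        using K by simp
    qed (intro holomorphic_intros)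
    moreover have "corner_chart L = Complex (Re (of_real K + \<i> + of_real K * exp L) / K) (Im (of_real K + \<i> + of_real K * exp L))"
      if "pi < Im L" "Im L < 3 * pi / 2" for L
      using that K pi_gt_zero by (simp add: corner_chart_def complex_eq_iff add_divide_distrib)
    ultimately show ?thesis by (elim holomorphic_transform) (simp add: f_def)
  qed
  have p4: "f holomorphic_on corner_dom \<inter> {L. 3 * pi / 2 < Im L}"
  proof -
    have "(\<lambda>L. \<phi> (1 + \<i> + of_real K * exp L)) holomorphic_on corner_dom \<inter> {L. 3 * pi / 2 < Im L}"
    proof (rule out)
      fix L assume L: "L \<in> corner_dom \<inter> {L. 3 * pi / 2 < Im L}"
      then have "0 < Re (exp L)" using Re_exp_last[of L] by (auto simp: corner_dom_def)
      then have "0 < K * Re (exp L)" using K by simp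
      then show "1 + \<i> + of_real K * exp L \<notin> Sq" by (auto simp: Sq_def)
    qed (intro holomorphic_intros)
    then show ?thesis
      by (rule holomorphic_transform) (use pi_ge_two in \<open>auto simp: f_def corner_chart_def\<close>)
  qed
  have q1: "f holomorphic_on corner_dom \<inter> {L. Im L < pi}"
  proof (rule holomorphic_on_paste_across_line[where d = \<i> and k = "- pi / 2"])
    show "open (corner_dom \<inter> {L. Im L < pi})" by (intro open_Int open_corner_dom open_halfspace_Im_lt)
    show "f holomorphic_on corner_dom \<inter> {L. Im L < pi} \<inter> {z. \<i> \<bullet> z < - pi / 2}"
      by (rule holomorphic_on_subset[OF p1]) (auto simp: inner_complex_def)
    show "f holomorphic_on corner_dom \<inter> {L. Im L < pi} \<inter> {z. - pi / 2 < \<i> \<bullet> z}"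
      by (rule holomorphic_on_subset[OF p2]) (auto simp: inner_complex_def)
    show "continuous_on (corner_dom \<inter> {L. Im L < pi}) f" by (rule f) auto
  qed simp
  have q2: "f holomorphic_on corner_dom \<inter> {L. pi < Im L}"
  proof (rule holomorphic_on_paste_across_line[where d = \<i> and k = "3 * pi / 2"])
    show "open (corner_dom \<inter> {L. pi < Im L})" by (intro open_Int open_corner_dom open_halfspace_Im_gt)
    show "f holomorphic_on corner_dom \<inter> {L. pi < Im L} \<inter> {z. \<i> \<bullet> z < 3 * pi / 2}"
      by (rule holomorphic_on_subset[OF p3]) (auto simp: inner_complex_def)
    show "f holomorphic_on corner_dom \<inter> {L. pi < Im L} \<inter> {z. 3 * pi / 2 < \<i> \<bullet> z}"
      by (rule holomorphic_on_subset[OF p4]) (auto simp: inner_complex_def)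
    show "continuous_on (corner_dom \<inter> {L. pi < Im L}) f" by (rule f) auto
  qed simp
  have "f holomorphic_on corner_dom"
  proof (rule holomorphic_on_paste_across_line[OF open_corner_dom, where d = \<i> and k = pi])
    show "f holomorphic_on corner_dom \<inter> {z. \<i> \<bullet> z < pi}"
      by (rule holomorphic_on_subset[OF q1]) (auto simp: inner_complex_def)
    show "f holomorphic_on corner_dom \<inter> {z. pi < \<i> \<bullet> z}"
      by (rule holomorphic_on_subset[OF q2]) (auto simp: inner_complex_def)
    show "continuous_on corner_dom f" by (rule f) auto
  qed simp
  then show ?thesis by (simp add: f_def)
qed

definition period :: complex where "period = Complex (- ln K) (2 * pi)"

lemma period_alpha: "period / alpha = 2 * pi * \<i>"
proof -
  have "period = 2 * pi * \<i> * alpha" by (simp add: period_def alpha_def kappa_def complex_eq_iff)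
  then show ?thesis using alpha_nz by simp
qed

lemma exp_period: "exp (L + period) = exp L / of_real K"
proof -
  have "period = - of_real (ln K) + of_real (2 * pi) * \<i>" by (simp add: period_def complex_eq_iff)
  then have "exp (L + period) = exp L * (exp (- of_real (ln K)) * exp (2 * pi * \<i>))"
    by (simp only: exp_add)
  also have "exp (- complex_of_real (ln K)) = inverse (of_real K)"
    using K by (simp add: exp_minus exp_of_real)
  also have "exp (complex_of_real (2 * pi) * \<i>) = 1" by (simp add: exp_two_pi_i)
  finally show ?thesis by (simp add: divide_inverse)
qed

lemma corner_chart_period:
  assumes "L \<in> corner_dom" "L + period \<in> corner_dom"
  shows "corner_chart (L + period) = corner_chart L"
proof -
  have Im: "Im (L + period) = Im L + 2 * pi" by (simp add: period_def)
  have b: "- pi < Im L" "Im L < 0" using assms unfolding corner_dom_def Im mem_Collect_eq by linarith+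
  show ?thesis
  proof (cases "Im L \<le> - pi / 2")
    case True
    then show ?thesis
      using b K unfolding corner_chart_def Im exp_period by (simp add: complex_eq_iff)
  next
    case False
    then show ?thesis
      using b K unfolding corner_chart_def Im exp_period by (simp add: complex_eq_iff)
  qed
qed

text \<open>
  Two values of \<open>L\<close> in the domain with the same \<open>exp (L / \<alpha>)\<close> differ by at most one period, as
  the imaginary parts range over an interval of length \<open>3 \<pi>\<close>.
\<close>

lemma corner_chart_eq_mod_period:
  assumes L: "L \<in> corner_dom" "L' \<in> corner_dom" and e: "exp (L / alpha) = exp (L' / alpha)"
  shows "corner_chart L = corner_chart L'"
proof -
  obtain n :: int where n: "L / alpha = L' / alpha + of_int (2 * n) * pi * \<i>"
    using e unfolding exp_eq by blast
  have "2 * pi * \<i> * alpha = period" using period_alpha alpha_nz by (metis nonzero_eq_divide_eq)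
  have "L = (L / alpha) * alpha" using alpha_nz by simp
  also have "\<dots> = L' + of_int n * (2 * pi * \<i> * alpha)" unfolding n using alpha_nz by (simp add: algebra_simps)
  finally have n': "L = L' + of_int n * period" by (simp only: \<open>2 * pi * \<i> * alpha = period\<close>)
  then have "Im L = Im L' + of_int n * (2 * pi)" by (simp add: period_def)
  moreover have "\<bar>Im L - Im L'\<bar> < 3 * pi" using L by (auto simp: corner_dom_def)
  ultimately have "\<bar>of_int n * (2 * pi)\<bar> < 3 * pi" by simp
  then have "\<bar>real_of_int n\<bar> * (2 * pi) < 3 / 2 * (2 * pi)" by (simp add: abs_mult)
  then have "\<bar>real_of_int n\<bar> < 3 / 2" by (rule mult_right_less_imp_less) simp
  then have "\<bar>n\<bar> \<le> 1" by linarith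
  then consider "n = 0" | "n = 1" | "n = -1" by linarith
  then show ?thesis
  proof cases
    case 2
    then show ?thesis using corner_chart_period[of L'] L n' by simp
  next
    case 3
    then have "L' = L + period" using n' by simp
    then show ?thesis using corner_chart_period[of L] L by simp
  qed (use n' in simp)
qed

lemma corner_chart_inj:
  assumes L: "L \<in> corner_dom" "L' \<in> corner_dom"
    and s: "- pi / 2 \<le> Im L" "Im L < 3 * pi / 2" "- pi / 2 \<le> Im L'" "Im L' < 3 * pi / 2"
    and e: "corner_chart L = corner_chart L'"
  shows "exp L = exp L'"
proof -
  define B where "B L = (if Im L \<le> pi then exp L else Complex (Re (exp L)) (K * Im (exp L)))" for L
  have B: "corner_chart M = 1 + \<i> + B M" if "- pi / 2 \<le> Im M" "Im M < 3 * pi / 2" for M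
  proof (cases "Im M = - pi / 2")
    case True
    then have "Re (exp M) = 0" by (simp add: Re_exp)
    then show ?thesis using True pi_ge_two by (auto simp: corner_chart_def B_def complex_eq_iff)
  qed (use that in \<open>auto simp: corner_chart_def B_def\<close>)
  have eq: "B L = B L'" using e B s by simp
  have mix: False if "- pi / 2 \<le> Im M" "Im M \<le> pi" "pi < Im M'" "Im M' < 3 * pi / 2" "B M = B M'" for M M'
  proof -
    have "Re (exp M') < 0" "Im (exp M') < 0" using exp_third_quadrant[of M'] that by auto
    then have "Re (B M') < 0" "Im (B M') < 0" using that K by (auto simp: B_def mult_pos_neg)
    then show False using exp_other_quadrants(1)[of M] that by (auto simp: B_def)
  qed
  consider "Im L \<le> pi" "Im L' \<le> pi" | "Im L > pi" "Im L' > pi" | "Im L \<le> pi" "Im L' > pi" | "Im L > pi" "Im L' \<le> pi"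
    by linarith
  then show ?thesis
  proof cases
    case 1 then show ?thesis using eq by (simp add: B_def)
  next
    case 2 then show ?thesis using eq K by (simp add: B_def complex_eq_iff)
  next
    case 3 then show ?thesis using mix[of L L'] s eq by simp
  next
    case 4 then show ?thesis using mix[of L' L] s eq by simp
  qed
qed

lemma corner_chart_near:
  assumes "L \<in> corner_dom"
  shows "corner_chart L \<noteq> 1 + \<i>" "corner_chart L \<notin> corners"
    "cmod (corner_chart L - (1 + \<i>)) \<le> 2 * K * exp (Re L)"
proof -
  define B where "B = corner_chart L - (1 + \<i>)"
  have L: "corner_chart L = 1 + \<i> + B" by (simp add: B_def)
  have B: "\<bar>Re B\<bar> < 1 \<and> \<bar>Im B\<bar> < 1 \<and> B \<noteq> 0 \<and> \<bar>Re B\<bar> \<le> K * exp (Re L) \<and> \<bar>Im B\<bar> \<le> K * exp (Re L)"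
  proof -
    note es = exp_small[OF assms]
    have r: "\<bar>Re (exp L)\<bar> \<le> exp (Re L)" "\<bar>Im (exp L)\<bar> \<le> exp (Re L)"
      using abs_Re_le_cmod[of "exp L"] abs_Im_le_cmod[of "exp L"] by auto
    have Kr: "K * \<bar>Re (exp L)\<bar> \<le> K * exp (Re L)" "K * \<bar>Im (exp L)\<bar> \<le> K * exp (Re L)"
      using r K by auto
    have d: "\<bar>Re (exp L) / K\<bar> \<le> \<bar>Re (exp L)\<bar>"
      using K by (simp add: abs_div divide_le_eq mult_le_cancel_left1)
    have "1 * exp (Re L) \<le> K * exp (Re L)" using K by (intro mult_right_mono) auto
    then have r': "\<bar>Re (exp L)\<bar> \<le> K * exp (Re L)" "\<bar>Im (exp L)\<bar> \<le> K * exp (Re L)" using r by linarith+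
    have nz: "\<not> (Re (exp L) = 0 \<and> Im (exp L) = 0)" using exp_not_eq_zero[of L] by (auto simp: complex_eq_iff)
    have "B = Complex (Re (exp L) / K) (Im (exp L)) \<or> B = exp L \<or>
       B = Complex (Re (exp L)) (K * Im (exp L)) \<or> B = of_real K * exp L"
      by (auto simp: B_def corner_chart_def)
    then show ?thesis
      using es Kr r' nz d K by (elim disjE) (auto simp: complex_eq_iff abs_mult)
  qed
  show "corner_chart L \<noteq> 1 + \<i>" using B L by simp
  show "corner_chart L \<notin> corners"
    unfolding corners_iff L using B by (auto simp: complex_eq_iff)
  have "cmod B \<le> \<bar>Re B\<bar> + \<bar>Im B\<bar>" by (rule cmod_le)
  then show "cmod (corner_chart L - (1 + \<i>)) \<le> 2 * K * exp (Re L)" using B unfolding B_def by linarith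
qed

section \<open>The residue at a corner\<close>

text \<open>
  Small enough that a value of \<open>L\<close> over \<open>t\<close> with bounded imaginary part lies in \<open>corner_dom\<close>; see
  \<open>corner_log_in_dom\<close>.
\<close>

definition corner_radius :: real where "corner_radius = exp (- (ln K + kappa * pi + 1))"

lemma corner_radius: "0 < corner_radius" "corner_radius < 1"
proof -
  have "ln K > 0" using K by simp
  moreover have "kappa * pi > 0" using kappa_pos by simp
  ultimately show "0 < corner_radius" "corner_radius < 1" by (simp_all add: corner_radius_def)
qed

text \<open>
  Because \<open>\<alpha>\<close> is not real, the branch of \<open>L\<close> that stays in a horizontal strip spirals with
  respect to the logarithm of \<open>t\<close>. Its real part nevertheless tends to \<open>- \<infinity>\<close> with \<open>t \<longrightarrow> 0\<close>.
\<close>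

lemma Re_corner_log:
  assumes "exp (L / alpha) = t"
  shows "Re L = (1 + kappa\<^sup>2) * ln (cmod t) - kappa * Im L"
proof -
  have "ln (cmod t) = Re (L / alpha)" using assms by (metis ln_exp norm_exp_eq_Re)
  also have "\<dots> = (Re L + kappa * Im L) / (1 + kappa\<^sup>2)"
    by (simp add: Re_divide alpha_def mult.commute)
  finally show ?thesis by (simp add: field_simps add_pos_nonneg[THEN less_imp_neq, symmetric])
qed

lemma corner_log_in_dom:
  assumes t: "exp (L / alpha) = t" "cmod t < corner_radius" and Im: "- pi < Im L" "Im L < 2 * pi"
  shows "L \<in> corner_dom"
proof -
  have "t \<noteq> 0" using t(1) by auto
  then have "ln (cmod t) < ln corner_radius" using t(2) corner_radius by simp
  then have l: "ln (cmod t) < - (ln K + kappa * pi + 1)" by (simp add: corner_radius_def)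
  have "ln K > 0" "kappa * pi > 0" using K kappa_pos by simp_all
  then have "ln (cmod t) \<le> 0" using l by linarith
  then have "kappa\<^sup>2 * ln (cmod t) \<le> 0" by (simp add: mult_nonneg_nonpos)
  moreover have "kappa * Im L \<ge> kappa * (- pi)" using kappa_pos Im by (intro mult_left_mono) auto
  ultimately have "Re L < - ln K" using Re_corner_log[OF t(1)] l by (simp add: distrib_right)
  then show ?thesis using Im by (simp add: corner_dom_def)
qed

lemma corner_log_exists:
  assumes "t \<noteq> 0"
  shows "\<exists>L. - pi / 2 \<le> Im L \<and> Im L < 3 * pi / 2 \<and> exp (L / alpha) = t"
proof -
  define L0 where "L0 = alpha * Ln t"
  \<comment> \<open>The number of periods that brings the imaginary part of \<open>L\<close> to the first turn.\<close>
  define n where "n = \<lceil>(- pi / 2 - Im L0) / (2 * pi)\<rceil>"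
  define L where "L = L0 + of_int n * period"
  have "(- pi / 2 - Im L0) / (2 * pi) \<le> of_int n" "of_int n < (- pi / 2 - Im L0) / (2 * pi) + 1"
    unfolding n_def by linarith+
  then have "- pi / 2 - Im L0 \<le> of_int n * (2 * pi)" "of_int n * (2 * pi) < - pi / 2 - Im L0 + 2 * pi"
    using pi_gt_zero by (simp_all add: divide_le_eq less_divide_eq field_simps)
  moreover have "Im L = Im L0 + of_int n * (2 * pi)" by (simp add: L_def period_def)
  ultimately have "- pi / 2 \<le> Im L" "Im L < 3 * pi / 2" by linarith+
  moreover have "L / alpha = alpha * Ln t / alpha + of_int n * (period / alpha)"
    by (simp add: L_def L0_def add_divide_distrib)
  then have "L / alpha = Ln t + of_int n * (2 * pi * \<i>)"
    using alpha_nz unfolding period_alpha by simp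
  then have "exp (L / alpha) = t * exp (of_int n * (2 * pi * \<i>))" by (simp only: exp_add exp_Ln[OF assms])
  moreover have "exp (of_int n * (2 * pi * \<i>)) = 1"
    using exp_integer_2pi[of "of_int n"] by (simp add: mult_ac)
  ultimately show ?thesis by auto
qed

definition corner_log :: "complex \<Rightarrow> complex" where
  "corner_log t = (SOME L. - pi / 2 \<le> Im L \<and> Im L < 3 * pi / 2 \<and> exp (L / alpha) = t)"

text \<open>
  The composition of \<open>\<phi>\<close> with the uniformization of a punctured neighbourhood of the corner,
  extended to the puncture. The branch chosen in \<open>corner_log\<close> jumps, but by
  \<open>corner_chart_eq_mod_period\<close> the composition does not depend on it.
\<close>

definition corner_param :: "complex \<Rightarrow> complex" where
  "corner_param t = (if t = 0 then \<phi> (1 + \<i>) else \<phi> (corner_chart (corner_log t)))"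

lemma corner_log:
  assumes "t \<noteq> 0" "cmod t < corner_radius"
  shows "- pi / 2 \<le> Im (corner_log t)" "Im (corner_log t) < 3 * pi / 2" "exp (corner_log t / alpha) = t" "corner_log t \<in> corner_dom"
proof -
  have r: "- pi / 2 \<le> Im (corner_log t) \<and> Im (corner_log t) < 3 * pi / 2 \<and> exp (corner_log t / alpha) = t"
    unfolding corner_log_def by (rule someI_ex[OF corner_log_exists[OF assms(1)]])
  then show "- pi / 2 \<le> Im (corner_log t)" "Im (corner_log t) < 3 * pi / 2" "exp (corner_log t / alpha) = t" by auto
  show "corner_log t \<in> corner_dom"
    by (rule corner_log_in_dom[OF _ assms(2)]) (use r pi_ge_two in auto)
qed

lemma corner_param_eq:
  assumes "t \<noteq> 0" "cmod t < corner_radius" "L \<in> corner_dom" "exp (L / alpha) = t"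
  shows "corner_param t = \<phi> (corner_chart L)"
  using corner_chart_eq_mod_period[OF corner_log(4)[OF assms(1,2)] assms(3)] corner_log(3)[OF assms(1,2)] assms
  by (simp add: corner_param_def)

lemma corner_param_inj: "inj_on corner_param (ball 0 corner_radius)"
proof (rule inj_onI)
  fix t t' assume t: "t \<in> ball 0 corner_radius" "t' \<in> ball 0 corner_radius" and e: "corner_param t = corner_param t'"
  have nz: "corner_param s \<noteq> \<phi> (1 + \<i>)" if "s \<noteq> 0" "s \<in> ball 0 corner_radius" for s
    using corner_chart_near(1)[OF corner_log(4)[of s]] that inj by (simp add: corner_param_def inj_eq)
  consider "t = 0" | "t' = 0" | "t \<noteq> 0" "t' \<noteq> 0" by blast
  then show "t = t'"
  proof cases
    case 1
    then show ?thesis using nz[of t'] t e by (auto simp: corner_param_def split: if_splits)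
  next
    case 2
    then show ?thesis using nz[of t] t e by (auto simp: corner_param_def split: if_splits)
  next
    case 3
    then have "corner_chart (corner_log t) = corner_chart (corner_log t')" using e inj by (simp add: corner_param_def inj_eq)
    moreover have c: "cmod t < corner_radius" "cmod t' < corner_radius" using t by auto
    note r = corner_log[OF 3(1) c(1)] and r' = corner_log[OF 3(2) c(2)]
    ultimately have "exp (corner_log t) = exp (corner_log t')"
      by (intro corner_chart_inj[OF r(4) r'(4) r(1,2) r'(1,2)])
    then obtain n :: int where n: "corner_log t = corner_log t' + of_int (2 * n) * pi * \<i>"
      unfolding exp_eq by blast
    then have "Im (corner_log t) - Im (corner_log t') = real_of_int n * (2 * pi)" by simp
    moreover have "\<bar>Im (corner_log t) - Im (corner_log t')\<bar> < 1 * (2 * pi)" using r(1,2) r'(1,2) by linarith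
    ultimately have "\<bar>real_of_int n\<bar> * (2 * pi) < 1 * (2 * pi)" by (simp add: abs_mult)
    then have "\<bar>real_of_int n\<bar> < 1" by (rule mult_right_less_imp_less) simp
    then have "n = 0" by linarith
    then have "corner_log t = corner_log t'" using n by simp
    then have "exp (corner_log t / alpha) = exp (corner_log t' / alpha)" by (simp only:)
    then show ?thesis by (simp only: r(3) r'(3))
  qed
qed

lemma corner_param_local:
  assumes t0: "t0 \<noteq> 0" "cmod t0 < corner_radius" and L0: "exp (L0 / alpha) = t0" "L0 \<in> U" and U: "open U" "U \<subseteq> corner_dom"
  shows "\<exists>N. open N \<and> t0 \<in> N \<and> N \<subseteq> ball 0 corner_radius - {0} \<and> (\<forall>t\<in>N. t / t0 \<notin> \<real>\<^sub>\<le>\<^sub>0 \<and> L0 + alpha * Ln (t / t0) \<in> U \<and>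
     corner_param t = \<phi> (corner_chart (L0 + alpha * Ln (t / t0))))"
proof -
  define M where "M = (ball 0 corner_radius - {0}) \<inter> (\<lambda>t. t / t0) -` (- \<real>\<^sub>\<le>\<^sub>0)"
  define l where "l t = L0 + alpha * Ln (t / t0)" for t
  have M: "open M"
    unfolding M_def
    by (intro open_Int open_delete open_ball open_vimage open_Compl closed_nonpos_Reals_complex continuous_intros) (use t0 in auto)
  have "continuous_on M l"
    unfolding l_def by (intro continuous_intros) (use t0 in \<open>auto simp: M_def\<close>)
  then have N: "open (M \<inter> l -` U)"
    by (rule continuous_open_preimage[OF _ M U(1)])
  have "t0 \<in> M \<inter> l -` U" using t0 L0 by (auto simp: M_def l_def)
  moreover have "corner_param t = \<phi> (corner_chart (l t))" if t: "t \<in> M \<inter> l -` U" for t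
  proof (rule corner_param_eq)
    show "t \<noteq> 0" "cmod t < corner_radius" "l t \<in> corner_dom" using t U by (auto simp: M_def)
    have "l t / alpha = L0 / alpha + Ln (t / t0)" using alpha_nz by (simp add: l_def add_divide_distrib)
    then show "exp (l t / alpha) = t" using L0 t0 \<open>t \<noteq> 0\<close> by (simp add: exp_add)
  qed
  ultimately show ?thesis
    by (intro exI[of _ "M \<inter> l -` U"] conjI N ballI) (auto simp: M_def l_def)
qed

text \<open>
  Away from zero, a locally continuous branch of \<open>L\<close> may be used. At zero the function is
  continuous, so the singularity is removable.
\<close>

lemma corner_param_holomorphic: "corner_param holomorphic_on ball 0 corner_radius"
proof (rule no_isolated_singularity[where K = "{0}"])
  have fd: "corner_param field_differentiable at t0" if "t0 \<in> ball 0 corner_radius - {0}" for t0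
  proof -
    have t0: "t0 \<noteq> 0" "cmod t0 < corner_radius" using that by auto
    obtain N where N: "open N" "t0 \<in> N" and n: "\<forall>t\<in>N. t / t0 \<notin> \<real>\<^sub>\<le>\<^sub>0 \<and> corner_log t0 + alpha * Ln (t / t0) \<in> corner_dom \<and>
       corner_param t = \<phi> (corner_chart (corner_log t0 + alpha * Ln (t / t0)))"
      using corner_param_local[OF t0 corner_log(3)[OF t0] corner_log(4)[OF t0] open_corner_dom order_refl] by blast
    have "(\<lambda>t. \<phi> (corner_chart (corner_log t0 + alpha * Ln (t / t0)))) holomorphic_on N"
      by (rule holomorphic_on_compose_gen[OF _ corner_chart_holomorphic, unfolded o_def])
        (use n t0 in \<open>auto intro!: holomorphic_intros\<close>)
    then have "corner_param holomorphic_on N" by (rule holomorphic_transform) (use n in simp)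
    then show ?thesis using N holomorphic_on_imp_differentiable_at by blast
  qed
  then show "corner_param holomorphic_on ball 0 corner_radius - {0}"
    by (auto simp: holomorphic_on_def intro: field_differentiable_at_within)
  have "isCont corner_param t" if "t \<in> ball 0 corner_radius" for t
  proof (cases "t = 0")
    case False
    then show ?thesis using fd that by (intro field_differentiable_imp_continuous_at) auto
  next
    case True
    have b: "cmod (corner_chart (corner_log s) - (1 + \<i>)) \<le> 2 * K * exp (kappa * pi) * cmod s"
      if s: "s \<noteq> 0" "cmod s < corner_radius" for s
    proof -
      have l0: "ln (cmod s) \<le> 0" using s corner_radius by simp
      then have "kappa\<^sup>2 * ln (cmod s) \<le> 0" by (simp add: mult_nonneg_nonpos)
      moreover have "kappa * Im (corner_log s) \<ge> kappa * (- pi)"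
        using kappa_pos corner_log(1)[OF s] pi_ge_two by (intro mult_left_mono) auto
      ultimately have "Re (corner_log s) \<le> kappa * pi + ln (cmod s)"
        using Re_corner_log[OF corner_log(3)[OF s]] by (simp add: distrib_right)
      then have "exp (Re (corner_log s)) \<le> exp (kappa * pi + ln (cmod s))" by simp
      also have "\<dots> = exp (kappa * pi) * cmod s" using s by (simp add: exp_add)
      finally have "2 * K * exp (Re (corner_log s)) \<le> 2 * K * (exp (kappa * pi) * cmod s)"
        using K by (intro mult_left_mono) auto
      then show ?thesis using corner_chart_near(3)[OF corner_log(4)[OF s]] by (simp add: mult.assoc)
    qed
    have "((\<lambda>s. corner_chart (corner_log s) - (1 + \<i>)) \<longlongrightarrow> 0) (at 0)"
    proof (rule Lim_null_comparison)
      show "((\<lambda>s. 2 * K * exp (kappa * pi) * cmod s) \<longlongrightarrow> 0) (at 0)"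
        by (auto intro!: tendsto_eq_intros)
      have "\<forall>\<^sub>F s in at 0. s \<in> ball 0 corner_radius - {0}"
        using corner_radius by (intro eventually_at_in_open) auto
      then show "\<forall>\<^sub>F s in at 0. norm (corner_chart (corner_log s) - (1 + \<i>)) \<le> 2 * K * exp (kappa * pi) * cmod s"
        by eventually_elim (use b in auto)
    qed
    then have "((\<lambda>s. corner_chart (corner_log s)) \<longlongrightarrow> 1 + \<i>) (at 0)" by (simp add: LIM_zero_iff)
    moreover have "isCont \<phi> (1 + \<i>)" using cont[of UNIV] by (simp add: continuous_on_eq_continuous_at)
    ultimately have "((\<lambda>s. \<phi> (corner_chart (corner_log s))) \<longlongrightarrow> \<phi> (1 + \<i>)) (at 0)"
      by (rule isCont_tendsto_compose[rotated])
    moreover have "\<forall>\<^sub>F s in at (0::complex). \<phi> (corner_chart (corner_log s)) = corner_param s"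
      by (auto simp: eventually_at_filter corner_param_def)
    ultimately have "(corner_param \<longlongrightarrow> \<phi> (1 + \<i>)) (at 0)" by (rule Lim_transform_eventually)
    then show ?thesis using True by (simp add: isCont_def corner_param_def)
  qed
  then show "continuous_on (ball 0 corner_radius) corner_param" by (simp add: continuous_at_imp_continuous_on)
qed simp_all

lemma corner_param_not_corner:
  assumes "t \<in> ball 0 corner_radius - {0}" shows "corner_param t \<notin> \<phi> ` corners"
  using corner_chart_near(2)[OF corner_log(4)[of t]] assms inj by (auto simp: corner_param_def inj_eq)

text \<open>
  On a set where the corner chart is \<open>1 + i + u\<close> with \<open>u = t\<^sup>\<alpha>\<close> up to a constant factor, the
  formula follows by expressing \<open>\<phi>'\<close> and \<open>\<phi>''\<close> through the derivatives of \<open>corner_param\<close>.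
\<close>

lemma chart_eta_corner_param_sector:
  "\<exists>N. open N \<and> N \<noteq> {} \<and> N \<subseteq> ball 0 corner_radius - {0} \<and> (\<forall>t\<in>N.
     chart_eta (corner_param t) = - (deriv (deriv corner_param) t * t + (1 - alpha) * deriv corner_param t) / ((deriv corner_param t)\<^sup>2 * t))"
proof -
  \<comment> \<open>A real value of \<open>L\<close> for which \<open>cmod t\<close> is \<open>corner_radius / exp 1\<close>.\<close>
  define L0 where "L0 = complex_of_real ((1 + kappa\<^sup>2) * (ln corner_radius - 1))"
  define t0 where "t0 = exp (L0 / alpha)"
  have pos: "1 + kappa\<^sup>2 > 0" by (simp add: add_pos_nonneg)
  have "Re (L0 / alpha) = ln corner_radius - 1" using pos by (simp add: L0_def Re_divide alpha_def)
  then have "cmod t0 = corner_radius * exp (- 1)" using corner_radius by (simp add: t0_def exp_diff exp_minus divide_inverse)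
  then have t0: "t0 \<noteq> 0" "cmod t0 < corner_radius" using corner_radius by (auto simp: t0_def)
  define U where "U = corner_dom \<inter> ({L. - pi / 2 < Im L} \<inter> {L. Im L < pi})"
  have U: "open U" unfolding U_def
    by (intro open_Int open_corner_dom open_halfspace_Im_gt open_halfspace_Im_lt)
  have "L0 \<in> corner_dom"
    by (rule corner_log_in_dom[OF t0_def[symmetric] t0(2)]) (simp_all add: L0_def)
  then have "L0 \<in> U" by (simp add: U_def L0_def)
  then obtain N where N: "open N" "t0 \<in> N" "N \<subseteq> ball 0 corner_radius - {0}"
    and n: "\<forall>t\<in>N. t / t0 \<notin> \<real>\<^sub>\<le>\<^sub>0 \<and> L0 + alpha * Ln (t / t0) \<in> U \<and> corner_param t = \<phi> (corner_chart (L0 + alpha * Ln (t / t0)))"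
    using corner_param_local[OF t0 t0_def[symmetric] _ U, of] U_def by (metis inf_le1)
  define u where "u t = exp (L0 + alpha * Ln (t / t0))" for t
  have cm: "corner_param t = \<phi> (1 + \<i> + u t)" and ou: "1 + \<i> + u t \<notin> Sq" if "t \<in> N" for t
  proof -
    have "- pi / 2 < Im (L0 + alpha * Ln (t / t0))" "Im (L0 + alpha * Ln (t / t0)) < pi"
      using n that by (auto simp: U_def)
    note b = this
    show "corner_param t = \<phi> (1 + \<i> + u t)" using n that b by (simp add: corner_chart_def u_def)
    have "0 < Re (u t) \<or> 0 < Im (u t)" unfolding u_def by (rule exp_other_quadrants(2)) (use b in auto)
    then show "1 + \<i> + u t \<notin> Sq" by (auto simp: Sq_def)
  qed
  have u': "(u has_field_derivative alpha * u t / t) (at t)" if "t \<in> N" for t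
  proof -
    have "t / t0 \<notin> \<real>\<^sub>\<le>\<^sub>0" "t \<noteq> 0" using n N that by auto
    then show ?thesis unfolding u_def
      using t0 by (auto intro!: derivative_eq_intros simp: field_simps)
  qed
  have oS: "open (- Sq)" using closed_Sq by blast
  have d1: "deriv corner_param t = deriv \<phi> (1 + \<i> + u t) * (alpha * u t / t)" if "t \<in> N" for t
  proof -
    have "((\<lambda>t. 1 + \<i> + u t) has_field_derivative alpha * u t / t) (at t)"
      using u'[OF that] by (auto intro!: derivative_eq_intros)
    moreover have "(\<phi> has_field_derivative deriv \<phi> (1 + \<i> + u t)) (at (1 + \<i> + u t))"
      using holomorphic_derivI[OF hol_out oS] ou[OF that] by simp
    ultimately have "((\<lambda>t. \<phi> (1 + \<i> + u t)) has_field_derivative deriv \<phi> (1 + \<i> + u t) * (alpha * u t / t)) (at t)"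
      by (rule DERIV_chain2[rotated])
    then have "(corner_param has_field_derivative deriv \<phi> (1 + \<i> + u t) * (alpha * u t / t)) (at t)"
      by (rule has_field_derivative_transform_within_open[OF _ N(1) that]) (simp add: cm)
    then show ?thesis by (rule DERIV_imp_deriv)
  qed
  have d2: "deriv (deriv corner_param) t = deriv (deriv \<phi>) (1 + \<i> + u t) * (alpha * u t / t)\<^sup>2
      + deriv \<phi> (1 + \<i> + u t) * (alpha * (alpha - 1) * u t / t\<^sup>2)" if "t \<in> N" for t
  proof -
    have t: "t \<noteq> 0" using N that by auto
    have "((\<lambda>t. 1 + \<i> + u t) has_field_derivative alpha * u t / t) (at t)"
      using u'[OF that] by (auto intro!: derivative_eq_intros)
    moreover have "(deriv \<phi> has_field_derivative deriv (deriv \<phi>) (1 + \<i> + u t)) (at (1 + \<i> + u t))"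
      using holomorphic_derivI[OF holomorphic_deriv[OF hol_out oS] oS] ou[OF that] by simp
    ultimately have a: "((\<lambda>t. deriv \<phi> (1 + \<i> + u t)) has_field_derivative deriv (deriv \<phi>) (1 + \<i> + u t) * (alpha * u t / t)) (at t)"
      by (rule DERIV_chain2[rotated])
    have b: "((\<lambda>t. alpha * u t / t) has_field_derivative alpha * (alpha - 1) * u t / t\<^sup>2) (at t)"
      using t by (auto intro!: derivative_eq_intros u'[OF that] simp: field_simps power2_eq_square)
    from DERIV_mult[OF a b]
    have "((\<lambda>t. deriv \<phi> (1 + \<i> + u t) * (alpha * u t / t)) has_field_derivative
       deriv (deriv \<phi>) (1 + \<i> + u t) * (alpha * u t / t)\<^sup>2
      + deriv \<phi> (1 + \<i> + u t) * (alpha * (alpha - 1) * u t / t\<^sup>2)) (at t)"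
      by (rule DERIV_cong) (simp add: power2_eq_square algebra_simps)
    then have "(deriv corner_param has_field_derivative deriv (deriv \<phi>) (1 + \<i> + u t) * (alpha * u t / t)\<^sup>2
      + deriv \<phi> (1 + \<i> + u t) * (alpha * (alpha - 1) * u t / t\<^sup>2)) (at t)"
      by (rule has_field_derivative_transform_within_open[OF _ N(1) that]) (simp add: d1)
    then show ?thesis by (rule DERIV_imp_deriv)
  qed
  have "chart_eta (corner_param t) = - (deriv (deriv corner_param) t * t + (1 - alpha) * deriv corner_param t) / ((deriv corner_param t)\<^sup>2 * t)"
    if "t \<in> N" for t
  proof -
    define v where "v = u t"
    define a b where "a = deriv \<phi> (1 + \<i> + v)" and "b = deriv (deriv \<phi>) (1 + \<i> + v)"
    have nz: "t \<noteq> 0" "v \<noteq> 0" using N that by (auto simp: v_def u_def)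
    have "chart_eta (corner_param t) = - b / a\<^sup>2"
      using chart_eta_outside[OF ou[OF that]] cm[OF that] by (simp add: inverse_nonlin_def a_def b_def v_def)
    moreover have "deriv (deriv corner_param) t * t + (1 - alpha) * deriv corner_param t = b * (alpha * v)\<^sup>2 / t"
      using nz unfolding d1[OF that] d2[OF that] v_def[symmetric] a_def[symmetric] b_def[symmetric]
      by (simp add: field_simps power2_eq_square)
    moreover have "(deriv corner_param t)\<^sup>2 * t = a\<^sup>2 * (alpha * v)\<^sup>2 / t"
      using nz unfolding d1[OF that] a_def[symmetric] v_def[symmetric]
      by (simp add: field_simps power2_eq_square)
    ultimately show ?thesis using nz alpha_nz by simp
  qed
  then show ?thesis using N by blast
qed

text \<open>
  Both sides are holomorphic on the punctured disc, so the sector determines the whole.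
\<close>

lemma chart_eta_corner_param:
  assumes "t \<in> ball 0 corner_radius - {0}"
  shows "chart_eta (corner_param t) = - (deriv (deriv corner_param) t * t + (1 - alpha) * deriv corner_param t) / ((deriv corner_param t)\<^sup>2 * t)"
proof -
  obtain N where N: "open N" "N \<noteq> {}" "N \<subseteq> ball 0 corner_radius - {0}"
    and n: "\<And>t. t \<in> N \<Longrightarrow> chart_eta (corner_param t) = - (deriv (deriv corner_param) t * t + (1 - alpha) * deriv corner_param t) / ((deriv corner_param t)\<^sup>2 * t)"
    using chart_eta_corner_param_sector by blast
  have nz: "deriv corner_param t \<noteq> 0" if "t \<in> ball 0 corner_radius" for t
    by (rule holomorphic_injective_imp_regular[OF corner_param_holomorphic open_ball corner_param_inj that])
  show ?thesis
  proof (rule analytic_continuation_open[of N "ball 0 corner_radius - {0}" "\<lambda>t. chart_eta (corner_param t)"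
        "\<lambda>t. - (deriv (deriv corner_param) t * t + (1 - alpha) * deriv corner_param t) / ((deriv corner_param t)\<^sup>2 * t)" t])
    show "connected (ball 0 corner_radius - {0::complex})"
      by (intro connected_open_delete) auto
    have h: "corner_param holomorphic_on ball 0 corner_radius - {0}" by (rule holomorphic_on_subset[OF corner_param_holomorphic]) auto
    show "(\<lambda>t. chart_eta (corner_param t)) holomorphic_on ball 0 corner_radius - {0}"
      by (rule holomorphic_on_compose_gen[OF h chart_eta_holomorphic, unfolded o_def])
        (intro image_subsetI, simp only: Compl_iff, rule corner_param_not_corner)
    have "deriv corner_param holomorphic_on ball 0 corner_radius - {0}" "deriv (deriv corner_param) holomorphic_on ball 0 corner_radius - {0}"
      by (intro holomorphic_deriv h open_delete open_ball)+
    then show "(\<lambda>t. - (deriv (deriv corner_param) t * t + (1 - alpha) * deriv corner_param t) / ((deriv corner_param t)\<^sup>2 * t)) holomorphic_on ball 0 corner_radius - {0}"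
      using nz by (intro holomorphic_intros h) auto
  qed (use N n assms in auto)
qed

text \<open>
  The map \<open>corner_param\<close> is injective, so its derivative does not vanish and it is a local coordinate
  at the image of the corner. The formula of \<open>chart_eta_corner_param\<close> then shows a simple pole with
  residue \<open>\<alpha> - 1 = i ln K / (2 \<pi>)\<close>.
\<close>

lemma chart_eta_residue: "((\<lambda>z. (z - \<phi> (1 + \<i>)) * chart_eta z) \<longlongrightarrow> alpha - 1) (at (\<phi> (1 + \<i>)))"
proof -
  have z1: "corner_param 0 = \<phi> (1 + \<i>)" by (simp add: corner_param_def)
  have c0: "0 \<in> ball 0 corner_radius" using corner_radius by simp
  obtain k where k: "k holomorphic_on corner_param ` ball 0 corner_radius" "\<And>t. t \<in> ball 0 corner_radius \<Longrightarrow> k (corner_param t) = t"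
    using holomorphic_has_inverse[OF corner_param_holomorphic open_ball corner_param_inj] by metis
  have op: "open (corner_param ` ball 0 corner_radius)" by (rule open_mapping_thm3[OF corner_param_holomorphic open_ball corner_param_inj])
  have nz: "deriv corner_param 0 \<noteq> 0"
    by (rule holomorphic_injective_imp_regular[OF corner_param_holomorphic open_ball corner_param_inj c0])
  have d: "(corner_param has_field_derivative deriv corner_param 0) (at 0)"
    by (rule holomorphic_derivI[OF corner_param_holomorphic open_ball c0])
  have l1: "((\<lambda>t. (corner_param t - corner_param 0) / t) \<longlongrightarrow> deriv corner_param 0) (at 0)"
    using d by (simp add: has_field_derivative_iff)
  have hd: "deriv corner_param holomorphic_on ball 0 corner_radius" "deriv (deriv corner_param) holomorphic_on ball 0 corner_radius"
    by (intro holomorphic_deriv corner_param_holomorphic open_ball)+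
  have i: "(deriv corner_param \<longlongrightarrow> deriv corner_param 0) (at 0)" "(deriv (deriv corner_param) \<longlongrightarrow> deriv (deriv corner_param) 0) (at 0)"
    using holomorphic_on_imp_differentiable_at[OF hd(1) open_ball c0]
      holomorphic_on_imp_differentiable_at[OF hd(2) open_ball c0]
    by (auto simp: isCont_def[symmetric] intro: field_differentiable_imp_continuous_at)
  have "((\<lambda>t. (corner_param t - corner_param 0) / t * (- (deriv (deriv corner_param) t * t + (1 - alpha) * deriv corner_param t) / (deriv corner_param t)\<^sup>2))
     \<longlongrightarrow> deriv corner_param 0 * (- (deriv (deriv corner_param) 0 * 0 + (1 - alpha) * deriv corner_param 0) / (deriv corner_param 0)\<^sup>2)) (at 0)"
    by (intro tendsto_intros l1 i) (use nz in simp)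
  also have "deriv corner_param 0 * (- (deriv (deriv corner_param) 0 * 0 + (1 - alpha) * deriv corner_param 0) / (deriv corner_param 0)\<^sup>2) = alpha - 1"
    using nz by (simp add: power2_eq_square field_simps)
  finally have l2: "((\<lambda>t. (corner_param t - corner_param 0) * chart_eta (corner_param t)) \<longlongrightarrow> alpha - 1) (at 0)"
  proof (rule Lim_transform_eventually)
    have "\<forall>\<^sub>F s in at 0. s \<in> ball 0 corner_radius - {0}"
      using corner_radius by (intro eventually_at_in_open) auto
    then show "\<forall>\<^sub>F t in at 0. (corner_param t - corner_param 0) / t * (- (deriv (deriv corner_param) t * t + (1 - alpha) * deriv corner_param t) / (deriv corner_param t)\<^sup>2) =
         (corner_param t - corner_param 0) * chart_eta (corner_param t)"
      by eventually_elim (simp add: chart_eta_corner_param)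
  qed
  have "isCont k (corner_param 0)"
    using k(1) op c0 by (metis continuous_on_eq_continuous_at holomorphic_on_imp_continuous_on imageI)
  then have kl: "(k \<longlongrightarrow> 0) (at (corner_param 0))" using k(2)[OF c0] by (simp add: isCont_def)
  have ev: "\<forall>\<^sub>F z in at (corner_param 0). z \<in> corner_param ` ball 0 corner_radius - {corner_param 0}"
    using op c0 by (intro eventually_at_in_open) auto
  have "filterlim k (at 0) (at (corner_param 0))"
    unfolding filterlim_at
  proof
    show "\<forall>\<^sub>F z in at (corner_param 0). k z \<in> UNIV \<and> k z \<noteq> 0"
      using ev by eventually_elim (use k(2) in auto)
  qed (rule kl)
  from filterlim_compose[OF l2 this]
  have "((\<lambda>z. (corner_param (k z) - corner_param 0) * chart_eta (corner_param (k z))) \<longlongrightarrow> alpha - 1) (at (corner_param 0))" .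
  then have "((\<lambda>z. (z - corner_param 0) * chart_eta z) \<longlongrightarrow> alpha - 1) (at (corner_param 0))"
    by (rule Lim_transform_eventually) (rule eventually_mono[OF ev], use k(2) in auto)
  then show ?thesis by (simp add: z1)
qed

lemma residue_shift:
  assumes "((\<lambda>z. (z - a) * f z) \<longlongrightarrow> c) (at (a::complex))"
  shows "((\<lambda>z. (z + a) * - f (- z)) \<longlongrightarrow> c) (at (- a))"
    "((\<lambda>z. (z - Complex.cnj a) * Complex.cnj (f (Complex.cnj z))) \<longlongrightarrow> Complex.cnj c) (at (Complex.cnj a))"
proof -
  have "filterlim uminus (at a) (at (- a))"
    unfolding filterlim_at
    by (auto intro!: tendsto_eq_intros eventually_mono[OF eventually_neq_at_within[of "- a" "- a" UNIV]])
  from filterlim_compose[OF assms this]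
  have "((\<lambda>z. (- z - a) * f (- z)) \<longlongrightarrow> c) (at (- a))" .
  then show "((\<lambda>z. (z + a) * - f (- z)) \<longlongrightarrow> c) (at (- a))" by (simp add: algebra_simps)
  have "filterlim Complex.cnj (at a) (at (Complex.cnj a))"
    unfolding filterlim_at
    by (auto intro!: tendsto_eq_intros eventually_mono[OF eventually_neq_at_within[of "Complex.cnj a" "Complex.cnj a" UNIV]])
  from filterlim_compose[OF assms this]
  have "((\<lambda>z. (Complex.cnj z - a) * f (Complex.cnj z)) \<longlongrightarrow> c) (at (Complex.cnj a))" .
  from tendsto_cnj[OF this]
  show "((\<lambda>z. (z - Complex.cnj a) * Complex.cnj (f (Complex.cnj z))) \<longlongrightarrow> Complex.cnj c) (at (Complex.cnj a))"
    by simp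
qed

end

section \<open>The formula for f''/f'\<close>

lemma removable_finite_set:
  assumes "finite S" "f holomorphic_on - S"
    and "\<And>s. s \<in> S \<Longrightarrow> ((\<lambda>z. (z - s) * f z) \<longlongrightarrow> 0) (at s)"
  shows "\<exists>g. g holomorphic_on UNIV \<and> (\<forall>z. z \<notin> S \<longrightarrow> g z = f z)"
  using assms
proof (induction S arbitrary: f rule: finite_induct)
  case empty
  then show ?case by auto
next
  case (insert a S)
  have op: "open (- S)" using insert finite_imp_closed by blast
  have eq: "- insert a S = - S - {a}" by auto
  have h: "f holomorphic_on - S - {a}" using insert.prems(1) by (simp only: eq)
  have i: "a \<in> interior (- S)" using op insert.hyps by (simp add: interior_open)
  have "((\<lambda>z. (z - a) * f z) \<longlongrightarrow> 0) (at a)" by (rule insert.prems(2)) simp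
  then have "\<exists>g. g holomorphic_on - S \<and> (\<forall>z\<in>- S - {a}. g z = f z)"
    by (rule holomorphic_on_extend_lim[OF h i, THEN iffD2])
  then obtain g where g: "g holomorphic_on - S" "\<forall>z\<in>- S - {a}. g z = f z" by blast
  have "((\<lambda>z. (z - s) * g z) \<longlongrightarrow> 0) (at s)" if "s \<in> S" for s
  proof (rule Lim_transform_eventually)
    show "((\<lambda>z. (z - s) * f z) \<longlongrightarrow> 0) (at s)" by (rule insert.prems(2)) (use that in simp)
    have "open (- insert a (S - {s}))"
      by (intro open_Compl finite_imp_closed) (use insert.hyps in simp)
    moreover have "s \<in> - insert a (S - {s})" using that insert.hyps by auto
    ultimately have "\<forall>\<^sub>F z in at s. z \<in> - insert a (S - {s}) - {s}" by (rule eventually_at_in_open)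
    then show "\<forall>\<^sub>F z in at s. (z - s) * f z = (z - s) * g z"
      by eventually_elim (use g(2) in auto)
  qed
  from insert.IH[OF g(1) this] obtain h where "h holomorphic_on UNIV" "\<forall>z. z \<notin> S \<longrightarrow> h z = g z" by blast
  then show ?case using g(2) by (intro exI[of _ h]) auto
qed

context square_solution
begin

lemma corner_images:
  "\<phi> (- 1 + \<i>) = - Complex.cnj (\<phi> (1 + \<i>))" "\<phi> (- 1 - \<i>) = - \<phi> (1 + \<i>)" "\<phi> (1 - \<i>) = Complex.cnj (\<phi> (1 + \<i>))"
proof -
  show "\<phi> (- 1 - \<i>) = - \<phi> (1 + \<i>)" using odd[of "1 + \<i>"] by simp
  show c: "\<phi> (1 - \<i>) = Complex.cnj (\<phi> (1 + \<i>))" using cnj[of "1 + \<i>"] by simp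
  show "\<phi> (- 1 + \<i>) = - Complex.cnj (\<phi> (1 + \<i>))" using odd[of "1 - \<i>"] c by simp
qed

text \<open>
  The difference of the two functions has removable singularities at the four points, by
  \<open>chart_eta_residue\<close> and the symmetries, and vanishes at infinity.
\<close>

theorem chart_eta_eq_eta:
  assumes "z \<notin> \<phi> ` corners"
  shows "chart_eta z = eta K \<phi> z"
proof -
  define z1 where "z1 = \<phi> (1 + \<i>)"
  define \<beta> where "\<beta> = alpha - 1"
  have beta: "\<beta> = - (complex_of_real (ln K) / (2 * \<i> * complex_of_real pi))"
    by (simp add: \<beta>_def alpha_def kappa_def complex_eq_iff Re_divide Im_divide power2_eq_square)
  have cb: "Complex.cnj \<beta> = - \<beta>" by (simp add: \<beta>_def alpha_def complex_eq_iff)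
  define R where "R z = \<beta> * (1 / (z - z1) - 1 / (z + Complex.cnj z1) + 1 / (z + z1) - 1 / (z - Complex.cnj z1))" for z
  have Re: "eta K \<phi> z = R z" for z
    unfolding eta_def corner_images z1_def[symmetric] R_def beta[symmetric] by simp
  have S: "\<phi> ` corners = {z1, - Complex.cnj z1, - z1, Complex.cnj z1}"
    unfolding corners_def image_insert image_empty corner_images z1_def[symmetric] by simp
  have xy: "Re z1 > 0" "Im z1 > 0" using Re_pos[of "1 + \<i>"] Im_pos[of "1 + \<i>"] by (auto simp: z1_def)
  have dist: "z1 \<noteq> - Complex.cnj z1" "z1 \<noteq> - z1" "z1 \<noteq> Complex.cnj z1" "- Complex.cnj z1 \<noteq> - z1"
     "- Complex.cnj z1 \<noteq> Complex.cnj z1" "- z1 \<noteq> Complex.cnj z1"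
    using xy by (auto simp: complex_eq_iff)
  have fin: "finite (\<phi> ` corners)" by (rule finite_corner_images)
  have op: "open (- \<phi> ` corners)" using fin finite_imp_closed by blast
  have evS: "\<forall>\<^sub>F z in at s. z \<notin> \<phi> ` corners" for s
    using islimpt_finite[OF fin, of s] by (simp add: islimpt_iff_eventually)
  have r1: "((\<lambda>z. (z - z1) * chart_eta z) \<longlongrightarrow> \<beta>) (at z1)" using chart_eta_residue by (simp add: z1_def \<beta>_def)
  have r4: "((\<lambda>z. (z - Complex.cnj z1) * chart_eta z) \<longlongrightarrow> - \<beta>) (at (Complex.cnj z1))"
  proof (rule Lim_transform_eventually)
    show "((\<lambda>z. (z - Complex.cnj z1) * Complex.cnj (chart_eta (Complex.cnj z))) \<longlongrightarrow> - \<beta>) (at (Complex.cnj z1))"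
      using residue_shift(2)[OF r1] by (simp add: cb)
    show "\<forall>\<^sub>F z in at (Complex.cnj z1). (z - Complex.cnj z1) * Complex.cnj (chart_eta (Complex.cnj z)) = (z - Complex.cnj z1) * chart_eta z"
      using evS by eventually_elim (simp add: chart_eta_cnj)
  qed
  have neg: "((\<lambda>z. (z + a) * chart_eta z) \<longlongrightarrow> c) (at (- a))" if "((\<lambda>z. (z - a) * chart_eta z) \<longlongrightarrow> c) (at a)" for a c
  proof (rule Lim_transform_eventually)
    show "((\<lambda>z. (z + a) * - chart_eta (- z)) \<longlongrightarrow> c) (at (- a))" by (rule residue_shift(1)[OF that])
    show "\<forall>\<^sub>F z in at (- a). (z + a) * - chart_eta (- z) = (z + a) * chart_eta z"
      using evS by eventually_elim (simp add: chart_eta_odd)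
  qed
  have r3: "((\<lambda>z. (z - - z1) * chart_eta z) \<longlongrightarrow> \<beta>) (at (- z1))" using neg[OF r1] by simp
  have r2: "((\<lambda>z. (z - - Complex.cnj z1) * chart_eta z) \<longlongrightarrow> - \<beta>) (at (- Complex.cnj z1))" using neg[OF r4] by simp
  define f where "f z = chart_eta z - R z" for z
  have hf: "f holomorphic_on - \<phi> ` corners"
    unfolding f_def R_def by (intro holomorphic_intros chart_eta_holomorphic) (auto simp: S add_eq_0_iff2)
  have rem: "((\<lambda>z. (z - s) * f z) \<longlongrightarrow> 0) (at s)"
    if r: "((\<lambda>z. (z - s) * chart_eta z) \<longlongrightarrow> b) (at s)" and R: "\<And>z. R z = b / (z - s) + Q z" and Q: "isCont Q s" for s b Q
  proof -
    have "((\<lambda>z. (z - s) * chart_eta z - b - (z - s) * Q z) \<longlongrightarrow> b - b - (s - s) * Q s) (at s)"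
      by (intro tendsto_intros r Q[unfolded isCont_def])
    then have "((\<lambda>z. (z - s) * chart_eta z - b - (z - s) * Q z) \<longlongrightarrow> 0) (at s)" by simp
    moreover have "\<forall>\<^sub>F z in at s. (z - s) * chart_eta z - b - (z - s) * Q z = (z - s) * f z"
      by (rule eventually_mono[OF eventually_neq_at_within[of s s UNIV]])
        (simp add: f_def R right_diff_distrib distrib_left)
    ultimately show ?thesis by (rule Lim_transform_eventually)
  qed
  have "((\<lambda>z. (z - s) * f z) \<longlongrightarrow> 0) (at s)" if "s \<in> \<phi> ` corners" for s
  proof -
    from that consider "s = z1" | "s = - Complex.cnj z1" | "s = - z1" | "s = Complex.cnj z1"
      unfolding S by auto
    then show ?thesis
    proof cases
      case 1
      have "((\<lambda>z. (z - z1) * f z) \<longlongrightarrow> 0) (at z1)"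
        by (rule rem[OF r1, of "\<lambda>z. \<beta> * (- 1 / (z + Complex.cnj z1) + 1 / (z + z1) - 1 / (z - Complex.cnj z1))"])
          (use dist in \<open>auto intro!: continuous_intros simp: R_def algebra_simps add_eq_0_iff2\<close>)
      then show ?thesis using 1 by simp
    next
      case 2
      have "((\<lambda>z. (z - - Complex.cnj z1) * f z) \<longlongrightarrow> 0) (at (- Complex.cnj z1))"
        by (rule rem[OF r2, of "\<lambda>z. \<beta> * (1 / (z - z1) + 1 / (z + z1) - 1 / (z - Complex.cnj z1))"])
          (use dist in \<open>auto intro!: continuous_intros simp: R_def algebra_simps add_eq_0_iff2\<close>)
      then show ?thesis using 2 by simp
    next
      case 3
      have "((\<lambda>z. (z - - z1) * f z) \<longlongrightarrow> 0) (at (- z1))"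
        by (rule rem[OF r3, of "\<lambda>z. \<beta> * (1 / (z - z1) - 1 / (z + Complex.cnj z1) - 1 / (z - Complex.cnj z1))"])
          (use dist in \<open>auto intro!: continuous_intros simp: R_def algebra_simps add_eq_0_iff2\<close>)
      then show ?thesis using 3 by simp
    next
      case 4
      have "((\<lambda>z. (z - Complex.cnj z1) * f z) \<longlongrightarrow> 0) (at (Complex.cnj z1))"
        by (rule rem[OF r4, of "\<lambda>z. \<beta> * (1 / (z - z1) - 1 / (z + Complex.cnj z1) + 1 / (z + z1))"])
          (use dist in \<open>auto intro!: continuous_intros simp: R_def algebra_simps add_eq_0_iff2\<close>)
      then show ?thesis using 4 by simp
    qed
  qed
  from removable_finite_set[OF fin hf this]
  obtain g where g: "g holomorphic_on UNIV" "\<And>z. z \<notin> \<phi> ` corners \<Longrightarrow> g z = f z" by blast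
  have inv: "((\<lambda>z. 1 / (z - a)) \<longlongrightarrow> 0) at_infinity" for a :: complex
  proof -
    have "filterlim (\<lambda>z. z + (- a)) at_infinity at_infinity"
      by (rule tendsto_add_filterlim_at_infinity'[OF filterlim_ident tendsto_const])
    then show ?thesis by (intro tendsto_divide_0[OF tendsto_const]) simp
  qed
  have "(R \<longlongrightarrow> \<beta> * (0 - 0 + 0 - 0)) at_infinity"
    unfolding R_def using inv[of "- Complex.cnj z1"] inv[of "- z1"] by (intro tendsto_intros inv) simp_all
  then have "(f \<longlongrightarrow> 0 - \<beta> * (0 - 0 + 0 - 0)) at_infinity"
    unfolding f_def by (intro tendsto_intros chart_eta_at_infinity)
  then have "(f \<longlongrightarrow> 0) at_infinity" by simp
  moreover have "\<forall>\<^sub>F z in at_infinity. f z = g z"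
  proof -
    obtain B where "\<forall>z\<in>\<phi> ` corners. cmod z \<le> B" using finite_imp_bounded[OF fin] bounded_iff by blast
    then have "z \<notin> \<phi> ` corners" if "B + 1 \<le> cmod z" for z using that by force
    then show ?thesis unfolding eventually_at_infinity using g(2) by metis
  qed
  ultimately have "(g \<longlongrightarrow> 0) at_infinity" by (rule Lim_transform_eventually)
  then have "g z = 0" using Liouville_weak_0[OF g(1)] by simp
  then show ?thesis using g(2)[OF assms] by (simp add: f_def Re)
qed

end

section \<open>Equations for the image of the square\<close>

text \<open>
  The quantity \<open>\<theta>' exp (- P \<theta>)\<close> is constant, and its value is 1 by the behaviour at infinity. So
  \<open>exp (- P)\<close> integrated from \<open>0\<close> to \<open>\<theta> s\<close> is \<open>s - s0\<close>. As \<open>\<theta> s\<close> is asymptotic to \<open>s - c\<close>, the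
  improper integral of \<open>exp (- P) - 1\<close> measures the offset \<open>c - s0\<close>.
\<close>

lemma ode_first_integral:
  fixes \<theta> \<theta>1 P p :: "real \<Rightarrow> real"
  assumes a: "a < s0"
    and d1: "\<And>s. s > a \<Longrightarrow> (\<theta> has_real_derivative \<theta>1 s) (at s)"
    and d2: "\<And>s. s > a \<Longrightarrow> (\<theta>1 has_real_derivative p (\<theta> s) * (\<theta>1 s)\<^sup>2) (at s)"
    and P: "\<And>t. (P has_real_derivative p t) (at t)"
    and lim1: "(\<theta>1 \<longlongrightarrow> 1) at_top"
    and lim2: "((\<lambda>s. \<theta> s - (s - c)) \<longlongrightarrow> 0) at_top"
    and P0: "(P \<longlongrightarrow> 0) at_top"
    and init: "\<theta> s0 = 0"
  shows "\<And>s. s \<ge> s0 \<Longrightarrow> 0 \<le> \<theta> s \<and> integral {0..\<theta> s} (\<lambda>t. exp (- P t)) = s - s0"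
    and "((\<lambda>T. integral {0..T} (\<lambda>t. exp (- P t) - 1)) \<longlongrightarrow> c - s0) at_top"
proof -
  have top: "filterlim \<theta> at_top at_top"
  proof -
    have "filterlim (\<lambda>s. s + (- c)) at_top at_top"
      by real_asymp
    from filterlim_tendsto_add_at_top[OF lim2 this]
    show ?thesis by simp
  qed
  define f where "f s = \<theta>1 s * exp (- P (\<theta> s))" for s
  have "\<exists>k. \<forall>s\<in>{a<..}. f s = k"
  proof (rule has_field_derivative_zero_constant)
    fix s assume "s \<in> {a<..}"
    then have s: "s > a" by simp
    have "(f has_real_derivative (p (\<theta> s) * (\<theta>1 s)\<^sup>2) * exp (- P (\<theta> s)) + exp (- P (\<theta> s)) * (- (p (\<theta> s) * \<theta>1 s)) * \<theta>1 s) (at s)"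
      unfolding f_def
      by (intro DERIV_mult d2[OF s] DERIV_fun_exp DERIV_minus DERIV_chain2[OF P d1[OF s]])
    then have "(f has_real_derivative 0) (at s)"
      by (rule DERIV_cong) (simp add: power2_eq_square)
    then show "(f has_field_derivative 0) (at s within {a<..})" by (rule has_field_derivative_at_within)
  qed simp
  then obtain k where k: "\<And>s. s > a \<Longrightarrow> f s = k" by auto
  have "((\<lambda>s. \<theta>1 s * exp (- P (\<theta> s))) \<longlongrightarrow> 1 * exp (- 0)) at_top"
    by (intro tendsto_intros lim1 filterlim_compose[OF P0 top])
  then have "(f \<longlongrightarrow> 1) at_top" by (simp add: f_def[abs_def])
  moreover have "(f \<longlongrightarrow> k) at_top"
    by (rule tendsto_eventually, rule eventually_mono[OF eventually_gt_at_top[of a]]) (rule k)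
  ultimately have "k = 1" using tendsto_unique trivial_limit_at_top_linorder by blast
  then have \<theta>1: "\<theta>1 s = exp (P (\<theta> s))" if "s > a" for s
    using k[OF that] by (simp add: f_def exp_minus field_simps)
  have mono: "\<theta> s < \<theta> t" if "a < s" "s < t" for s t
    by (rule DERIV_pos_imp_increasing[OF that(2)]) (use d1 \<theta>1 that in \<open>metis exp_gt_zero order_less_le_trans\<close>)
  have nonneg: "0 \<le> \<theta> s" if "s \<ge> s0" for s
    using mono[of s0 s] a that init by (cases "s = s0") auto
  have cP: "continuous_on S (\<lambda>t. exp (- P t))" for S
    by (intro continuous_intros DERIV_continuous_on[OF has_field_derivative_at_within[OF P]])
  have cth: "continuous_on S \<theta>" if "S \<subseteq> {a<..}" for S
    by (rule DERIV_continuous_on[OF has_field_derivative_at_within[OF d1]]) (use that in auto)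
  have main: "integral {0..\<theta> s} (\<lambda>t. exp (- P t)) = s - s0" if s: "s \<ge> s0" for s
  proof -
    have "((\<lambda>x. \<theta>1 x *\<^sub>R exp (- P (\<theta> x))) has_integral (integral {\<theta> s0..\<theta> s} (\<lambda>t. exp (- P t)))) {s0..s}"
    proof (rule has_integral_substitution[where c = "\<theta> s0" and d = "\<theta> s"])
      show "\<theta> s0 \<le> \<theta> s" using nonneg[OF s] init by simp
      show "\<theta> ` {s0..s} \<subseteq> {\<theta> s0..\<theta> s}"
      proof (rule image_subsetI)
        fix x assume "x \<in> {s0..s}"
        then show "\<theta> x \<in> {\<theta> s0..\<theta> s}"
          using nonneg[of x] init mono[of x s] a by (cases "x = s") auto
      qed
      fix x assume "x \<in> {s0..s}"
      then show "(\<theta> has_field_derivative \<theta>1 x) (at x within {s0..s})"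
        using a by (intro has_field_derivative_at_within[OF d1]) auto
    qed (use s cP in auto)
    moreover have "\<theta>1 x *\<^sub>R exp (- P (\<theta> x)) = 1" if "x \<in> {s0..s}" for x
      using \<theta>1[of x] that a by (simp add: exp_minus)
    ultimately have "((\<lambda>x. 1::real) has_integral (integral {\<theta> s0..\<theta> s} (\<lambda>t. exp (- P t)))) {s0..s}"
      by (rule has_integral_eq[rotated])
    moreover have "((\<lambda>x. 1::real) has_integral (s - s0)) {s0..s}"
      using has_integral_const_real[of "1::real" s0 s] s by simp
    ultimately show ?thesis using init has_integral_unique by metis
  qed
  show "\<And>s. s \<ge> s0 \<Longrightarrow> 0 \<le> \<theta> s \<and> integral {0..\<theta> s} (\<lambda>t. exp (- P t)) = s - s0"
    using nonneg main by blast
  show "((\<lambda>T. integral {0..T} (\<lambda>t. exp (- P t) - 1)) \<longlongrightarrow> c - s0) at_top"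
  proof (rule tendstoI)
    fix \<epsilon> :: real assume "\<epsilon> > 0"
    then have "\<forall>\<^sub>F s in at_top. dist (\<theta> s - (s - c)) 0 < \<epsilon>" using lim2 by (rule tendstoD[rotated])
    then obtain S where S: "\<And>s. s \<ge> S \<Longrightarrow> \<bar>\<theta> s - (s - c)\<bar> < \<epsilon>"
      by (auto simp: eventually_at_top_linorder)
    define S' where "S' = max S s0"
    have "dist (integral {0..T} (\<lambda>t. exp (- P t) - 1)) (c - s0) < \<epsilon>" if T: "T \<ge> \<theta> S'" for T
    proof -
      have "\<forall>\<^sub>F s in at_top. \<theta> s \<ge> T" using top by (simp add: filterlim_at_top)
      then obtain s2 where s2: "s2 \<ge> S'" "\<theta> s2 \<ge> T"
        by (metis eventually_at_top_linorder le_cases max.cobounded1 max.cobounded2)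
      have "\<exists>s\<ge>S'. s \<le> s2 \<and> \<theta> s = T"
      proof (rule IVT'[of \<theta> S' T s2])
        show "continuous_on {S'..s2} \<theta>" by (rule cth) (use a in \<open>auto simp: S'_def\<close>)
      qed (use T s2 in auto)
      then obtain s where s: "S' \<le> s" "s \<le> s2" "\<theta> s = T" by blast
      then have ss: "s \<ge> S" "s \<ge> s0" by (auto simp: S'_def)
      have "T \<ge> 0" using nonneg[OF ss(2)] s by simp
      have "integral {0..T} (\<lambda>t. exp (- P t) - 1) = integral {0..T} (\<lambda>t. exp (- P t)) - integral {0..T} (\<lambda>t. 1)"
        by (intro Henstock_Kurzweil_Integration.integral_diff integrable_continuous_interval cP) simp
      also have "\<dots> = (s - s0) - T" using main[OF ss(2)] s \<open>T \<ge> 0\<close> by simp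
      finally show ?thesis using S[OF ss(1)] s by (simp add: dist_real_def abs_minus_commute algebra_simps)
    qed
    then show "\<forall>\<^sub>F T in at_top. dist (integral {0..T} (\<lambda>t. exp (- P t) - 1)) (c - s0) < \<epsilon>"
      unfolding eventually_at_top_linorder by blast
  qed
qed

context square_solution
begin

lemma deriv2_chart:
  assumes c: "straight_chart K d E V" and w: "w \<in> V" and nc: "E w \<notin> corners"
  shows "deriv (deriv (\<lambda>w. \<phi> (E w))) w = - eta K \<phi> (\<phi> (E w)) * (deriv (\<lambda>w. \<phi> (E w)) w)\<^sup>2"
proof -
  have "\<phi> (E w) \<notin> \<phi> ` corners" using nc inj by (auto simp: inj_eq)
  then have "eta K \<phi> (\<phi> (E w)) = inverse_nonlin (\<lambda>w. \<phi> (E w)) w"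
    using pulled_eta_chart[OF c w] by (simp add: chart_eta_eq_eta[symmetric] chart_eta_\<phi>)
  moreover have "deriv (\<lambda>w. \<phi> (E w)) w \<noteq> 0"
    by (rule deriv_chart_nonzero[OF _ w]) (use c in \<open>simp add: straight_chart_def\<close>)
  ultimately show ?thesis by (simp add: inverse_nonlin_def)
qed

text \<open>
  The ray of direction \<open>e\<close> in the chart is mapped by \<open>\<phi> \<circ> E\<close> to the line of direction \<open>e\<close>. In the
  real coordinate \<open>\<theta>\<close> on that line, the formula for \<open>f'' / f'\<close> becomes the equation of
  \<open>ode_first_integral\<close>, and the far part of the chart, a translation by \<open>- cc * e\<close>, provides the
  behaviour at infinity.
\<close>

lemma ray_ode:
  fixes \<theta> :: "real \<Rightarrow> real"
  assumes c: "straight_chart K d E V" and e: "e \<noteq> 0"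
    and ray: "\<And>s. s > a \<Longrightarrow> of_real s * e \<in> V \<and> E (of_real s * e) \<notin> corners \<and>
       \<phi> (E (of_real s * e)) = e * of_real (\<theta> s)"
    and far: "open V'" "V' \<subseteq> V" "V' \<subseteq> {w. E w \<notin> Sq}" "\<And>w. w \<in> V' \<Longrightarrow> E w = w - of_real cc * e"
      "\<And>s. s > a2 \<Longrightarrow> of_real s * e \<in> V'"
    and p: "\<And>t. p t = Re (- e * eta K \<phi> (e * of_real t))"
    and P: "\<And>t. (P has_real_derivative p t) (at t)" and P0: "(P \<longlongrightarrow> 0) at_top"
    and s0: "a < s0" "\<theta> s0 = 0"
  shows "\<And>s. s \<ge> s0 \<Longrightarrow> 0 \<le> \<theta> s \<and> integral {0..\<theta> s} (\<lambda>t. exp (- P t)) = s - s0"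
    and "((\<lambda>T. integral {0..T} (\<lambda>t. exp (- P t) - 1)) \<longlongrightarrow> cc - s0) at_top"
proof -
  define \<Psi> where "\<Psi> = (\<lambda>w. \<phi> (E w))"
  have V: "open V" and h: "\<Psi> holomorphic_on V"
    using c square_solution_axioms by (auto simp: straight_chart_def affine_chart_def \<Psi>_def)
  have l: "((\<lambda>s::real. of_real s * e) has_vector_derivative e) (at s)" for s
    by (auto intro!: derivative_eq_intros simp: has_vector_derivative_def scaleR_conv_of_real)
  have chain: "((\<lambda>s::real. F (of_real s * e)) has_vector_derivative e * deriv F (of_real s * e)) (at s)"
    if "F holomorphic_on V" "s > a" for F s
    using field_vector_diff_chain_at[OF l holomorphic_derivI[OF that(1) V, of "of_real s * e"]] ray[OF that(2)]
    by (simp add: o_def)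
  define \<theta>1 where "\<theta>1 s = Re (deriv \<Psi> (of_real s * e))" for s :: real
  have D1: "(\<theta> has_real_derivative \<theta>1 s) (at s) \<and> Im (deriv \<Psi> (of_real s * e)) = 0" if s: "s > a" for s
  proof -
    have "((\<lambda>s. \<Psi> (of_real s * e) / e) has_vector_derivative deriv \<Psi> (of_real s * e)) (at s)"
      using has_vector_derivative_divide[OF chain[OF h s], of e] e by simp
    then have "((\<lambda>s. complex_of_real (\<theta> s)) has_vector_derivative deriv \<Psi> (of_real s * e)) (at s)"
      by (rule has_vector_derivative_transform_within_open[of _ _ _ "{a<..}"])
        (use s ray e in \<open>auto simp: \<Psi>_def\<close>)
    then have v: "((\<lambda>s. complex_of_real (\<theta> s)) has_derivative (\<lambda>v. v *\<^sub>R deriv \<Psi> (of_real s * e))) (at s)"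
      by (simp add: has_vector_derivative_def)
    have r: "(\<theta> has_derivative (\<lambda>v. v * \<theta>1 s)) (at s)"
      using has_derivative_Re[OF v] by (simp add: \<theta>1_def)
    have "((\<lambda>s::real. 0::real) has_derivative (\<lambda>v. v * Im (deriv \<Psi> (of_real s * e)))) (at s)"
      using has_derivative_Im[OF v] by simp
    from has_derivative_unique[OF this has_derivative_const]
    have "(\<lambda>v::real. v * Im (deriv \<Psi> (of_real s * e))) = (\<lambda>v. 0)" .
    from fun_cong[OF this, of 1] have "Im (deriv \<Psi> (of_real s * e)) = 0" by simp
    then show ?thesis using r by (simp add: has_field_derivative_def mult_commute_abs)
  qed
  have D2: "(\<theta>1 has_real_derivative p (\<theta> s) * (\<theta>1 s)\<^sup>2) (at s)" if s: "s > a" for s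
  proof -
    have "((\<lambda>s. deriv \<Psi> (of_real s * e)) has_derivative (\<lambda>v. v *\<^sub>R (e * deriv (deriv \<Psi>) (of_real s * e)))) (at s)"
      using chain[OF holomorphic_deriv[OF h V] s] by (simp add: has_vector_derivative_def)
    from has_derivative_Re[OF this]
    have "(\<theta>1 has_real_derivative Re (e * deriv (deriv \<Psi>) (of_real s * e))) (at s)"
      by (simp add: \<theta>1_def[abs_def] has_field_derivative_def mult_commute_abs)
    moreover have "deriv \<Psi> (of_real s * e) = of_real (\<theta>1 s)"
      using D1[OF s] by (simp add: \<theta>1_def complex_eq_iff)
    then have "deriv (deriv \<Psi>) (of_real s * e) = - eta K \<phi> (e * of_real (\<theta> s)) * (of_real (\<theta>1 s))\<^sup>2"
      using deriv2_chart[OF c, of "of_real s * e"] ray[OF s] by (simp add: \<Psi>_def)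
    then have "e * deriv (deriv \<Psi>) (of_real s * e) = - e * eta K \<phi> (e * of_real (\<theta> s)) * of_real ((\<theta>1 s)\<^sup>2)"
      by simp
    then have "Re (e * deriv (deriv \<Psi>) (of_real s * e)) = p (\<theta> s) * (\<theta>1 s)\<^sup>2"
    proof -
      assume *: "e * deriv (deriv \<Psi>) (of_real s * e) = - e * eta K \<phi> (e * of_real (\<theta> s)) * of_real ((\<theta>1 s)\<^sup>2)"
      have r: "Re (X * of_real r) = Re X * r" for X r by simp
      show ?thesis unfolding p * by (rule r)
    qed
    ultimately show ?thesis by simp
  qed
  have inf: "filterlim (\<lambda>s. of_real s * e - of_real cc * e) at_infinity at_top"
  proof -
    have "filterlim (\<lambda>s. \<bar>s - cc\<bar> * cmod e) at_top at_top"
      using e zero_less_norm_iff[of e] by real_asymp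
    moreover have "cmod (of_real s * e - of_real cc * e) = \<bar>s - cc\<bar> * cmod e" for s
      by (simp add: left_diff_distrib[symmetric] norm_mult flip: of_real_diff)
    ultimately show ?thesis by (intro filterlim_norm_at_top_imp_at_infinity) simp
  qed
  have evt: "\<forall>\<^sub>F s in at_top. s > max a a2" by (rule eventually_gt_at_top)
  have L1: "(\<theta>1 \<longlongrightarrow> 1) at_top"
  proof -
    have dP: "deriv \<Psi> w = deriv \<phi> (w - of_real cc * e)" if w: "w \<in> V'" for w
    proof -
      have "(\<phi> has_field_derivative deriv \<phi> (w - of_real cc * e)) (at (w - of_real cc * e))"
        by (rule holomorphic_derivI[OF hol_out]) (use closed_Sq far w in auto)
      moreover have "((\<lambda>w. w - of_real cc * e) has_field_derivative 1) (at w)"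
        by (auto intro!: derivative_eq_intros)
      ultimately have "((\<lambda>w. \<phi> (w - of_real cc * e)) has_field_derivative deriv \<phi> (w - of_real cc * e) * 1) (at w)"
        by (rule DERIV_chain2)
      then have "(\<Psi> has_field_derivative deriv \<phi> (w - of_real cc * e) * 1) (at w)"
        by (rule has_field_derivative_transform_within_open[OF _ far(1) w]) (simp add: \<Psi>_def far(4))
      then show ?thesis by (simp add: DERIV_imp_deriv)
    qed
    have "((\<lambda>s. Re (deriv \<phi> (of_real s * e - of_real cc * e))) \<longlongrightarrow> Re 1) at_top"
      by (intro tendsto_intros filterlim_compose[OF deriv_outside_at_infinity(1) inf])
    moreover have "\<forall>\<^sub>F s in at_top. Re (deriv \<phi> (of_real s * e - of_real cc * e)) = \<theta>1 s"
      using evt by eventually_elim (simp add: \<theta>1_def dP far(5))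
    ultimately show ?thesis using Lim_transform_eventually by fastforce
  qed
  have L2: "((\<lambda>s. \<theta> s - (s - cc)) \<longlongrightarrow> 0) at_top"
  proof -
    have "((\<lambda>s. Re ((\<phi> (of_real s * e - of_real cc * e) - (of_real s * e - of_real cc * e)) / e)) \<longlongrightarrow> Re (0 / e)) at_top"
      by (intro tendsto_intros filterlim_compose[OF norm inf] e)
    moreover have "\<forall>\<^sub>F s in at_top. Re ((\<phi> (of_real s * e - of_real cc * e) - (of_real s * e - of_real cc * e)) / e) = \<theta> s - (s - cc)"
      using evt
    proof eventually_elim
      case (elim s)
      have "\<phi> (of_real s * e - of_real cc * e) = e * of_real (\<theta> s)"
        using ray[of s] far(4)[OF far(5), of s] elim by simp
      then have "(\<phi> (of_real s * e - of_real cc * e) - (of_real s * e - of_real cc * e)) / e = of_real (\<theta> s - (s - cc))"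
        using e by (simp add: field_simps)
      then show ?case by simp
    qed
    ultimately show ?thesis using Lim_transform_eventually by fastforce
  qed
  have D1': "\<And>s. s > a \<Longrightarrow> (\<theta> has_real_derivative \<theta>1 s) (at s)" using D1 by blast
  show "\<And>s. s \<ge> s0 \<Longrightarrow> 0 \<le> \<theta> s \<and> integral {0..\<theta> s} (\<lambda>t. exp (- P t)) = s - s0"
    by (rule ode_first_integral(1)[OF s0(1) D1' D2 P L1 L2 P0 s0(2)])
  show "((\<lambda>T. integral {0..T} (\<lambda>t. exp (- P t) - 1)) \<longlongrightarrow> cc - s0) at_top"
    by (rule ode_first_integral(2)[OF s0(1) D1' D2 P L1 L2 P0 s0(2)])
qed

lemma eta_on_axes:
  defines "x \<equiv> Re (\<phi> (1 + \<i>))" and "y \<equiv> Im (\<phi> (1 + \<i>))"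
  shows "Re (- \<i> * eta K \<phi> (\<i> * of_real t)) = ln K / pi * (x / (x\<^sup>2 + (t + y)\<^sup>2) - x / (x\<^sup>2 + (t - y)\<^sup>2))"
    and "Re (- 1 * eta K \<phi> (1 * of_real t)) = ln K / pi * (y / ((t - x)\<^sup>2 + y\<^sup>2) - y / ((t + x)\<^sup>2 + y\<^sup>2))"
proof -
  define z1 where "z1 = \<phi> (1 + \<i>)"
  have z1: "z1 = Complex x y" by (simp add: z1_def x_def y_def)
  have b: "- (complex_of_real (ln K) / (2 * \<i> * complex_of_real pi)) = \<i> * of_real (ln K / (2 * pi))"
    by (simp add: complex_eq_iff Re_divide Im_divide power2_eq_square)
  define S where "S z = 1 / (z - Complex x y) - 1 / (z - Complex (- x) y) + 1 / (z - Complex (- x) (- y)) - 1 / (z - Complex x (- y))" for z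
  have E: "eta K \<phi> z = \<i> * of_real (ln K / (2 * pi)) * S z" for z
    unfolding eta_def corner_images z1_def[symmetric] z1 b S_def by (simp add: complex_minus complex_cnj)
  have Ri: "Re (1 / Complex a c) = a / (a\<^sup>2 + c\<^sup>2)" "Im (1 / Complex a c) = - c / (a\<^sup>2 + c\<^sup>2)" for a c
    by (simp_all add: Re_divide Im_divide)
  have m1: "\<i> * of_real t - Complex a c = Complex (- a) (t - c)" for a c by (simp add: complex_eq_iff)
  have m2: "1 * of_real t - Complex a c = Complex (t - a) (- c)" for a c by (simp add: complex_eq_iff)
  have dbl: "ln K / (2 * pi) * (2 * q) = ln K / pi * q" for q by simp
  have "Re (- \<i> * (\<i> * of_real q * X)) = q * Re X" for q X by simp
  then have "Re (- \<i> * eta K \<phi> (\<i> * of_real t)) = ln K / (2 * pi) * Re (S (\<i> * of_real t))"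
    unfolding E by blast
  also have "Re (S (\<i> * of_real t)) = 2 * (x / (x\<^sup>2 + (t + y)\<^sup>2) - x / (x\<^sup>2 + (t - y)\<^sup>2))"
    unfolding S_def m1 plus_complex.sel minus_complex.sel Ri by simp
  finally show "Re (- \<i> * eta K \<phi> (\<i> * of_real t)) = ln K / pi * (x / (x\<^sup>2 + (t + y)\<^sup>2) - x / (x\<^sup>2 + (t - y)\<^sup>2))"
    by (simp only: dbl)
  have "Re (- 1 * (\<i> * of_real q * X)) = q * Im X" for q X by simp
  then have "Re (- 1 * eta K \<phi> (1 * of_real t)) = ln K / (2 * pi) * Im (S (1 * of_real t))"
    unfolding E by blast
  also have "Im (S (1 * of_real t)) = 2 * (y / ((t - x)\<^sup>2 + y\<^sup>2) - y / ((t + x)\<^sup>2 + y\<^sup>2))"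
    unfolding S_def m2 plus_complex.sel minus_complex.sel Ri by simp
  finally show "Re (- 1 * eta K \<phi> (1 * of_real t)) = ln K / pi * (y / ((t - x)\<^sup>2 + y\<^sup>2) - y / ((t + x)\<^sup>2 + y\<^sup>2))"
    by (simp only: dbl)
qed

end

text \<open>
  The angle under which the interval \<open>[- y, y]\<close> of a line is seen from a point at distance \<open>x\<close> from the
  line and height \<open>t\<close> along it. Up to the factor \<open>\<plusminus> ln K / \<pi>\<close> this is the primitive needed on the
  imaginary axis, and with \<open>x\<close> and \<open>y\<close> exchanged on the real axis.
\<close>

definition subtend :: "real \<Rightarrow> real \<Rightarrow> real \<Rightarrow> real" where
  "subtend x y t = arctan ((t + y) / x) - arctan ((t - y) / x)"

lemma subtend_derivative:
  assumes "x > 0"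
  shows "((\<lambda>t. subtend x y t) has_real_derivative (x / (x\<^sup>2 + (t + y)\<^sup>2) - x / (x\<^sup>2 + (t - y)\<^sup>2))) (at t)"
proof -
  have a: "((\<lambda>t. arctan ((t + c) / x)) has_real_derivative x / (x\<^sup>2 + (t + c)\<^sup>2)) (at t)" for c
  proof -
    have "((\<lambda>t. arctan ((t + c) / x)) has_real_derivative inverse (1 + ((t + c) / x)\<^sup>2) * (1 / x)) (at t)"
      by (use assms in \<open>auto intro!: derivative_eq_intros\<close>)
    moreover have "inverse (1 + ((t + c) / x)\<^sup>2) * (1 / x) = x / (x\<^sup>2 + (t + c)\<^sup>2)"
    proof -
      have x: "x \<noteq> 0" using assms by simp
      then have "1 + ((t + c) / x)\<^sup>2 = (x\<^sup>2 + (t + c)\<^sup>2) / x\<^sup>2"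
        unfolding power_divide add_divide_distrib[of "x\<^sup>2"] by simp
      then have "inverse (1 + ((t + c) / x)\<^sup>2) * (1 / x) = x\<^sup>2 / (x\<^sup>2 + (t + c)\<^sup>2) * (1 / x)"
        by simp
      also have "\<dots> = x / (x\<^sup>2 + (t + c)\<^sup>2)" using x by (simp add: power2_eq_square)
      finally show ?thesis .
    qed
    ultimately show ?thesis by simp
  qed
  show ?thesis
    unfolding subtend_def using DERIV_diff[OF a[of y] a[of "- y"]] by simp
qed

lemma subtend_at_top:
  assumes "x > 0" shows "(subtend x y \<longlongrightarrow> 0) at_top"
  unfolding subtend_def using assms by real_asymp

context square_solution
begin

text \<open>
  The imaginary axis in the continuation of the outer chart through the top edge. There the centre
  of \<open>Sq\<close> has height \<open>1 - 1 / K\<close>, because the upper half of \<open>Sq\<close> is compressed to height \<open>1 / K\<close>.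
\<close>

theorem height_equation:
  defines "x \<equiv> Re (\<phi> (1 + \<i>))" and "y \<equiv> Im (\<phi> (1 + \<i>))"
  shows "((\<lambda>T. integral {0..T} (\<lambda>t. exp (- (ln K / pi * subtend x y t)) - 1)) \<longlongrightarrow> - (1 - 1 / K)) at_top"
proof -
  have x: "x > 0" using Re_pos[of "1 + \<i>"] by (simp add: x_def)
  define \<theta> where "\<theta> s = Im (\<phi> (chart_top K (of_real s * \<i>)))" for s
  have "((\<lambda>T. integral {0..T} (\<lambda>t. exp (- (ln K / pi * subtend x y t)) - 1)) \<longlongrightarrow> 0 - (1 - 1 / K)) at_top"
  proof (rule ray_ode(2)[OF straight_chart_top[OF K], of \<i> "1 - 2 / K" \<theta> "dom_top K \<inter> {w. 1 < Im w}" 0 1])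
    fix s assume s: "s > 1 - 2 / K"
    have "Re (chart_top K (of_real s * \<i>)) = 0" by (simp add: chart_top_def)
    then have "Re (\<phi> (chart_top K (of_real s * \<i>))) = 0" by (simp add: Re_eq_0_iff)
    then show "of_real s * \<i> \<in> dom_top K \<and> chart_top K (of_real s * \<i>) \<notin> corners \<and>
         \<phi> (chart_top K (of_real s * \<i>)) = \<i> * of_real (\<theta> s)"
      using s by (simp add: dom_top_def corners_iff chart_top_def \<theta>_def complex_eq_iff)
  next
    show "open (dom_top K \<inter> {w. 1 < Im w})" by (intro open_Int open_dom_top open_halfspace_Im_gt)
    show "dom_top K \<inter> {w. 1 < Im w} \<subseteq> {w. chart_top K w \<notin> Sq}" by (auto simp: chart_top_above Sq_def)
    show "of_real s * \<i> \<in> dom_top K \<inter> {w. 1 < Im w}" if "s > 1" for s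
    proof -
      have "2 / K > 0" using K by simp
      then have "1 - 2 / K < s" using that by linarith
      then show ?thesis using that by (simp add: dom_top_def)
    qed
    show "((\<lambda>t. ln K / pi * subtend x y t) has_real_derivative
        ln K / pi * (x / (x\<^sup>2 + (t + y)\<^sup>2) - x / (x\<^sup>2 + (t - y)\<^sup>2))) (at t)" for t
      by (intro DERIV_cmult subtend_derivative x)
    show "ln K / pi * (x / (x\<^sup>2 + (t + y)\<^sup>2) - x / (x\<^sup>2 + (t - y)\<^sup>2)) = Re (- \<i> * eta K \<phi> (\<i> * of_real t))" for t
      using eta_on_axes(1) by (simp add: x_def y_def)
    show "((\<lambda>t. ln K / pi * subtend x y t) \<longlongrightarrow> 0) at_top"
      using tendsto_mult_left[OF subtend_at_top[OF x, of y], of "ln K / pi"] by simp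
    show "1 - 2 / K < 1 - 1 / K" using K by (simp add: divide_strict_right_mono)
    have "chart_top K (of_real (1 - 1 / K) * \<i>) = 0"
      using K by (simp add: chart_top_def complex_eq_iff min_def max_def)
    then show "\<theta> (1 - 1 / K) = 0" by (simp add: \<theta>_def zero)
  qed (auto simp: chart_top_above)
  then show ?thesis by simp
qed

text \<open>
  The real axis in the continuation of the inner chart through the right edge. There the centre
  of \<open>Sq\<close> is at \<open>0\<close>, the midpoint of the right edge at \<open>K\<close>, and the outside is translated by
  \<open>K - 1\<close>.
\<close>

theorem width_equations:
  defines "x \<equiv> Re (\<phi> (1 + \<i>))" and "y \<equiv> Im (\<phi> (1 + \<i>))" and "X \<equiv> Re (\<phi> 1)"
  shows "integral {0..X} (\<lambda>t. exp (ln K / pi * subtend y x t)) = K"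
    and "((\<lambda>T. integral {0..T} (\<lambda>t. exp (ln K / pi * subtend y x t) - 1)) \<longlongrightarrow> K - 1) at_top"
    and "X > 0"
proof -
  have y: "y > 0" using Im_pos[of "1 + \<i>"] by (simp add: y_def)
  show "X > 0" using Re_pos[of 1] by (simp add: X_def)
  define \<theta> where "\<theta> s = Re (\<phi> (chart_right K (of_real s * 1)))" for s
  have 1: "of_real s * 1 \<in> dom_right K \<and> chart_right K (of_real s * 1) \<notin> corners \<and>
         \<phi> (chart_right K (of_real s * 1)) = 1 * of_real (\<theta> s)" if s: "s > - K" for s
  proof -
    have "Im (chart_right K (of_real s * 1)) = 0" by (simp add: chart_right_def)
    then have "Im (\<phi> (chart_right K (of_real s * 1))) = 0" by (simp add: Im_eq_0_iff)
    then show ?thesis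
      using s by (simp add: dom_right_def corners_iff chart_right_def \<theta>_def complex_eq_iff)
  qed
  have 2: "open (dom_right K \<inter> {w. K < Re w})" by (intro open_Int open_dom_right open_halfspace_Re_gt)
  have 3: "dom_right K \<inter> {w. K < Re w} \<subseteq> {w. chart_right K w \<notin> Sq}"
    using K by (auto simp: chart_right_right Sq_def)
  have 4: "chart_right K w = w - of_real (K - 1) * 1" if "w \<in> dom_right K \<inter> {w. K < Re w}" for w
    using that K by (simp add: chart_right_right)
  have 5: "of_real s * 1 \<in> dom_right K \<inter> {w. K < Re w}" if "s > K" for s
    using that K by (simp add: dom_right_def)
  have 6: "((\<lambda>t. - (ln K / pi * subtend y x t)) has_real_derivative
        - (ln K / pi * (y / (y\<^sup>2 + (t + x)\<^sup>2) - y / (y\<^sup>2 + (t - x)\<^sup>2)))) (at t)" for t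
    by (intro DERIV_minus DERIV_cmult subtend_derivative y)
  have 7: "- (ln K / pi * (y / (y\<^sup>2 + (t + x)\<^sup>2) - y / (y\<^sup>2 + (t - x)\<^sup>2))) = Re (- 1 * eta K \<phi> (1 * of_real t))" for t
    unfolding eta_on_axes(2) x_def y_def by (simp add: algebra_simps)
  have 8: "((\<lambda>t. - (ln K / pi * subtend y x t)) \<longlongrightarrow> 0) at_top"
    using tendsto_minus[OF tendsto_mult_left[OF subtend_at_top[OF y, of x], of "ln K / pi"]] by simp
  have 9: "- K < 0" using K by simp
  have 10: "\<theta> 0 = 0"
  proof -
    have "chart_right K 0 = 0" using K by (simp add: chart_right_def complex_eq_iff)
    then show ?thesis by (simp add: \<theta>_def zero)
  qed
  have R1: "0 \<le> \<theta> s \<and> integral {0..\<theta> s} (\<lambda>t. exp (- (- (ln K / pi * subtend y x t)))) = s - 0" if "0 \<le> s" for s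
    by (rule ray_ode(1)[OF straight_chart_right[OF K] one_neq_zero 1 2 Int_lower1 3 4 5 7 6 8 9 10 that])
  have R2: "((\<lambda>T. integral {0..T} (\<lambda>t. exp (- (- (ln K / pi * subtend y x t))) - 1)) \<longlongrightarrow> (K - 1) - 0) at_top"
    by (rule ray_ode(2)[OF straight_chart_right[OF K] one_neq_zero 1 2 Int_lower1 3 4 5 7 6 8 9 10])
  have "\<theta> K = X"
  proof -
    have "chart_right K (of_real K) = 1" using K by (simp add: chart_right_def complex_eq_iff)
    then show ?thesis by (simp add: \<theta>_def X_def)
  qed
  then show "integral {0..X} (\<lambda>t. exp (ln K / pi * subtend y x t)) = K"
  proof -
    assume X: "\<theta> K = X"
    have "0 \<le> K" using K by simp
    from conjunct2[OF R1[OF this]] show ?thesis unfolding X by simp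
  qed
  show "((\<lambda>T. integral {0..T} (\<lambda>t. exp (ln K / pi * subtend y x t) - 1)) \<longlongrightarrow> K - 1) at_top"
    using R2 by simp
qed

end

section \<open>The limit system\<close>

lemma inverse_1_plus_square_has_integral:
  "((\<lambda>u::real. 1 / (1 + u\<^sup>2)) has_integral pi / 2) {0..}"
proof (rule has_integral_to_inf)
  have F: "((\<lambda>u::real. 1 / (1 + u\<^sup>2)) has_integral arctan y - arctan 0) {0..y}" if "0 \<le> y" for y
    by (rule fundamental_theorem_of_calculus[OF that])
      (auto intro!: derivative_eq_intros simp: has_real_derivative_iff_has_vector_derivative[symmetric] inverse_eq_divide)
  show "(\<lambda>u::real. 1 / (1 + u\<^sup>2)) integrable_on {0..y}" for y
    using F[of y] by (cases "0 \<le> y") auto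
  have "((\<lambda>y. arctan y) \<longlongrightarrow> pi / 2) at_top" by (rule tendsto_arctan_at_top)
  then show "((\<lambda>y. integral {0..y} (\<lambda>u::real. 1 / (1 + u\<^sup>2))) \<longlongrightarrow> pi / 2) at_top"
    by (rule Lim_transform_eventually)
      (rule eventually_mono[OF eventually_ge_at_top[of 0]], use integral_unique[OF F] in auto)
qed simp

text \<open>
  The factors of \<open>x\<close> in \<open>W\<close> and \<open>H\<close>. The pair is determined by \<open>Wint \<sigma> = Hint \<sigma>\<close>, where the left
  side decreases from 1 and the right side increases strictly from 0.
\<close>

definition Wint :: "real \<Rightarrow> real" where
  "Wint \<sigma> = integral {0..1} (\<lambda>u. exp (- \<sigma> / (1 - u\<^sup>2)))"
definition Hint :: "real \<Rightarrow> real" where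
  "Hint \<sigma> = integral {0..} (\<lambda>u. 1 - exp (- \<sigma> / (1 + u\<^sup>2)))"

lemma integral_half_open:
  fixes f :: "real \<Rightarrow> real"
  shows "integral {0..1} f = integral {0..<1} f"
  by (rule integral_subset_negligible[symmetric]) (auto intro: negligible_subset[of "{1}"])

lemma square_less_1: "0 \<le> u \<Longrightarrow> u < 1 \<Longrightarrow> u\<^sup>2 < (1::real)"
  by (simp add: power_less_one_iff)

lemma Wint_integrable: "0 \<le> \<sigma> \<Longrightarrow> (\<lambda>u. exp (- \<sigma> / (1 - u\<^sup>2))) integrable_on {0..<1::real}"
proof (rule measurable_bounded_by_integrable_imp_integrable[where g = "\<lambda>_. 1"])
  show "(\<lambda>u. exp (- \<sigma> / (1 - u\<^sup>2))) \<in> borel_measurable (lebesgue_on {0..<1::real})"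
    by (rule continuous_imp_measurable_on_sets_lebesgue)
      (use square_less_1 in \<open>fastforce intro!: continuous_intros\<close>)+
  have "(\<lambda>_. 1::real) integrable_on {0..1::real}" by (rule integrable_const_ivl)
  then show "(\<lambda>_. 1::real) integrable_on {0..<1::real}"
    by (rule integrable_spike_set) (auto intro: negligible_subset[of "{1::real}"])
  assume "0 \<le> \<sigma>"
  then show "norm (exp (- \<sigma> / (1 - u\<^sup>2))) \<le> 1" if "u \<in> {0..<1}" for u
    using square_less_1[of u] that by simp
qed auto

lemma one_minus_exp_bounds: "0 \<le> v \<Longrightarrow> 0 \<le> 1 - exp (- v) \<and> 1 - exp (- v) \<le> (v::real)"
  using exp_ge_add_one_self[of "- v"] by auto

lemma Hint_integrable:
  fixes \<sigma> :: real
  assumes "0 \<le> \<sigma>"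
  shows "(\<lambda>u::real. 1 - exp (- \<sigma> / (1 + u\<^sup>2))) integrable_on {0..}"
proof (rule measurable_bounded_by_integrable_imp_integrable[where g = "\<lambda>u::real. \<sigma> * (1 / (1 + u\<^sup>2))"])
  have "1 + u\<^sup>2 \<noteq> 0" for u :: real by (metis add_pos_nonneg less_numeral_extra(3) zero_le_power2 zero_less_one)
  then show "(\<lambda>u. 1 - exp (- \<sigma> / (1 + u\<^sup>2))) \<in> borel_measurable (lebesgue_on {0..})"
    by (intro continuous_imp_measurable_on_sets_lebesgue continuous_intros) auto
  show "(\<lambda>u::real. \<sigma> * (1 / (1 + u\<^sup>2))) integrable_on {0..}"
    by (rule integrable_on_mult_right) (use inverse_1_plus_square_has_integral in blast)
  show "norm (1 - exp (- \<sigma> / (1 + u\<^sup>2))) \<le> \<sigma> * (1 / (1 + u\<^sup>2))" for u :: real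
  proof -
    have "0 \<le> \<sigma> / (1 + u\<^sup>2)" using assms by (simp add: add_nonneg_nonneg)
    from one_minus_exp_bounds[OF this] show ?thesis by simp
  qed
qed auto

lemma Wint_limit:
  assumes s: "s \<longlonglongrightarrow> \<sigma>" "\<And>n. 0 \<le> s n" "0 \<le> \<sigma>"
  shows "(\<lambda>n. Wint (s n)) \<longlonglongrightarrow> Wint \<sigma>"
  unfolding Wint_def integral_half_open
proof (rule dominated_convergence(2)[where h = "\<lambda>_. 1"])
  show "(\<lambda>u. exp (- s n / (1 - u\<^sup>2))) integrable_on {0..<1::real}" for n by (rule Wint_integrable) (rule s)
  have "(\<lambda>_. 1::real) integrable_on {0..1::real}" by (rule integrable_const_ivl)
  then show "(\<lambda>_. 1::real) integrable_on {0..<1::real}"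
    by (rule integrable_spike_set) (auto intro: negligible_subset[of "{1::real}"])
  show "norm (exp (- s n / (1 - u\<^sup>2))) \<le> 1" if "u \<in> {0..<1}" for u n
    using square_less_1[of u] that s(2)[of n] by simp
  show "(\<lambda>n. exp (- s n / (1 - u\<^sup>2))) \<longlonglongrightarrow> exp (- \<sigma> / (1 - u\<^sup>2))" if "u \<in> {0..<1}" for u
    using square_less_1[of u] that by (intro tendsto_intros s(1)) auto
qed

lemma Hint_limit:
  assumes s: "s \<longlonglongrightarrow> \<sigma>" "\<And>n. 0 \<le> s n" "\<And>n. s n \<le> M"
  shows "(\<lambda>n. Hint (s n)) \<longlonglongrightarrow> Hint \<sigma>"
  unfolding Hint_def
proof (rule dominated_convergence(2)[where h = "\<lambda>u. M * (1 / (1 + u\<^sup>2))"])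
  show "(\<lambda>u. 1 - exp (- s n / (1 + u\<^sup>2))) integrable_on {0..}" for n by (rule Hint_integrable) (rule s)
  show "(\<lambda>u. M * (1 / (1 + u\<^sup>2))) integrable_on {0..}"
    by (rule integrable_on_mult_right) (use inverse_1_plus_square_has_integral in blast)
  fix u :: real
  have p: "1 + u\<^sup>2 > 0" by (simp add: add_pos_nonneg)
  show "norm (1 - exp (- s n / (1 + u\<^sup>2))) \<le> M * (1 / (1 + u\<^sup>2))" for n
  proof -
    have "0 \<le> s n / (1 + u\<^sup>2)" "s n / (1 + u\<^sup>2) \<le> M / (1 + u\<^sup>2)"
      using s(2,3)[of n] p by (auto intro!: divide_right_mono)
    with one_minus_exp_bounds[OF this(1)] show ?thesis by simp
  qed
  show "(\<lambda>n. 1 - exp (- s n / (1 + u\<^sup>2))) \<longlonglongrightarrow> 1 - exp (- \<sigma> / (1 + u\<^sup>2))"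
    using p by (intro tendsto_intros s(1)) auto
qed

lemma Wint_antimono:
  assumes "0 \<le> s" "s \<le> t" shows "Wint t \<le> Wint s"
  unfolding Wint_def integral_half_open
proof (rule integral_le)
  fix u :: real assume "u \<in> {0..<1}"
  then have "1 - u\<^sup>2 > 0" using square_less_1[of u] by simp
  then show "exp (- t / (1 - u\<^sup>2)) \<le> exp (- s / (1 - u\<^sup>2))" using assms by (simp add: divide_right_mono)
next
  show "(\<lambda>u. exp (- t / (1 - u\<^sup>2))) integrable_on {0..<1}" "(\<lambda>u. exp (- s / (1 - u\<^sup>2))) integrable_on {0..<1}"
    by (rule Wint_integrable; use assms in simp)+
qed

lemma Hint_strict_mono:
  assumes "0 \<le> s" "s < t" shows "Hint s < Hint t"
proof -
  define d where "d u = exp (- s / (1 + u\<^sup>2)) - exp (- t / (1 + u\<^sup>2))" for u :: real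
  have nn: "0 \<le> d u" for u
    using assms by (auto simp: d_def intro!: divide_right_mono add_nonneg_nonneg)
  have lower: "exp (- s) - exp (- (s + (t - s) / 2)) \<le> d u" if "u \<in> {0..1}" for u
  proof -
    define q where "q = 1 / (1 + u\<^sup>2)"
    have "u\<^sup>2 \<le> 1" using that by (simp add: power_le_one)
    then have q: "1 / 2 \<le> q" "q \<le> 1" "0 < q" by (auto simp: q_def field_simps add_pos_nonneg)
    have "d u = exp (- (s * q)) * (1 - exp (- ((t - s) * q)))"
      by (simp add: d_def q_def exp_add[symmetric] algebra_simps diff_divide_distrib)
    moreover have "exp (- s) - exp (- (s + (t - s) / 2)) = exp (- s) * (1 - exp (- ((t - s) / 2)))"
      by (simp add: algebra_simps exp_add[symmetric])
    moreover have "exp (- s) \<le> exp (- (s * q))" using assms q by (simp add: mult_left_le)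
    moreover have "exp (- ((t - s) * q)) \<le> exp (- ((t - s) / 2))"
      using assms mult_left_mono[OF q(1), of "t - s"] by simp
    moreover have "exp (- ((t - s) / 2)) \<le> 1" using assms by simp
    ultimately show ?thesis by (auto intro!: mult_mono)
  qed
  have di: "d integrable_on {0..}" and de: "integral {0..} d = Hint t - Hint s"
  proof -
    have i: "(\<lambda>u::real. 1 - exp (- t / (1 + u\<^sup>2))) integrable_on {0..}" "(\<lambda>u::real. 1 - exp (- s / (1 + u\<^sup>2))) integrable_on {0..}"
      by (rule Hint_integrable; use assms in simp)+
    have eq: "d = (\<lambda>u. (1 - exp (- t / (1 + u\<^sup>2))) - (1 - exp (- s / (1 + u\<^sup>2))))" by (auto simp: d_def)
    show "d integrable_on {0..}" unfolding eq by (rule Henstock_Kurzweil_Integration.integrable_diff[OF i])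
    show "integral {0..} d = Hint t - Hint s"
      unfolding eq Hint_def by (rule Henstock_Kurzweil_Integration.integral_diff[OF i])
  qed
  have di1: "d integrable_on {0..1}"
    by (rule integrable_on_subinterval[OF di]) auto
  have "0 < exp (- s) - exp (- (s + (t - s) / 2))" using assms by simp
  also have "\<dots> = integral {0..1::real} (\<lambda>_. exp (- s) - exp (- (s + (t - s) / 2)))" by simp
  also have "\<dots> \<le> integral {0..1} d"
    by (rule integral_le[OF integrable_const_ivl di1]) (rule lower)
  also have "\<dots> \<le> integral {0..} d"
    by (rule integral_subset_le[OF _ di1 di]) (use nn in auto)
  finally show ?thesis using de by simp
qed

lemma Wint_pos:
  assumes "0 \<le> s" shows "Wint s > 0"
proof -
  have i: "(\<lambda>u. exp (- s / (1 - u\<^sup>2))) integrable_on {0..<1::real}" by (rule Wint_integrable[OF assms])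
  have sub: "{0..1/2} \<subseteq> {0..<1::real}" by auto
  have i2: "(\<lambda>u. exp (- s / (1 - u\<^sup>2))) integrable_on {0..1/2::real}"
    by (rule integrable_on_subinterval[OF i sub])
  have "0 < 1/2 * exp (- 2 * s)" by simp
  also have "\<dots> = integral {0..1/2::real} (\<lambda>_. exp (- 2 * s))" by simp
  also have "\<dots> \<le> integral {0..1/2} (\<lambda>u. exp (- s / (1 - u\<^sup>2)))"
  proof (rule integral_le[OF integrable_const_ivl i2])
    fix u :: real assume "u \<in> {0..1/2}"
    then have "u\<^sup>2 \<le> (1/2)\<^sup>2" by (intro power_mono) auto
    then have "1 - u\<^sup>2 \<ge> 1/2" by (simp add: power2_eq_square)
    then have "1 / (1 - u\<^sup>2) \<le> 2" by (simp add: field_simps)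
    then have "s * (1 / (1 - u\<^sup>2)) \<le> s * 2" using assms by (rule mult_left_mono)
    then show "exp (- 2 * s) \<le> exp (- s / (1 - u\<^sup>2))" by simp
  qed
  also have "\<dots> \<le> Wint s"
    unfolding Wint_def integral_half_open by (rule integral_subset_le[OF sub i2 i]) auto
  finally show ?thesis .
qed

lemma Wint_0: "Wint 0 = 1" and Hint_0: "Hint 0 = 0"
  by (simp_all add: Wint_def Hint_def)

lemma Wint_le_exp: "0 \<le> s \<Longrightarrow> Wint s \<le> exp (- s)"
proof -
  assume s: "0 \<le> s"
  have "Wint s \<le> integral {0..<1::real} (\<lambda>_. exp (- s))"
    unfolding Wint_def integral_half_open
  proof (rule integral_le[OF Wint_integrable[OF s]])
    show "(\<lambda>_. exp (- s)) integrable_on {0..<1::real}"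
      by (rule integrable_spike_set[OF integrable_const_ivl[of _ 0 1]]) (auto intro: negligible_subset[of "{1::real}"])
    fix u :: real assume "u \<in> {0..<1}"
    then have "0 < 1 - u\<^sup>2" "1 - u\<^sup>2 \<le> 1" using square_less_1[of u] by auto
    then have "1 \<le> 1 / (1 - u\<^sup>2)" by simp
    then have "s * 1 \<le> s * (1 / (1 - u\<^sup>2))" using s by (rule mult_left_mono)
    then show "exp (- s / (1 - u\<^sup>2)) \<le> exp (- s)" by simp
  qed
  also have "\<dots> = exp (- s)" by (simp add: integral_half_open[symmetric])
  finally show ?thesis .
qed

lemma Hint_ge: "0 \<le> s \<Longrightarrow> 1 - exp (- s / 2) \<le> Hint s"
proof -
  assume s: "0 \<le> s"
  have i: "(\<lambda>u::real. 1 - exp (- s / (1 + u\<^sup>2))) integrable_on {0..}" by (rule Hint_integrable[OF s])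
  have i1: "(\<lambda>u. 1 - exp (- s / (1 + u\<^sup>2))) integrable_on {0..1::real}"
    by (rule integrable_on_subinterval[OF i]) auto
  have "1 - exp (- s / 2) = integral {0..1::real} (\<lambda>_. 1 - exp (- s / 2))" by simp
  also have "\<dots> \<le> integral {0..1} (\<lambda>u. 1 - exp (- s / (1 + u\<^sup>2)))"
  proof (rule integral_le[OF integrable_const_ivl i1])
    fix u :: real assume "u \<in> {0..1}"
    then have "u\<^sup>2 \<le> 1" by (simp add: power_le_one)
    then have "s / 2 \<le> s / (1 + u\<^sup>2)" using s by (intro divide_left_mono) (auto simp: add_pos_nonneg)
    then show "1 - exp (- s / 2) \<le> 1 - exp (- s / (1 + u\<^sup>2))" by simp
  qed
  also have "\<dots> \<le> Hint s" unfolding Hint_def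
  proof (rule integral_subset_le[OF _ i1 i])
    have "0 \<le> s / (1 + u\<^sup>2)" for u :: real using s by (simp add: add_nonneg_nonneg)
    then show "\<forall>u\<in>{0..}. 0 \<le> 1 - exp (- s / (1 + u\<^sup>2))" by simp
  qed auto
  finally show ?thesis .
qed

text \<open>
  The explicit values at \<open>\<sigma> = 2\<close> already give \<open>Wint 2 \<le> Hint 2\<close>, so the solution lies between 0 and 2.
\<close>

lemma Wint_eq_Hint_ex1: "\<exists>!\<sigma>. \<sigma> > 0 \<and> Wint \<sigma> = Hint \<sigma>"
proof (rule ex_ex1I)
  have c: "continuous_on {0..2} (\<lambda>s. Hint s - Wint s)"
    by (rule continuous_on_sequentiallyI) (auto intro!: tendsto_diff Wint_limit Hint_limit[where M = 2])
  have "exp (1::real) \<ge> 2" using exp_ge_add_one_self[of 1] by simp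
  then have e: "exp (- 1 :: real) \<le> 1 / 2" by (simp add: exp_minus field_simps)
  have "exp (- 2 :: real) = exp (- 1) * exp (- 1)" by (simp add: exp_add[symmetric])
  also have "\<dots> \<le> 1 / 2 * (1 / 2)" using e by (intro mult_mono) auto
  finally have "Hint 2 - Wint 2 \<ge> 0" using Hint_ge[of 2] Wint_le_exp[of 2] e by simp
  then have "\<exists>s\<ge>0. s \<le> 2 \<and> Hint s - Wint s = 0"
    by (intro IVT'[OF _ _ _ c]) (auto simp: Wint_0 Hint_0)
  then obtain s where s: "0 \<le> s" "Hint s - Wint s = 0" by blast
  have "s \<noteq> 0" using s by (auto simp: Wint_0 Hint_0)
  then show "\<exists>\<sigma>. \<sigma> > 0 \<and> Wint \<sigma> = Hint \<sigma>" using s by (intro exI[of _ s]) auto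
next
  fix s t assume "s > 0 \<and> Wint s = Hint s" "t > 0 \<and> Wint t = Hint t"
  then show "s = t"
    using Hint_strict_mono[of s t] Hint_strict_mono[of t s] Wint_antimono[of s t] Wint_antimono[of t s]
    by (cases s t rule: linorder_cases) auto
qed

lemma W_eq: "W x \<sigma> = x * Wint \<sigma>" and H_eq: "H x \<sigma> = x * Hint \<sigma>"
  by (simp_all add: W_def H_def Wint_def Hint_def)

theorem WH_ex1: "\<exists>!(p :: real \<times> real). fst p > 0 \<and> snd p > 0 \<and> W (fst p) (snd p) = 1 \<and> H (fst p) (snd p) = 1"
proof -
  obtain \<sigma> where s: "\<sigma> > 0" "Wint \<sigma> = Hint \<sigma>" and u: "\<And>t. t > 0 \<Longrightarrow> Wint t = Hint t \<Longrightarrow> t = \<sigma>"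
    using Wint_eq_Hint_ex1 by blast
  have p: "Wint \<sigma> > 0" using s(1) by (intro Wint_pos) simp
  show ?thesis
  proof (rule ex1I[of _ "(1 / Wint \<sigma>, \<sigma>)"])
    show "fst (1 / Wint \<sigma>, \<sigma>) > 0 \<and> snd (1 / Wint \<sigma>, \<sigma>) > 0 \<and>
       W (fst (1 / Wint \<sigma>, \<sigma>)) (snd (1 / Wint \<sigma>, \<sigma>)) = 1 \<and> H (fst (1 / Wint \<sigma>, \<sigma>)) (snd (1 / Wint \<sigma>, \<sigma>)) = 1"
      using s p by (simp add: W_eq H_eq)
    fix q :: "real \<times> real"
    assume q: "fst q > 0 \<and> snd q > 0 \<and> W (fst q) (snd q) = 1 \<and> H (fst q) (snd q) = 1"
    then have "fst q * Wint (snd q) = fst q * Hint (snd q)" by (simp add: W_eq H_eq)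
    then have "Wint (snd q) = Hint (snd q)" using q by simp
    then have "snd q = \<sigma>" using u q by blast
    moreover from this have "fst q = 1 / Wint \<sigma>" using q p by (simp add: W_eq field_simps)
    ultimately show "q = (1 / Wint \<sigma>, \<sigma>)" by (simp add: prod_eq_iff)
  qed
qed

section \<open>Estimates for the shape of the image of the square\<close>

lemma exp_minus_2_le: "exp (- 2 :: real) \<le> 1 / 4" and exp_minus_1_le: "exp (- 1 :: real) \<le> 1 / 2" and exp_minus_5_le: "exp (- 5 :: real) \<le> 1 / 10"
proof -
  have "exp (1::real) \<ge> 2" using exp_ge_add_one_self[of 1] by simp
  then show e: "exp (- 1 :: real) \<le> 1 / 2" by (simp add: exp_minus field_simps)
  have "exp (- 2 :: real) = exp (- 1) * exp (- 1)" by (simp add: exp_add[symmetric])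
  also have "\<dots> \<le> 1 / 2 * (1 / 2)" using e by (intro mult_mono) auto
  finally show e2: "exp (- 2 :: real) \<le> 1 / 4" by simp
  have "exp (- 5 :: real) = exp (- 2) * (exp (- 2) * exp (- 1))" by (simp add: exp_add[symmetric])
  also have "\<dots> \<le> 1 / 4 * (1 / 4 * (1 / 2))" using e e2 by (intro mult_mono) auto
  finally show "exp (- 5 :: real) \<le> 1 / 10" by simp
qed

lemma subtend_pos: "x > 0 \<Longrightarrow> y > 0 \<Longrightarrow> subtend x y t > 0"
  unfolding subtend_def by (simp add: arctan_less_iff divide_strict_right_mono)

lemma subtend_antimono:
  assumes "x > 0" "y > 0" "0 \<le> s" "s \<le> t"
  shows "subtend x y t \<le> subtend x y s"
proof (rule DERIV_nonpos_imp_nonincreasing[OF assms(4)])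
  fix u assume u: "s \<le> u" "u \<le> t"
  have "(u - y)\<^sup>2 \<le> (u + y)\<^sup>2"
    using assms u by (intro abs_le_square_iff[THEN iffD1]) auto
  then have "x / (x\<^sup>2 + (u + y)\<^sup>2) \<le> x / (x\<^sup>2 + (u - y)\<^sup>2)"
    using assms by (intro divide_left_mono mult_pos_pos add_pos_nonneg) auto
  then show "\<exists>d. (subtend x y has_real_derivative d) (at u) \<and> d \<le> 0"
    using subtend_derivative[OF assms(1), of y u] by (intro exI conjI) auto
qed

lemma subtend_mvt:
  assumes "x > 0" "y > 0"
  shows "\<exists>v. t - y < v \<and> v < t + y \<and> subtend x y t = 2 * y * (x / (x\<^sup>2 + v\<^sup>2))"
proof -
  have d: "((\<lambda>v. arctan (v / x)) has_real_derivative x / (x\<^sup>2 + v\<^sup>2)) (at v)" for v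
  proof -
    have "((\<lambda>v. arctan (v / x)) has_real_derivative inverse (1 + (v / x)\<^sup>2) * (1 / x)) (at v)"
      using assms by (auto intro!: derivative_eq_intros)
    moreover have "1 + (v / x)\<^sup>2 = (x\<^sup>2 + v\<^sup>2) / x\<^sup>2"
      using assms unfolding power_divide add_divide_distrib[of "x\<^sup>2"] by simp
    then have "inverse (1 + (v / x)\<^sup>2) * (1 / x) = x\<^sup>2 / (x\<^sup>2 + v\<^sup>2) * (1 / x)" by simp
    then have "inverse (1 + (v / x)\<^sup>2) * (1 / x) = x / (x\<^sup>2 + v\<^sup>2)"
      using assms by (simp add: power2_eq_square)
    ultimately show ?thesis by simp
  qed
  have "\<exists>v. t - y < v \<and> v < t + y \<and> arctan ((t + y) / x) - arctan ((t - y) / x) = (t + y - (t - y)) * (x / (x\<^sup>2 + v\<^sup>2))"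
    by (rule MVT2) (use assms d in auto)
  then show ?thesis by (auto simp: subtend_def)
qed

lemma subtend_continuous: "x > 0 \<Longrightarrow> continuous_on S (subtend x y)"
  unfolding subtend_def by (intro continuous_intros) auto

text \<open>
  The equations of \<open>height_equation\<close> and \<open>width_equations\<close> after scaling lengths by \<open>x\<close>:
  \<open>lam = ln K / \<pi>\<close>, \<open>r = y / x\<close>, and \<open>om = \<phi> 1 / x\<close> is the position of the midpoint of the right
  edge. In the limit \<open>om\<close> may exceed 1, but the part of the interval beyond 1 contributes little.
\<close>

locale shape_data =
  fixes lam x r om :: real
  assumes lam: "lam > 0" and x: "x > 0" and r: "r > 0" and om: "om > 0"
    and h: "((\<lambda>T. integral {0..T} (\<lambda>u. 1 - exp (- (lam * subtend 1 r u)))) \<longlongrightarrow> (1 - exp (- (pi * lam))) / x) at_top"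
    and w1: "integral {0..om} (\<lambda>u. exp (lam * subtend r 1 u)) = exp (pi * lam) / x"
    and w2: "((\<lambda>T. integral {0..T} (\<lambda>u. exp (lam * subtend r 1 u) - 1)) \<longlongrightarrow> (exp (pi * lam) - 1) / x) at_top"
begin

definition excess :: "real \<Rightarrow> real" where "excess u = exp (lam * subtend r 1 u) - 1"

lemma excess_int: "excess integrable_on {a..b}"
  unfolding excess_def by (intro integrable_continuous_interval continuous_intros subtend_continuous r)

lemma excess_nonneg: "excess u \<ge> 0"
  using lam subtend_pos[OF r, of 1 u] by (simp add: excess_def)

lemma h_has_integral: "((\<lambda>u. 1 - exp (- (lam * subtend 1 r u))) has_integral (1 - exp (- (pi * lam))) / x) {0..}"
proof (rule has_integral_to_inf[OF _ h])
  show "(\<lambda>u. 1 - exp (- (lam * subtend 1 r u))) integrable_on {0..y}" for y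
    by (intro integrable_continuous_interval continuous_intros subtend_continuous) auto
  show "0 \<le> 1 - exp (- (lam * subtend 1 r y))" for y
    using lam subtend_pos[OF zero_less_one r, of y] by simp
qed

lemma height_bound:
  assumes "0 \<le> a" "a \<le> b" "0 \<le> c" "\<And>u. a \<le> u \<Longrightarrow> u \<le> b \<Longrightarrow> c \<le> lam * subtend 1 r u"
  shows "(b - a) * (1 - exp (- c)) \<le> 1 / x"
proof -
  let ?f = "\<lambda>u. 1 - exp (- (lam * subtend 1 r u))"
  have i: "?f integrable_on {a..b}"
    by (intro integrable_continuous_interval continuous_intros subtend_continuous) auto
  have "(b - a) * (1 - exp (- c)) = integral {a..b} (\<lambda>_. 1 - exp (- c))" using assms by simp
  also have "\<dots> \<le> integral {a..b} ?f"
    by (rule integral_le[OF integrable_const_ivl i]) (use assms in auto)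
  also have "\<dots> \<le> integral {0..} ?f"
  proof (rule integral_subset_le[OF _ i])
    have "0 \<le> lam * subtend 1 r u" for u
      using lam subtend_pos[OF zero_less_one r, of u] by simp
    then show "\<forall>u\<in>{0..}. 0 \<le> ?f u" by simp
  qed (use assms h_has_integral in auto)
  also have "\<dots> = (1 - exp (- (pi * lam))) / x" by (rule integral_unique[OF h_has_integral])
  also have "\<dots> \<le> 1 / x" using x by (simp add: divide_right_mono)
  finally show ?thesis .
qed

lemma width_eq: "integral {0..om} (\<lambda>u. exp (- (lam * (pi - subtend r 1 u)))) = 1 / x"
proof -
  have "(\<lambda>u. exp (- (lam * (pi - subtend r 1 u)))) = (\<lambda>u. exp (- (pi * lam)) * exp (lam * subtend r 1 u))"
    by (auto simp: exp_add[symmetric] algebra_simps)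
  then have "integral {0..om} (\<lambda>u. exp (- (lam * (pi - subtend r 1 u)))) = exp (- (pi * lam)) * (exp (pi * lam) / x)"
    using w1 by simp
  then show ?thesis by (simp add: exp_minus)
qed

lemma width_integrable: "(\<lambda>u. exp (- (lam * (pi - subtend r 1 u)))) integrable_on {a..b}"
  by (intro integrable_continuous_interval continuous_intros subtend_continuous r)

lemma excess_tail_limit: "((\<lambda>T. integral {om..T} excess) \<longlongrightarrow> om - 1 / x) at_top"
proof -
  have "integral {0..om} excess = integral {0..om} (\<lambda>u. exp (lam * subtend r 1 u)) - integral {0..om} (\<lambda>u. 1)"
    unfolding excess_def
    by (intro Henstock_Kurzweil_Integration.integral_diff integrable_continuous_interval continuous_intros subtend_continuous r)
  then have e: "integral {0..om} excess = exp (pi * lam) / x - om" using w1 om by simp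
  have "((\<lambda>T. integral {0..T} excess - integral {0..om} excess) \<longlongrightarrow> (exp (pi * lam) - 1) / x - (exp (pi * lam) / x - om)) at_top"
    unfolding e using w2 by (intro tendsto_intros) (simp add: excess_def[abs_def])
  also have "(exp (pi * lam) - 1) / x - (exp (pi * lam) / x - om) = om - 1 / x" by (simp add: diff_divide_distrib)
  finally show ?thesis
  proof (rule Lim_transform_eventually)
    show "\<forall>\<^sub>F T in at_top. integral {0..T} excess - integral {0..om} excess = integral {om..T} excess"
      using eventually_ge_at_top[of om]
    proof eventually_elim
      case (elim T)
      then show ?case
        using Henstock_Kurzweil_Integration.integral_combine[of 0 om T excess] om excess_int by simp
    qed
  qed
qed

lemma excess_tail_le:
  assumes "om \<le> a" "a \<le> b" shows "integral {a..b} excess \<le> om - 1 / x"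
proof (rule tendsto_lowerbound[OF excess_tail_limit])
  show "\<forall>\<^sub>F T in at_top. integral {a..b} excess \<le> integral {om..T} excess"
    using eventually_ge_at_top[of b]
    by eventually_elim (intro integral_subset_le excess_int, use assms excess_nonneg in auto)
qed simp

text \<open>
  Beyond \<open>om\<close> the integral of \<open>exp (lam * subtend r 1 u) - 1\<close> is \<open>om - 1 / x\<close>. If \<open>om\<close> is large,
  \<open>subtend r 1 u\<close> is of order \<open>r / u\<^sup>2\<close> there, so the integral is of order \<open>lam * r / om\<close>.
\<close>

lemma om_upper: "om \<le> 2 + 1 / x + 8 * lam * r"
proof (cases "om \<le> 2")
  case True
  have "8 * lam * r > 0" "1 / x > 0" using lam r x by simp_all
  then show ?thesis using True by linarith
next
  case False
  define M where "M = 8 * lam * r"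
  have M: "M > 0" using lam r by (simp add: M_def)
  have xp: "1 / x > 0" using x by simp
  show ?thesis
  proof (cases "om\<^sup>2 \<le> M")
    case True
    have "om * 1 \<le> om * om" using False by (intro mult_left_mono) auto
    then have "om \<le> M" using True by (simp add: power2_eq_square)
    then show ?thesis using xp unfolding M_def by linarith
  next
    case big: False
    have bnd: "excess u \<le> 2 * M / u\<^sup>2" if u: "u \<ge> om" for u
    proof -
      have u2: "u > 2" using u False by simp
      obtain v where v: "u - 1 < v" "subtend r 1 u = 2 * (r / (r\<^sup>2 + v\<^sup>2))"
        using subtend_mvt[OF r zero_less_one, of u] by auto
      have "(u / 2)\<^sup>2 \<le> v\<^sup>2" using v(1) u2 by (intro power_mono) auto
      then have "(u / 2)\<^sup>2 \<le> r\<^sup>2 + v\<^sup>2" using zero_le_power2[of r] by linarith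
      then have "r / (r\<^sup>2 + v\<^sup>2) \<le> r / (u / 2)\<^sup>2"
        using r u2 by (intro divide_left_mono mult_pos_pos add_pos_nonneg) auto
      then have "subtend r 1 u \<le> 8 * r / u\<^sup>2" using v by (simp add: power_divide)
      then have "lam * subtend r 1 u \<le> lam * (8 * r / u\<^sup>2)" using lam by (intro mult_left_mono) auto
      then have le: "lam * subtend r 1 u \<le> M / u\<^sup>2" by (simp add: M_def mult_ac)
      have "om\<^sup>2 \<le> u\<^sup>2" using u om by (intro power_mono) auto
      then have "M / u\<^sup>2 \<le> 1" using big u2 by simp
      then have q: "0 \<le> lam * subtend r 1 u" "lam * subtend r 1 u \<le> 1"
        using lam subtend_pos[OF r, of 1 u] le by auto
      have "(lam * subtend r 1 u)\<^sup>2 \<le> lam * subtend r 1 u * 1"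
        unfolding power2_eq_square using q by (intro mult_left_mono) auto
      then have "excess u \<le> 2 * (lam * subtend r 1 u)"
        using exp_bound[OF q] by (simp add: excess_def)
      then show ?thesis using le by simp
    qed
    have "om - 1 / x \<le> 2 * M / om"
    proof (rule tendsto_upperbound[OF excess_tail_limit])
      show "\<forall>\<^sub>F T in at_top. integral {om..T} excess \<le> 2 * M / om"
        using eventually_ge_at_top[of om]
      proof eventually_elim
        case (elim T)
        have "((\<lambda>u. 2 * M / u\<^sup>2) has_integral (- (2 * M) / T) - (- (2 * M) / om)) {om..T}"
        proof (rule fundamental_theorem_of_calculus[OF elim])
          fix u assume "u \<in> {om..T}"
          then have "u \<noteq> 0" using om by auto
          then have "((\<lambda>u. - (2 * M) / u) has_real_derivative 2 * M / u\<^sup>2) (at u within {om..T})"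
            by (auto intro!: derivative_eq_intros simp: power2_eq_square)
          then show "((\<lambda>u. - (2 * M) / u) has_vector_derivative 2 * M / u\<^sup>2) (at u within {om..T})"
            by (simp add: has_real_derivative_iff_has_vector_derivative)
        qed
        then have "integral {om..T} excess \<le> (- (2 * M) / T) - (- (2 * M) / om)"
          using bnd by (intro has_integral_le[OF integrable_integral[OF excess_int]]) auto
        also have "\<dots> \<le> 2 * M / om" using M elim om by simp
        finally show ?case .
      qed
    qed simp
    also have "2 * M / om \<le> M" using False M by (simp add: divide_le_eq mult.commute)
    finally show ?thesis by (simp add: M_def)
  qed
qed

lemma pi_minus_subtend: "pi - subtend r 1 u \<ge> 2 * arctan r" if "u \<ge> 0"
proof -
  have "subtend r 1 u \<le> subtend r 1 0" by (rule subtend_antimono) (use r that in auto)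
  also have "\<dots> = 2 * arctan (1 / r)" by (simp add: subtend_def arctan_minus)
  also have "arctan (1 / r) = pi / 2 - arctan r" using arctan_inverse[of r] r by (simp add: inverse_eq_divide)
  finally show ?thesis by simp
qed

lemma half_pi_le: "pi - subtend r 1 u \<ge> pi / 2" if "u \<ge> 1"
proof -
  have "subtend r 1 u \<le> subtend r 1 1" by (rule subtend_antimono) (use r that in auto)
  also have "\<dots> \<le> pi / 2" using arctan_ubound[of "2 / r"] by (simp add: subtend_def)
  finally show ?thesis by simp
qed

text \<open>
  If \<open>r \<ge> 1\<close>, the height equation bounds \<open>x * r\<close>. Then \<open>x * om\<close> grows at most linearly in
  \<open>lam\<close>, while the integrand of the width equation is at most \<open>exp (- lam * \<pi> / 2)\<close>, so the
  integral is too small.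
\<close>

lemma r_less_1:
  assumes l: "lam \<ge> 4" "(9 + 32 * lam) * exp (- (lam * (pi / 2))) < 1"
  shows "r < 1"
proof (rule ccontr)
  assume "\<not> r < 1"
  then have r1: "r \<ge> 1" by simp
  have "(r / 2 - 0) * (1 - exp (- 1)) \<le> 1 / x"
  proof (rule height_bound)
    fix u assume u: "0 \<le> u" "u \<le> r / 2"
    have "arctan (u + r) \<ge> arctan 1" by (rule arctan_monotone') (use u r1 in simp)
    moreover have "arctan (u - r) \<le> 0" using u r by (simp add: arctan_le_zero_iff)
    moreover have "subtend 1 r u = arctan (u + r) - arctan (u - r)" by (simp add: subtend_def)
    ultimately have "subtend 1 r u \<ge> pi / 4" unfolding arctan_one by linarith
    then have "1 / 2 \<le> subtend 1 r u" using pi_ge_two by linarith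
    then have "4 * (1 / 2) \<le> lam * subtend 1 r u" using l by (intro mult_mono) auto
    then show "1 \<le> lam * subtend 1 r u" by simp
  qed (use r in auto)
  moreover have "(r / 2) * (1 / 2) \<le> (r / 2) * (1 - exp (- 1))" using r exp_minus_1_le by (intro mult_left_mono) auto
  ultimately have "r / 4 \<le> 1 / x" by simp
  then have xr: "x * r \<le> 4" using x by (simp add: field_simps)
  have "x * 1 \<le> x * r" using x r1 by (intro mult_left_mono) auto
  then have x4: "x \<le> 4" using xr by simp
  have "1 / x \<le> integral {0..om} (\<lambda>_. exp (- (lam * (pi / 2))))"
    unfolding width_eq[symmetric]
  proof (rule integral_le[OF width_integrable integrable_const_ivl])
    fix u assume "u \<in> {0..om}"
    then have "pi - subtend r 1 u \<ge> 2 * arctan r" by (intro pi_minus_subtend) simp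
    moreover have "arctan r \<ge> pi / 4" using arctan_monotone'[OF r1] by (simp only: arctan_one)
    ultimately have "pi / 2 \<le> pi - subtend r 1 u" by simp
    then show "exp (- (lam * (pi - subtend r 1 u))) \<le> exp (- (lam * (pi / 2)))"
      using lam by (simp add: mult_left_mono)
  qed
  then have "1 / x \<le> om * exp (- (lam * (pi / 2)))" using om by simp
  then have "1 \<le> (x * om) * exp (- (lam * (pi / 2)))" using x by (simp add: field_simps)
  also have "x * om \<le> x * (2 + 1 / x + 8 * lam * r)" using om_upper x by (intro mult_left_mono) auto
  also have "x * (2 + 1 / x + 8 * lam * r) = 2 * x + 1 + 8 * lam * (x * r)" using x by (simp add: algebra_simps)
  also have "8 * lam * (x * r) \<le> 8 * lam * 4" using lam xr by (intro mult_left_mono) auto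
  finally have "1 \<le> (2 * x + 1 + 8 * lam * 4) * exp (- (lam * (pi / 2)))" by (simp add: mult_right_mono)
  also have "\<dots> \<le> (9 + 32 * lam) * exp (- (lam * (pi / 2)))" using x4 by (intro mult_right_mono) auto
  finally show False using l by simp
qed

text \<open>
  The width equation gives \<open>1 \<le> x * (exp (- 2 * lam * arctan r) + 1 / 10) + 1 / 10\<close>. So \<open>x\<close> is bounded
  below, and if \<open>lam * r \<ge> 5\<close> then \<open>x > 2\<close>, whereas the height equation would give \<open>x \<le> 4 / 3\<close>.
\<close>

lemma uniform_bounds:
  assumes l: "lam \<ge> 4" "(9 + 32 * lam) * exp (- (lam * (pi / 2))) < 1 / 10"
  shows "r < 1" "2 * lam * r < 10" "x \<ge> 2 / 5"
proof -
  show r1: "r < 1" by (rule r_less_1) (use l in auto)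
  define E1 where "E1 = exp (- (lam * (2 * arctan r)))"
  define E2 where "E2 = exp (- (lam * (pi / 2)))"
  have E2: "E2 > 0" "(9 + 32 * lam) * E2 < 1 / 10" using l by (auto simp: E2_def)
  have E1: "E1 > 0" "E1 \<le> 1" using lam r by (auto simp: E1_def)
  have "1 / x \<le> E1 + om * E2"
  proof (cases "om \<le> 1")
    case True
    have "1 / x \<le> integral {0..om} (\<lambda>_. E1)"
      unfolding width_eq[symmetric] E1_def
      by (rule integral_le[OF width_integrable integrable_const_ivl]) (use lam pi_minus_subtend in \<open>auto intro!: mult_left_mono\<close>)
    also have "\<dots> = om * E1" using om by simp
    also have "\<dots> \<le> 1 * E1" using True E1 by (intro mult_right_mono) auto
    finally show ?thesis using om E2 by (smt (verit) mult_pos_pos)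
  next
    case False
    have "1 / x = integral {0..1} (\<lambda>u. exp (- (lam * (pi - subtend r 1 u)))) + integral {1..om} (\<lambda>u. exp (- (lam * (pi - subtend r 1 u))))"
      using Henstock_Kurzweil_Integration.integral_combine[OF _ _ width_integrable, of 0 1 om] False width_eq by simp
    also have "integral {0..1} (\<lambda>u. exp (- (lam * (pi - subtend r 1 u)))) \<le> integral {0..1::real} (\<lambda>_. E1)"
      unfolding E1_def
      by (rule integral_le[OF width_integrable integrable_const_ivl]) (use lam pi_minus_subtend in \<open>auto intro!: mult_left_mono\<close>)
    also have "integral {1..om} (\<lambda>u. exp (- (lam * (pi - subtend r 1 u)))) \<le> integral {1..om} (\<lambda>_. E2)"
      unfolding E2_def
      by (rule integral_le[OF width_integrable integrable_const_ivl]) (use lam half_pi_le in \<open>auto intro!: mult_left_mono\<close>)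
    also have "integral {1..om} (\<lambda>_. E2) = (om - 1) * E2" using False by simp
    also have "\<dots> \<le> om * E2" using E2 by (intro mult_right_mono) auto
    finally show ?thesis by simp
  qed
  then have "1 \<le> x * E1 + (x * om) * E2" using x by (simp add: field_simps)
  also have "x * om \<le> x * (2 + 1 / x + 8 * lam * r)" using om_upper x by (intro mult_left_mono) auto
  also have "x * (2 + 1 / x + 8 * lam * r) = 2 * x + 1 + x * (8 * lam * r)" using x by (simp add: algebra_simps)
  also have "x * (8 * lam * r) \<le> x * (8 * lam * 1)" using lam x r1 by (intro mult_left_mono) auto
  finally have "1 \<le> x * E1 + (2 * x + 1 + x * (8 * lam * 1)) * E2" using E2 by (simp add: mult_right_mono)
  also have "\<dots> = x * E1 + x * ((2 + 8 * lam) * E2) + E2" by (simp add: algebra_simps)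
  also have "x * ((2 + 8 * lam) * E2) \<le> x * (1 / 10)"
  proof (rule mult_left_mono)
    have "(2 + 8 * lam) * E2 \<le> (9 + 32 * lam) * E2" using lam E2 by (intro mult_right_mono) auto
    then show "(2 + 8 * lam) * E2 \<le> 1 / 10" using E2 by linarith
  qed (use x in simp)
  finally have a: "1 \<le> x * E1 + x * (1 / 10) + E2" by simp
  have "1 * E2 \<le> (9 + 32 * lam) * E2" using lam E2 by (intro mult_right_mono) auto
  then have E2': "E2 \<le> 1 / 10" using E2 by linarith
  have "x * E1 \<le> x * 1" using x E1 by (intro mult_left_mono) auto
  then show "x \<ge> 2 / 5" using a E2' by linarith
  show "2 * lam * r < 10"
  proof (rule ccontr)
    assume "\<not> 2 * lam * r < 10"
    then have s: "lam * r \<ge> 5" by simp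
    have "arctan r \<ge> r / 2"
    proof -
      obtain v where v: "0 < v" "v < r" "arctan r - arctan 0 = (r - 0) * inverse (1 + v\<^sup>2)"
        using MVT2[of 0 r arctan "\<lambda>v. inverse (1 + v\<^sup>2)"] r DERIV_arctan by blast
      have "v\<^sup>2 \<le> 1" using v r1 by (simp add: power_le_one)
      then have "1 / 2 \<le> inverse (1 + v\<^sup>2)" by (simp add: inverse_eq_divide divide_left_mono add_pos_nonneg)
      then have "r * (1 / 2) \<le> r * inverse (1 + v\<^sup>2)" using r by (intro mult_left_mono) auto
      then show ?thesis using v by simp
    qed
    then have "lam * r \<le> lam * (2 * arctan r)" using lam by (intro mult_left_mono) auto
    then have "E1 \<le> exp (- 5)" using s by (simp add: E1_def)
    then have "E1 \<le> 1 / 10" using exp_minus_5_le by linarith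
    then have "x * E1 \<le> x * (1 / 10)" using x by (intro mult_left_mono) auto
    then have x4: "x > 2" using a E2' by linarith
    have "(1 - 0) * (1 - exp (- 2)) \<le> 1 / x"
    proof (rule height_bound)
      fix u :: real assume u: "0 \<le> u" "u \<le> 1"
      obtain v where v: "u - r < v" "v < u + r" "subtend 1 r u = 2 * r * (1 / (1 + v\<^sup>2))"
        using subtend_mvt[OF zero_less_one r, of u] by auto
      have "\<bar>v\<bar> \<le> 2" using v u r1 by auto
      then have "v\<^sup>2 \<le> 2\<^sup>2" by (metis abs_le_square_iff abs_numeral)
      then have "1 / 5 \<le> 1 / (1 + v\<^sup>2)" by (intro divide_left_mono) (auto simp: add_pos_nonneg)
      then have "2 * r * (1 / 5) \<le> subtend 1 r u" unfolding v(3) using r by (intro mult_left_mono) auto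
      then have "lam * (2 * r * (1 / 5)) \<le> lam * subtend 1 r u" using lam by (intro mult_left_mono) auto
      moreover have "lam * (2 * r * (1 / 5)) = 2 / 5 * (lam * r)" by simp
      ultimately show "2 \<le> lam * subtend 1 r u" using s by linarith
    qed auto
    then have "3 / 4 \<le> 1 / x" using exp_minus_2_le by simp
    then have "x \<le> 4 / 3" using x by (simp add: field_simps)
    then show False using x4 by simp
  qed
qed

text \<open>
  If \<open>om < 1 - d\<close>, the tail integral \<open>om - 1 / x\<close> would contain an interval of length \<open>d / 2\<close> to the left
  of 1 on which \<open>subtend r 1 u\<close> is at least \<open>\<pi> / 2\<close>, and would be exponentially large.
\<close>

lemma om_ge:
  assumes d: "0 < d" "d < 1" and rd: "r \<le> d / 2" and l: "1 < (d / 2) * (exp (lam * (pi / 2)) - 1)"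
  shows "om \<ge> 1 - d"
proof (rule ccontr)
  assume "\<not> om \<ge> 1 - d"
  then have o: "om < 1 - d" by simp
  have "(d / 2) * (exp (lam * (pi / 2)) - 1) = integral {1 - d..1 - d / 2} (\<lambda>_. exp (lam * (pi / 2)) - 1)"
    using d by simp
  also have "\<dots> \<le> integral {1 - d..1 - d / 2} excess"
  proof (rule integral_le[OF integrable_const_ivl excess_int])
    fix u assume "u \<in> {1 - d..1 - d / 2}"
    then have u: "0 \<le> u" "u \<le> 1 - d / 2" using d by auto
    have "1 \<le> (u + 1) / r" using u d rd r by (simp add: le_divide_eq)
    then have "arctan ((u + 1) / r) \<ge> pi / 4" using arctan_monotone'[of 1] by (simp only: arctan_one)
    moreover have "(u - 1) / r \<le> - 1" using u rd r by (simp add: divide_le_eq)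
    then have "arctan ((u - 1) / r) \<le> arctan (- 1)" by (rule arctan_monotone')
    then have "arctan ((u - 1) / r) \<le> - (pi / 4)" by (simp only: arctan_minus arctan_one)
    ultimately have "subtend r 1 u \<ge> pi / 2" by (simp add: subtend_def)
    then show "exp (lam * (pi / 2)) - 1 \<le> excess u" using lam by (simp add: excess_def mult_left_mono)
  qed
  also have "\<dots> \<le> om - 1 / x" by (rule excess_tail_le) (use o d in auto)
  also have "\<dots> < 1"
  proof -
    have "1 / x > 0" using x by simp
    then show ?thesis using o d by linarith
  qed
  finally show False using l by simp
qed

end

section \<open>Passage to the limit\<close>

lemma difference_quotient_seq:
  fixes f :: "real \<Rightarrow> real"
  assumes "(f has_real_derivative D) (at u)" "\<rho> \<longlonglongrightarrow> 0" "\<And>n. \<rho> n \<noteq> 0"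
    "(\<lambda>n. lam n * \<rho> n) \<longlonglongrightarrow> c"
  shows "(\<lambda>n. lam n * (f (u + \<rho> n) - f u)) \<longlonglongrightarrow> c * D"
proof -
  have "filterlim \<rho> (at 0) sequentially" using assms(2,3) by (simp add: filterlim_at)
  with assms(1) have "(\<lambda>n. (f (u + \<rho> n) - f u) / \<rho> n) \<longlonglongrightarrow> D"
    unfolding DERIV_def by (rule filterlim_compose)
  from tendsto_mult[OF assms(4) this] show ?thesis
    using assms(3) by simp
qed

text \<open>
  Dominated convergence in both equations. For small \<open>r\<close> the exponents are difference quotients of the
  arctangent: \<open>lam * subtend 1 r u\<close> tends to \<open>s / (1 + u\<^sup>2)\<close>, and
  \<open>lam * (\<pi> - subtend r 1 u) = lam * arctan (r / (1 + u)) + lam * arctan (r / (1 - u))\<close> tends to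
  \<open>s / (1 - u\<^sup>2)\<close>.
\<close>

theorem shape_data_limits_along_convergent:
  fixes lam x r om :: "nat \<Rightarrow> real"
  assumes D: "\<And>n. shape_data (lam n) (x n) (r n) (om n)"
    and l: "filterlim lam at_top sequentially"
    and b: "\<And>n. r n < 1" "\<And>n. 2 * lam n * r n < 10" "\<And>n. x n \<ge> 2 / 5"
    and s: "(\<lambda>n. 2 * lam n * r n) \<longlonglongrightarrow> s"
  shows "(\<lambda>n. 1 / x n) \<longlonglongrightarrow> Wint s" "(\<lambda>n. (1 - exp (- (pi * lam n))) / x n) \<longlonglongrightarrow> Hint s"
proof -
  have pos: "lam n > 0" "x n > 0" "r n > 0" "om n > 0" for n
    using D[of n] by (auto simp: shape_data_def)
  have r0: "r \<longlonglongrightarrow> 0"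
  proof (rule tendsto_sandwich[of "\<lambda>_. 0" _ _ "\<lambda>n. 5 / lam n"])
    show "\<forall>\<^sub>F n in sequentially. r n \<le> 5 / lam n"
      using b(2) pos(1) by (intro always_eventually allI) (simp add: field_simps less_imp_le)
    show "(\<lambda>n. 5 / lam n) \<longlonglongrightarrow> 0"
      by (intro tendsto_divide_0[OF tendsto_const] filterlim_at_top_imp_at_infinity l)
  qed (use pos(3) in \<open>auto intro!: always_eventually less_imp_le\<close>)
  have lr: "(\<lambda>n. lam n * r n) \<longlonglongrightarrow> s / 2"
    using tendsto_divide[OF s tendsto_const[of 2]] by simp
  have s0: "s \<ge> 0"
    using pos by (intro LIMSEQ_le_const[OF s]) (auto intro!: exI[of _ 0] less_imp_le mult_pos_pos)
  have "(\<lambda>n. integral {0..} (\<lambda>u. 1 - exp (- (lam n * subtend 1 (r n) u)))) \<longlonglongrightarrow> Hint s"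
    unfolding Hint_def
  proof (rule dominated_convergence(2)[where h = "\<lambda>u::real. 30 * (1 / (1 + u\<^sup>2))"])
    show "(\<lambda>u. 1 - exp (- (lam n * subtend 1 (r n) u))) integrable_on {0..}" for n
      using shape_data.h_has_integral[OF D[of n]] by blast
    show "(\<lambda>u::real. 30 * (1 / (1 + u\<^sup>2))) integrable_on {0..}"
      by (rule integrable_on_mult_right) (use inverse_1_plus_square_has_integral in blast)
    fix u :: real
    have p: "1 + u\<^sup>2 > 0" by (simp add: add_pos_nonneg)
    \<comment> \<open>The mean value point \<open>v\<close> has distance at most 1 from \<open>u\<close>, whence \<open>1 + u\<^sup>2 \<le> 3 * (1 + v\<^sup>2)\<close>; and \<open>2 * lam n * r n < 10\<close>.\<close>
    show "norm (1 - exp (- (lam n * subtend 1 (r n) u))) \<le> 30 * (1 / (1 + u\<^sup>2))" for n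
    proof -
      obtain v where v: "u - r n < v" "v < u + r n" "subtend 1 (r n) u = 2 * r n * (1 / (1 + v\<^sup>2))"
        using subtend_mvt[OF zero_less_one pos(3)[of n], of u] by auto
      have "\<bar>u - v\<bar> \<le> 1" using v b(1)[of n] by auto
      then have "(u - v)\<^sup>2 \<le> 1" by (simp add: abs_square_le_1)
      moreover have "u\<^sup>2 \<le> 2 * v\<^sup>2 + 2 * (u - v)\<^sup>2"
        using zero_le_power2[of "u - 2 * v"] by (simp add: power2_eq_square algebra_simps)
      moreover have "1 + a \<le> 3 * (1 + b)" if "q \<le> 1" "a \<le> 2 * b + 2 * q" "0 \<le> b" for a b q :: real
        using that by simp
      ultimately have "1 + u\<^sup>2 \<le> 3 * (1 + v\<^sup>2)" using zero_le_power2[of v] by blast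
      moreover have "1 + v\<^sup>2 > 0" by (simp add: add_pos_nonneg)
      ultimately have "1 / (1 + v\<^sup>2) \<le> 3 * (1 / (1 + u\<^sup>2))" using p by (simp add: field_simps)
      then have "(2 * lam n * r n) * (1 / (1 + v\<^sup>2)) \<le> 10 * (3 * (1 / (1 + u\<^sup>2)))"
        using b(2)[of n] pos[of n] p by (intro mult_mono) (auto simp: add_nonneg_nonneg)
      then have "lam n * subtend 1 (r n) u \<le> 30 * (1 / (1 + u\<^sup>2))" using v by (simp add: mult_ac)
      moreover have "0 \<le> lam n * subtend 1 (r n) u"
        using pos[of n] subtend_pos[OF zero_less_one pos(3)[of n], of u] by simp
      ultimately show ?thesis using one_minus_exp_bounds[of "lam n * subtend 1 (r n) u"] by simp
    qed
    have a1: "(\<lambda>n. lam n * (arctan (u + r n) - arctan u)) \<longlonglongrightarrow> s / 2 * inverse (1 + u\<^sup>2)"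
      by (rule difference_quotient_seq[OF DERIV_arctan r0 _ lr]) (use pos in \<open>simp add: less_imp_neq[symmetric]\<close>)
    have a2: "(\<lambda>n. lam n * (arctan (u + - r n) - arctan u)) \<longlonglongrightarrow> - (s / 2) * inverse (1 + u\<^sup>2)"
      by (rule difference_quotient_seq[OF DERIV_arctan])
        (use pos tendsto_minus[OF r0] tendsto_minus[OF lr] in \<open>auto simp: less_imp_neq[symmetric]\<close>)
    have "(\<lambda>n. lam n * subtend 1 (r n) u) \<longlonglongrightarrow> s / (1 + u\<^sup>2)"
    proof -
      have "s / 2 * q - - (s / 2) * q = s * q" for q by simp
      then have e: "s / 2 * inverse (1 + u\<^sup>2) - - (s / 2) * inverse (1 + u\<^sup>2) = s / (1 + u\<^sup>2)"
        by (simp only: divide_inverse)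
      have "(\<lambda>n. lam n * (arctan (u + r n) - arctan u) - lam n * (arctan (u + - r n) - arctan u)) \<longlonglongrightarrow> s / (1 + u\<^sup>2)"
        using tendsto_diff[OF a1 a2] unfolding e .
      then show ?thesis by (simp add: subtend_def right_diff_distrib)
    qed
    then show "(\<lambda>n. 1 - exp (- (lam n * subtend 1 (r n) u))) \<longlonglongrightarrow> 1 - exp (- s / (1 + u\<^sup>2))"
      by (auto intro!: tendsto_intros tendsto_minus simp flip: minus_divide_left)
  qed
  then show "(\<lambda>n. (1 - exp (- (pi * lam n))) / x n) \<longlonglongrightarrow> Hint s"
    using integral_unique[OF shape_data.h_has_integral[OF D]] by simp
  define g where "g n u = exp (- (lam n * (pi - subtend (r n) 1 u)))" for n u
  have g_int: "g n integrable_on {a..b}" for n a b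
    unfolding g_def by (rule shape_data.width_integrable[OF D])
  have ge: "\<forall>\<^sub>F n in sequentially. om n \<ge> 1 - d" if d: "0 < d" "d < 1" for d
  proof -
    have "\<forall>\<^sub>F n in sequentially. r n < d / 2" using d by (intro order_tendstoD(2)[OF r0]) auto
    moreover have "filterlim (\<lambda>t. (d / 2) * (exp (t * (pi / 2)) - 1)) at_top at_top"
      using d pi_gt_zero by real_asymp
    then have "filterlim (\<lambda>n. (d / 2) * (exp (lam n * (pi / 2)) - 1)) at_top sequentially"
      using l by (rule filterlim_compose)
    then have "\<forall>\<^sub>F n in sequentially. (d / 2) * (exp (lam n * (pi / 2)) - 1) > 1"
      unfolding filterlim_at_top_dense by blast
    ultimately show ?thesis
      by eventually_elim (use shape_data.om_ge[OF D d] in auto)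
  qed
  have main: "(\<lambda>n. integral {0..<1} (\<lambda>u. if u \<in> {0..om n} then g n u else 0)) \<longlonglongrightarrow> Wint s"
    unfolding Wint_def integral_half_open
  proof (rule dominated_convergence(2)[where h = "\<lambda>_. 1"])
    show "(\<lambda>u. if u \<in> {0..om n} then g n u else 0) integrable_on {0..<1}" for n
    proof (rule integrable_spike_set)
      show "(\<lambda>u. if u \<in> {0..om n} then g n u else 0) integrable_on {0..1}"
        unfolding integrable_restrict_Int Int_atLeastAtMost by (rule g_int)
    qed (auto intro: negligible_subset[of "{1::real}"])
    have "(\<lambda>_. 1::real) integrable_on {0..1::real}" by (rule integrable_const_ivl)
    then show "(\<lambda>_. 1::real) integrable_on {0..<1::real}"
      by (rule integrable_spike_set) (auto intro: negligible_subset[of "{1::real}"])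
    fix u :: real assume u: "u \<in> {0..<1}"
    show "norm (if u \<in> {0..om n} then g n u else 0) \<le> 1" for n
    proof -
      have "pi - subtend (r n) 1 u \<ge> 2 * arctan (r n)"
        by (rule shape_data.pi_minus_subtend[OF D]) (use u in simp)
      moreover have "arctan (r n) > 0" using pos(3) by (simp add: zero_less_arctan_iff)
      ultimately have "pi - subtend (r n) 1 u \<ge> 0" by linarith
      then have "lam n * (pi - subtend (r n) 1 u) \<ge> 0" using pos(1)[of n] by (intro mult_nonneg_nonneg) auto
      then show ?thesis by (simp add: g_def)
    qed
    have "(\<lambda>n. lam n * (arctan ((0 + r n) / a) - arctan (0 / a))) \<longlonglongrightarrow> s / 2 * (1 / a)" if a: "a > 0" for a
    proof (rule difference_quotient_seq[where f = "\<lambda>t. arctan (t / a)", OF _ r0 _ lr])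
      show "((\<lambda>t. arctan (t / a)) has_real_derivative 1 / a) (at 0)"
        using a by (auto intro!: derivative_eq_intros)
      show "r n \<noteq> 0" for n using pos(3)[of n] by simp
    qed
    from this[of "1 + u"] this[of "1 - u"] u
    have "(\<lambda>n. lam n * arctan (r n / (1 + u)) + lam n * arctan (r n / (1 - u))) \<longlonglongrightarrow> s / 2 * (1 / (1 + u)) + s / 2 * (1 / (1 - u))"
      by (intro tendsto_add) auto
    moreover have "s / 2 * (1 / (1 + u)) + s / 2 * (1 / (1 - u)) = s / (1 - u\<^sup>2)"
    proof -
      have gen: "s / 2 * (1 / A) + s / 2 * (1 / B) = s / (A * B)" if "A \<noteq> 0" "B \<noteq> 0" "A + B = 2" for A B :: real
      proof -
        have "1 / A + 1 / B = (A + B) / (A * B)" using that(1,2) by (simp add: field_simps)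
        then have "s / 2 * (1 / A) + s / 2 * (1 / B) = s / 2 * (2 / (A * B))"
          unfolding that(3) by (simp only: distrib_left[symmetric])
        then show ?thesis by simp
      qed
      have "1 - u\<^sup>2 = (1 + u) * (1 - u)" by (simp add: power2_eq_square algebra_simps)
      then show ?thesis using u by (simp only:) (rule gen, auto)
    qed
    moreover have "lam n * arctan (r n / (1 + u)) + lam n * arctan (r n / (1 - u)) = lam n * (pi - subtend (r n) 1 u)" for n
    proof -
      have i1: "arctan ((u + 1) / r n) = pi / 2 - arctan (r n / (1 + u))"
        using arctan_inverse[of "r n / (1 + u)"] u pos(3)[of n] by (simp add: sgn_divide add.commute inverse_eq_divide)
      have i2: "arctan ((1 - u) / r n) = pi / 2 - arctan (r n / (1 - u))"
        using arctan_inverse[of "r n / (1 - u)"] u pos(3)[of n] by (simp add: sgn_divide inverse_eq_divide)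
      have "(u - 1) / r n = - ((1 - u) / r n)" by (simp add: minus_divide_left)
      then have "arctan ((u - 1) / r n) = - arctan ((1 - u) / r n)" by (simp only: arctan_minus)
      then have "pi - subtend (r n) 1 u = arctan (r n / (1 + u)) + arctan (r n / (1 - u))"
        using i1 i2 by (simp add: subtend_def)
      then show ?thesis by (simp add: distrib_left)
    qed
    ultimately have "(\<lambda>n. lam n * (pi - subtend (r n) 1 u)) \<longlonglongrightarrow> s / (1 - u\<^sup>2)" by simp
    then have "(\<lambda>n. g n u) \<longlonglongrightarrow> exp (- s / (1 - u\<^sup>2))"
      unfolding g_def by (auto intro!: tendsto_intros tendsto_minus simp flip: minus_divide_left)
    then show "(\<lambda>n. if u \<in> {0..om n} then g n u else 0) \<longlonglongrightarrow> exp (- s / (1 - u\<^sup>2))"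
    proof (rule Lim_transform_eventually)
      have "\<forall>\<^sub>F n in sequentially. om n \<ge> 1 - (1 - u) / 2" by (rule ge) (use u in auto)
      then show "\<forall>\<^sub>F n in sequentially. g n u = (if u \<in> {0..om n} then g n u else 0)"
        by eventually_elim (use u in \<open>auto simp: field_simps\<close>)
    qed
  qed
  have err: "(\<lambda>n. 1 / x n - integral {0..<1} (\<lambda>u. if u \<in> {0..om n} then g n u else 0)) \<longlonglongrightarrow> 0"
  proof (rule Lim_null_comparison)
    have "((\<lambda>t. 50 * exp (- (t * (pi / 2)))) \<longlongrightarrow> 0) at_top" using pi_gt_zero by real_asymp
    then show "(\<lambda>n. 50 * exp (- (lam n * (pi / 2)))) \<longlonglongrightarrow> 0" using l by (rule filterlim_compose)
    show "\<forall>\<^sub>F n in sequentially. norm (1 / x n - integral {0..<1} (\<lambda>u. if u \<in> {0..om n} then g n u else 0)) \<le> 50 * exp (- (lam n * (pi / 2)))"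
    proof (rule always_eventually, rule allI)
      fix n
      have e1: "integral {0..<1} (\<lambda>u. if u \<in> {0..om n} then g n u else 0) = integral {0..min 1 (om n)} (g n)"
        by (subst integral_half_open[symmetric], subst integral_restrict_Int) (simp add: Int_atLeastAtMost min.commute)
      have e2: "1 / x n = integral {0..om n} (g n)"
        unfolding g_def using shape_data.width_eq[OF D] by simp
      show "norm (1 / x n - integral {0..<1} (\<lambda>u. if u \<in> {0..om n} then g n u else 0)) \<le> 50 * exp (- (lam n * (pi / 2)))"
      proof (cases "om n \<le> 1")
        case True
        then show ?thesis unfolding e1 e2 by (simp add: min_absorb2)
      next
        case False
        then have d: "1 / x n - integral {0..<1} (\<lambda>u. if u \<in> {0..om n} then g n u else 0) = integral {1..om n} (g n)"
          using Henstock_Kurzweil_Integration.integral_combine[OF _ _ g_int[of n], of 0 1 "om n"]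
          unfolding e1 e2 by (simp add: min_absorb1)
        have "integral {1..om n} (g n) \<le> integral {1..om n} (\<lambda>_. exp (- (lam n * (pi / 2))))"
          unfolding g_def
          by (rule integral_le[OF shape_data.width_integrable[OF D] integrable_const_ivl])
            (use pos(1) shape_data.half_pi_le[OF D] in \<open>auto intro!: mult_left_mono less_imp_le\<close>)
        also have "\<dots> = (om n - 1) * exp (- (lam n * (pi / 2)))" using False by simp
        also have "\<dots> \<le> 50 * exp (- (lam n * (pi / 2)))"
        proof (rule mult_right_mono)
          \<comment> \<open>By \<open>om_upper\<close>, \<open>om n\<close> is at most \<open>2 + 5 / 2 + 40\<close>.\<close>
          have "1 / x n \<le> 5 / 2" using b(3)[of n] pos(2)[of n] by (simp add: field_simps)
          then show "om n - 1 \<le> 50" using shape_data.om_upper[OF D, of n] b(2)[of n] by simp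
        qed simp
        finally have "integral {1..om n} (g n) \<le> 50 * exp (- (lam n * (pi / 2)))" .
        moreover have "integral {1..om n} (g n) \<ge> 0"
          by (rule Henstock_Kurzweil_Integration.integral_nonneg[OF g_int]) (simp add: g_def)
        ultimately show ?thesis unfolding d by simp
      qed
    qed
  qed
  from tendsto_add[OF main err] show "(\<lambda>n. 1 / x n) \<longlonglongrightarrow> Wint s" by simp
qed

text \<open>
  Any limit \<open>t\<close> of \<open>2 * lam * r\<close> along a sequence satisfies \<open>Wint t = Hint t\<close>, hence is \<open>\<sigma>\<close>. The values
  stay in a compact interval, so they converge.
\<close>

theorem shape_data_limits:
  fixes lam x r om :: "real \<Rightarrow> real"
  assumes D: "\<And>K. K > 1 \<Longrightarrow> shape_data (lam K) (x K) (r K) (om K)"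
    and l: "filterlim lam at_top at_top"
    and \<sigma>: "\<sigma> > 0" "Wint \<sigma> = Hint \<sigma>"
  shows "((\<lambda>K. 2 * lam K * r K) \<longlongrightarrow> \<sigma>) at_top" "(x \<longlongrightarrow> 1 / Wint \<sigma>) at_top"
proof -
  have "\<forall>\<^sub>F t :: real in at_top. (9 + 32 * t) * exp (- (t * (pi / 2))) < 1 / 10"
  proof -
    have "((\<lambda>t. (9 + 32 * t) * exp (- (t * (pi / 2)))) \<longlongrightarrow> 0) at_top" using pi_gt_zero by real_asymp
    then show ?thesis by (rule order_tendstoD(2)) simp
  qed
  then have ev: "\<forall>\<^sub>F K in at_top. (9 + 32 * lam K) * exp (- (lam K * (pi / 2))) < 1 / 10"
    using l by (rule eventually_compose_filterlim)
  have "\<forall>\<^sub>F K in at_top. lam K \<ge> 4" using l by (simp add: filterlim_at_top)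
  with ev eventually_gt_at_top[of 1]
  have "\<forall>\<^sub>F K in at_top. K > 1 \<and> r K < 1 \<and> 2 * lam K * r K < 10 \<and> x K \<ge> 2 / 5"
    by eventually_elim (use shape_data.uniform_bounds[OF D] in auto)
  then obtain K0 where K0: "\<And>K. K \<ge> K0 \<Longrightarrow> K > 1 \<and> r K < 1 \<and> 2 * lam K * r K < 10 \<and> x K \<ge> 2 / 5"
    by (auto simp: eventually_at_top_linorder)
  have uniq: "t = \<sigma>" if "t \<ge> 0" "Wint t = Hint t" for t
  proof -
    have "t \<noteq> 0" using that by (auto simp: Wint_0 Hint_0)
    then show ?thesis using that \<sigma> Wint_eq_Hint_ex1 by (metis order_le_less)
  qed
  have Ipos: "Wint \<sigma> > 0" using \<sigma>(1) by (intro Wint_pos) simp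
  have lims: "(\<lambda>n. 1 / x (k n)) \<longlonglongrightarrow> Wint t" "t = \<sigma>"
    if k: "filterlim k at_top sequentially" "\<And>n. k n \<ge> K0" and t: "(\<lambda>n. 2 * lam (k n) * r (k n)) \<longlonglongrightarrow> t" for k t
  proof -
    have lk: "filterlim (\<lambda>n. lam (k n)) at_top sequentially" using l k(1) by (rule filterlim_compose)
    note A = shape_data_limits_along_convergent[of "\<lambda>n. lam (k n)" "\<lambda>n. x (k n)" "\<lambda>n. r (k n)" "\<lambda>n. om (k n)", OF _ lk _ _ _ t]
    show I: "(\<lambda>n. 1 / x (k n)) \<longlonglongrightarrow> Wint t" by (rule A(1)) (use K0[OF k(2)] D in auto)
    have J: "(\<lambda>n. (1 - exp (- (pi * lam (k n)))) / x (k n)) \<longlonglongrightarrow> Hint t" by (rule A(2)) (use K0[OF k(2)] D in auto)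
    have "((\<lambda>t. 1 - exp (- (pi * t))) \<longlongrightarrow> 1) at_top" using pi_gt_zero by real_asymp
    then have "(\<lambda>n. 1 - exp (- (pi * lam (k n)))) \<longlonglongrightarrow> 1" using lk by (rule filterlim_compose)
    from tendsto_mult[OF this I] have "(\<lambda>n. (1 - exp (- (pi * lam (k n)))) / x (k n)) \<longlonglongrightarrow> Wint t" by simp
    then have "Wint t = Hint t" using J by (rule LIMSEQ_unique)
    moreover have "t \<ge> 0"
    proof (rule LIMSEQ_le_const[OF t])
      have "0 \<le> 2 * lam (k n) * r (k n)" for n
        using D[of "k n"] K0[OF k(2)[of n]] by (auto simp: shape_data_def)
      then show "\<exists>N. \<forall>n\<ge>N. 0 \<le> 2 * lam (k n) * r (k n)" by blast
    qed
    ultimately show "t = \<sigma>" by (rule uniq[rotated])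
  qed
  have seq: "(\<lambda>n. 2 * lam (k n) * r (k n)) \<longlonglongrightarrow> \<sigma>"
    if k: "filterlim k at_top sequentially" "\<And>n. k n \<ge> K0" for k
  proof (rule ccontr)
    define f where "f n = 2 * lam (k n) * r (k n)" for n
    assume "\<not> (\<lambda>n. 2 * lam (k n) * r (k n)) \<longlonglongrightarrow> \<sigma>"
    then have "\<not> f \<longlonglongrightarrow> \<sigma>" by (simp add: f_def[abs_def])
    then obtain \<epsilon> where e: "\<epsilon> > 0" "\<not> (\<forall>\<^sub>F n in sequentially. dist (f n) \<sigma> < \<epsilon>)"
      by (auto simp: tendsto_iff)
    define B where "B = {n. \<not> dist (f n) \<sigma> < \<epsilon>}"
    have "infinite B"
      using e(2) unfolding B_def infinite_nat_iff_unbounded_le eventually_sequentially by auto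
    define q where "q = enumerate B"
    have q: "strict_mono q" "\<And>n. q n \<in> B"
      using \<open>infinite B\<close> by (simp_all add: q_def strict_mono_enumerate enumerate_in_set)
    have in10: "f n \<in> {0..10}" for n
      using K0[OF k(2)[of n]] D[of "k n"] by (auto simp: f_def shape_data_def)
    have "seq_compact {0..10::real}" using compact_imp_seq_compact compact_Icc by blast
    moreover have "\<forall>n. (f \<circ> q) n \<in> {0..10}" using in10 by simp
    ultimately obtain t p where t: "strict_mono (p :: nat \<Rightarrow> nat)" "((f \<circ> q) \<circ> p) \<longlonglongrightarrow> t"
      by (rule seq_compactE)
    have "filterlim (\<lambda>n. q (p n)) at_top sequentially"
      using filterlim_subseq[OF strict_mono_o[OF q(1) t(1)]] by (simp add: o_def)
    then have "filterlim (\<lambda>n. k (q (p n))) at_top sequentially" by (rule filterlim_compose[OF k(1)])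
    then have "t = \<sigma>"
      by (rule lims(2)) (use k(2) t(2) in \<open>auto simp: f_def o_def\<close>)
    then have "\<forall>\<^sub>F n in sequentially. dist (((f \<circ> q) \<circ> p) n) \<sigma> < \<epsilon>"
      using t(2) e(1) by (auto dest: tendstoD)
    then obtain n where "dist (f (q (p n))) \<sigma> < \<epsilon>" by (auto simp: eventually_sequentially)
    then show False using q(2)[of "p n"] by (simp add: B_def)
  qed
  have shift: "(g \<longlongrightarrow> L) at_top" if "\<And>k. filterlim k at_top sequentially \<Longrightarrow> (\<And>n. k n \<ge> K0) \<Longrightarrow> (\<lambda>n. g (k n)) \<longlonglongrightarrow> L"
    for g :: "real \<Rightarrow> real" and L
  proof (rule tendsto_at_topI_sequentially)
    fix X :: "nat \<Rightarrow> real" assume X: "filterlim X at_top sequentially"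
    have ev: "\<forall>\<^sub>F n in sequentially. X n \<ge> K0" using X by (simp add: filterlim_at_top)
    have "filterlim (\<lambda>n. max K0 (X n)) at_top sequentially"
      by (rule filterlim_at_top_mono[OF X]) simp
    then have "(\<lambda>n. g (max K0 (X n))) \<longlonglongrightarrow> L" by (rule that) simp
    then show "(\<lambda>n. g (X n)) \<longlonglongrightarrow> L"
      by (rule Lim_transform_eventually) (use ev in \<open>auto elim!: eventually_mono simp: max_absorb2\<close>)
  qed
  show "((\<lambda>K. 2 * lam K * r K) \<longlongrightarrow> \<sigma>) at_top" by (rule shift[OF seq])
  show "(x \<longlongrightarrow> 1 / Wint \<sigma>) at_top"
  proof (rule shift)
    fix k :: "nat \<Rightarrow> real" assume k: "filterlim k at_top sequentially" "\<And>n. k n \<ge> K0"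
    have "(\<lambda>n. 1 / (1 / x (k n))) \<longlonglongrightarrow> 1 / Wint \<sigma>"
      using Ipos by (intro tendsto_divide tendsto_const lims(1)[OF k seq[OF k]]) auto
    then show "(\<lambda>n. x (k n)) \<longlonglongrightarrow> 1 / Wint \<sigma>" by simp
  qed
qed

lemma integral_rescale:
  fixes f :: "real \<Rightarrow> real"
  assumes "c > 0" "0 \<le> T" "continuous_on UNIV f"
  shows "integral {0..c * T} f = c * integral {0..T} (\<lambda>u. f (c * u))"
proof -
  have "((\<lambda>u. c *\<^sub>R f (c * u)) has_integral (integral {c * 0..c * T} f)) {0..T}"
  proof (rule has_integral_substitution[where c = 0 and d = "c * T"])
    show "continuous_on {0..c * T} f" using assms(3) continuous_on_subset by blast
    show "((*) c has_real_derivative c) (at u within {0..T})" for u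
      by (auto intro!: derivative_eq_intros)
  qed (use assms in auto)
  from integral_unique[OF this] show ?thesis by simp
qed

lemma integral_rescale_limit:
  fixes f :: "real \<Rightarrow> real"
  assumes c: "c > 0" and f: "continuous_on UNIV f"
    and l: "((\<lambda>T. integral {0..T} f) \<longlongrightarrow> L) at_top"
  shows "((\<lambda>T. integral {0..T} (\<lambda>u. f (c * u))) \<longlongrightarrow> L / c) at_top"
proof -
  have "filterlim (\<lambda>T. c * T) at_top at_top" using c by real_asymp
  from filterlim_compose[OF l this]
  have "((\<lambda>T. integral {0..c * T} f / c) \<longlongrightarrow> L / c) at_top"
    using c by (intro tendsto_divide tendsto_const) auto
  then show ?thesis
    by (rule Lim_transform_eventually)
      (rule eventually_mono[OF eventually_ge_at_top[of 0]], use c integral_rescale[OF c _ f] in simp)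
qed

lemma (in square_solution) shape_data:
  defines "x \<equiv> Re (\<phi> (1 + \<i>))" and "y \<equiv> Im (\<phi> (1 + \<i>))"
  shows "shape_data (ln K / pi) x (y / x) (Re (\<phi> 1) / x)"
proof
  have x: "x > 0" using Re_pos[of "1 + \<i>"] by (simp add: x_def)
  have y: "y > 0" using Im_pos[of "1 + \<i>"] by (simp add: y_def)
  have lnK: "ln K > 0" using K by simp
  show "ln K / pi > 0" using lnK by simp
  show "x > 0" "y / x > 0" "Re (\<phi> 1) / x > 0" using x y Re_pos[of 1] by simp_all
  have sx: "subtend x y (x * u) = subtend 1 (y / x) u" for u
    using x by (simp add: subtend_def add_divide_distrib diff_divide_distrib)
  have sy: "subtend y x (x * u) = subtend (y / x) 1 u" for u
  proof -
    have "(x * u + x) / y = (u + 1) / (y / x)" "(x * u - x) / y = (u - 1) / (y / x)" by (simp_all add: algebra_simps)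
    then show ?thesis by (simp only: subtend_def)
  qed
  have e: "exp (pi * (ln K / pi)) = K" "exp (- (pi * (ln K / pi))) = 1 / K"
    using K by (simp_all add: exp_minus inverse_eq_divide)
  have c1: "continuous_on UNIV (\<lambda>t. exp (- (ln K / pi * subtend x y t)) - 1)"
    by (intro continuous_intros subtend_continuous x)
  have c2: "continuous_on UNIV (\<lambda>t. exp (ln K / pi * subtend y x t))"
    by (intro continuous_intros subtend_continuous y)
  have c3: "continuous_on UNIV (\<lambda>t. exp (ln K / pi * subtend y x t) - 1)"
    by (intro continuous_intros c2)
  from integral_rescale_limit[OF x c1 height_equation[folded x_def y_def]]
  have "((\<lambda>T. integral {0..T} (\<lambda>u. exp (- (ln K / pi * subtend 1 (y / x) u)) - 1)) \<longlongrightarrow> - (1 - 1 / K) / x) at_top"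
    unfolding sx .
  from tendsto_minus[OF this]
  have "((\<lambda>T. integral {0..T} (\<lambda>u. - (exp (- (ln K / pi * subtend 1 (y / x) u)) - 1))) \<longlongrightarrow> (1 - 1 / K) / x) at_top"
    by (simp only: integral_neg minus_divide_left minus_minus)
  then show "((\<lambda>T. integral {0..T} (\<lambda>u. 1 - exp (- (ln K / pi * subtend 1 (y / x) u)))) \<longlongrightarrow> (1 - exp (- (pi * (ln K / pi)))) / x) at_top"
    unfolding e by simp
  have "K = integral {0..x * (Re (\<phi> 1) / x)} (\<lambda>t. exp (ln K / pi * subtend y x t))"
    using width_equations(1) x by (simp add: x_def y_def)
  also have "\<dots> = x * integral {0..Re (\<phi> 1) / x} (\<lambda>u. exp (ln K / pi * subtend (y / x) 1 u))"
    using integral_rescale[OF x _ c2, of "Re (\<phi> 1) / x"] x width_equations(3) unfolding sy by simp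
  finally show "integral {0..Re (\<phi> 1) / x} (\<lambda>u. exp (ln K / pi * subtend (y / x) 1 u)) = exp (pi * (ln K / pi)) / x"
    unfolding e using x by (simp add: field_simps)
  from integral_rescale_limit[OF x c3 width_equations(2)[folded x_def y_def]]
  show "((\<lambda>T. integral {0..T} (\<lambda>u. exp (ln K / pi * subtend (y / x) 1 u) - 1)) \<longlongrightarrow> (exp (pi * (ln K / pi)) - 1) / x) at_top"
    unfolding sy e .
qed

text \<open>
  The four poles are paired as complex conjugates, so that the factor \<open>Im z\<^sub>1\<close> comes out and \<open>\<eta>\<close> has a
  limit although \<open>ln K\<close> does not.
\<close>

lemma (in square_solution) eta_factored:
  defines "z1 \<equiv> \<phi> (1 + \<i>)"
  assumes "z \<noteq> z1" "z \<noteq> Complex.cnj z1" "z \<noteq> - z1" "z \<noteq> - Complex.cnj z1"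
  shows "eta K \<phi> z = of_real (- (ln K / pi * Im z1)) *
     (1 / ((z - z1) * (z - Complex.cnj z1)) - 1 / ((z + z1) * (z + Complex.cnj z1)))"
proof -
  have d: "z1 - Complex.cnj z1 = 2 * \<i> * of_real (Im z1)" by (simp add: complex_eq_iff)
  have n: "z - z1 \<noteq> 0" "z - Complex.cnj z1 \<noteq> 0" "z + z1 \<noteq> 0" "z + Complex.cnj z1 \<noteq> 0"
    using assms by (auto simp: add_eq_0_iff2)
  have "1 / (z - z1) - 1 / (z - Complex.cnj z1) = (z1 - Complex.cnj z1) / ((z - z1) * (z - Complex.cnj z1))"
    using n by (simp add: diff_frac_eq)
  moreover have "1 / (z + z1) - 1 / (z + Complex.cnj z1) = - (z1 - Complex.cnj z1) / ((z + z1) * (z + Complex.cnj z1))"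
    using n by (simp add: diff_frac_eq)
  ultimately have s: "1 / (z - z1) - 1 / (z - - Complex.cnj z1) + 1 / (z - - z1) - 1 / (z - Complex.cnj z1) =
     2 * \<i> * of_real (Im z1) * (1 / ((z - z1) * (z - Complex.cnj z1)) - 1 / ((z + z1) * (z + Complex.cnj z1)))"
    unfolding d by (simp add: algebra_simps)
  have "- (complex_of_real (ln K) / (2 * \<i> * complex_of_real pi)) * (2 * \<i> * of_real (Im z1)) = of_real (- (ln K / pi * Im z1))"
    by simp
  then show ?thesis
    unfolding eta_def corner_images z1_def[symmetric] s by (simp only: mult.assoc[symmetric])
qed

theorem theorem9:
  "(\<exists>!(p :: real \<times> real). fst p > 0 \<and> snd p > 0 \<and>
       W (fst p) (snd p) = 1 \<and> H (fst p) (snd p) = 1) \<and>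
   (\<forall>(x :: real) (\<sigma> :: real) (\<phi> :: real \<Rightarrow> complex \<Rightarrow> complex).
      x > 0 \<longrightarrow> \<sigma> > 0 \<longrightarrow> W x \<sigma> = 1 \<longrightarrow> H x \<sigma> = 1 \<longrightarrow>
      (\<forall>K>1. straightening (beltrami_Sq K) (\<phi> K)) \<longrightarrow>
      ((\<lambda>K. \<phi> K (1 + \<i>)) \<longlongrightarrow> complex_of_real x) at_top \<and>
      (\<lambda>K. Im (\<phi> K (1 + \<i>))) \<sim>[at_top] (\<lambda>K. pi * \<sigma> * x / (2 * ln K)) \<and>
      (\<forall>z. z \<notin> {- complex_of_real x, complex_of_real x} \<longrightarrow>
         ((\<lambda>K. eta K (\<phi> K) z) \<longlongrightarrow>
            complex_of_real (\<sigma> * x / 2) *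
              (- 1 / (z - complex_of_real x)\<^sup>2 + 1 / (z + complex_of_real x)\<^sup>2)) at_top))"
proof (intro conjI allI impI)
  show "\<exists>!(p :: real \<times> real). fst p > 0 \<and> snd p > 0 \<and>
       W (fst p) (snd p) = 1 \<and> H (fst p) (snd p) = 1"
    by (rule WH_ex1)
next
  fix x \<sigma> :: real and \<phi> :: "real \<Rightarrow> complex \<Rightarrow> complex"
  assume x: "x > 0" and \<sigma>: "\<sigma> > 0" and WH: "W x \<sigma> = 1" "H x \<sigma> = 1"
    and s: "\<forall>K>1. straightening (beltrami_Sq K) (\<phi> K)"
  define a b where "a K = Re (\<phi> K (1 + \<i>))" and "b K = Im (\<phi> K (1 + \<i>))" for K
  have sol: "square_solution K (\<phi> K)" if "K > 1" for K
    using straightening_imp_square_solution s that by blast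
  have D: "shape_data (ln K / pi) (a K) (b K / a K) (Re (\<phi> K 1) / a K)" if "K > 1" for K
    unfolding a_def b_def by (rule square_solution.shape_data[OF sol[OF that]])
  have l: "filterlim (\<lambda>K. ln K / pi) at_top at_top"
    using pi_gt_zero by real_asymp
  have xI1: "x * Wint \<sigma> = 1" "x * Hint \<sigma> = 1" using WH by (simp_all add: W_eq H_eq)
  then have "x * Wint \<sigma> = x * Hint \<sigma>" by simp
  then have IJ: "Wint \<sigma> = Hint \<sigma>" using x by simp
  have "Wint \<sigma> \<noteq> 0" using xI1(1) by auto
  then have xI: "1 / Wint \<sigma> = x" using xI1(1) by (simp add: field_simps)
  note lim = shape_data_limits[of "\<lambda>K. ln K / pi" a "\<lambda>K. b K / a K" "\<lambda>K. Re (\<phi> K 1) / a K", OF D l \<sigma> IJ, unfolded xI]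
  have apos: "a K > 0" if "K > 1" for K
    using D[OF that] by (simp add: shape_data_def)
  have ev: "\<forall>\<^sub>F K in at_top. (K::real) > 1" by (rule eventually_gt_at_top)
  have key: "((\<lambda>K. ln K / pi * b K) \<longlongrightarrow> \<sigma> * x / 2) at_top"
  proof -
    have "((\<lambda>K. 2 * (ln K / pi) * (b K / a K) * a K / 2) \<longlongrightarrow> \<sigma> * x / 2) at_top"
      by (intro tendsto_intros lim) simp_all
    then show ?thesis
      by (rule Lim_transform_eventually) (rule eventually_mono[OF ev], use apos in \<open>force simp: field_simps\<close>)
  qed
  have b0: "(b \<longlongrightarrow> 0) at_top"
  proof -
    have "((\<lambda>K. ln K / pi * b K / (ln K / pi)) \<longlongrightarrow> 0) at_top"
      by (rule tendsto_divide_0[OF key filterlim_at_top_imp_at_infinity[OF l]])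
    then show ?thesis
      by (rule Lim_transform_eventually) (rule eventually_mono[OF ev], simp)
  qed
  have z1: "((\<lambda>K. \<phi> K (1 + \<i>)) \<longlongrightarrow> complex_of_real x) at_top"
    using tendsto_Complex[OF lim(2) b0] by (simp add: a_def b_def complex_of_real_def)
  then show "((\<lambda>K. \<phi> K (1 + \<i>)) \<longlongrightarrow> complex_of_real x) at_top" .
  show "(\<lambda>K. Im (\<phi> K (1 + \<i>))) \<sim>[at_top] (\<lambda>K. pi * \<sigma> * x / (2 * ln K))"
  proof (rule asymp_equivI')
    have "((\<lambda>K. ln K / pi * b K / (\<sigma> * x / 2)) \<longlongrightarrow> (\<sigma> * x / 2) / (\<sigma> * x / 2)) at_top"
      by (intro tendsto_divide key tendsto_const) (use x \<sigma> in simp)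
    then show "((\<lambda>K. Im (\<phi> K (1 + \<i>)) / (pi * \<sigma> * x / (2 * ln K))) \<longlongrightarrow> 1) at_top"
      using x \<sigma> by (simp add: b_def mult_ac)
  qed
  fix z assume z: "z \<notin> {- complex_of_real x, complex_of_real x}"
  let ?z = "\<lambda>K. \<phi> K (1 + \<i>)"
  have cz: "((\<lambda>K. cnj (?z K)) \<longlongrightarrow> complex_of_real x) at_top"
    using tendsto_cnj[OF z1] by simp
  have nz: "z - of_real x \<noteq> 0" "z + of_real x \<noteq> 0" using z by (auto simp: add_eq_0_iff2)
  have A: "((\<lambda>K. complex_of_real (- (ln K / pi * b K)) * (1 / ((z - ?z K) * (z - cnj (?z K))) - 1 / ((z + ?z K) * (z + cnj (?z K)))))
     \<longlongrightarrow> complex_of_real (- (\<sigma> * x / 2)) * (1 / ((z - of_real x) * (z - of_real x)) - 1 / ((z + of_real x) * (z + of_real x)))) at_top"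
    by (intro tendsto_intros key z1 cz) (use nz in auto)
  have C: "complex_of_real (- (\<sigma> * x / 2)) * (1 / ((z - of_real x) * (z - of_real x)) - 1 / ((z + of_real x) * (z + of_real x))) =
      complex_of_real (\<sigma> * x / 2) * (- 1 / (z - complex_of_real x)\<^sup>2 + 1 / (z + complex_of_real x)\<^sup>2)"
    by (simp add: power2_eq_square algebra_simps)
  have B: "\<forall>\<^sub>F K in at_top. complex_of_real (- (ln K / pi * b K)) * (1 / ((z - ?z K) * (z - cnj (?z K))) - 1 / ((z + ?z K) * (z + cnj (?z K)))) = eta K (\<phi> K) z"
  proof -
    have "\<forall>\<^sub>F K in at_top. ?z K \<noteq> z" "\<forall>\<^sub>F K in at_top. cnj (?z K) \<noteq> z"
      "\<forall>\<^sub>F K in at_top. ?z K \<noteq> - z" "\<forall>\<^sub>F K in at_top. cnj (?z K) \<noteq> - z"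
      using z by (auto intro!: tendsto_imp_eventually_ne[OF z1] tendsto_imp_eventually_ne[OF cz])
    then show ?thesis using ev
    proof eventually_elim
      case (elim K)
      then have "z \<noteq> - ?z K" "z \<noteq> - cnj (?z K)" by (metis minus_minus)+
      then show ?case
        unfolding b_def
        by (intro square_solution.eta_factored[OF sol, symmetric]) (use elim in auto)
    qed
  qed
  show "((\<lambda>K. eta K (\<phi> K) z) \<longlongrightarrow>
      complex_of_real (\<sigma> * x / 2) * (- 1 / (z - complex_of_real x)\<^sup>2 + 1 / (z + complex_of_real x)\<^sup>2)) at_top"
    using Lim_transform_eventually[OF A B] unfolding C .
qed

end
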